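(* Let $\mathcal M$ be a complete $n$-dimensional Riemannian manifold with a retraction $R$ and an associated vector transport $\mathcal T$, and let $f:\mathcal M\to\mathbb R$ be locally Lipschitz continuous. Assume that (1) $\mathcal T$ is isometric and satisfies the locking condition $\mathcal T_{\xi_x}(\xi_x)=\beta_{\xi_x}^{-1}\,\mathrm DR_x(\xi_x)[\xi_x]$; (2) ${\rm Inj}_R(\mathcal M)>0$; (3) the sublevel set $\{x\in\mathcal M: f(x)\le f(x_1)\}$ is bounded, where $x_1$ is the initial iterate. If Algorithm RQNBM (described in the context), run with tolerance $\varepsilon=0$, generates an infinite number of serious steps, then every cluster point $x^*$ of the sequence $\{x_k\}$ is a stationary point of $f$ on $\mathcal M$, i.e. $0_{x^*}\in\partial f(x^* )$.
   Context: Notation. A retraction is a smooth map $R:T\mathcal M\to\mathcal M$ with $R_x(0_x)=x$ and $\mathrm DR_x(0_x)=\mathrm{id}_{T_x\mathcal M}$, where $R_x=R|_{T_x\mathcal M}$. A vector transport associated to $R$ is a continuous map $\mathcal T:T\mathcal M\oplus T\mathcal M\to T\mathcal M$, $(\eta_x,\xi_x)\mapsto\mathcal T_{\eta_x}(\xi_x)$, such that $\mathcal T_{\eta_x}:T_x\mathcal M\to T_{R_x(\eta_x)}\mathcal M$ is linear and invertible and $\mathcal T_{0_x}=\mathrm{id}$; it is isometric if each $\mathcal T_{\eta_x}$ preserves the Riemannian inner product. Put $\beta_{0_x}=1$ and $\beta_{\xi_x}=\|\mathrm DR_x(\xi_x)[\xi_x]\|/\|\xi_x\|$ for $\xi_x\ne0_x$.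 $B(0_x,r)$ is the open ball of radius $r$ in $T_x\mathcal M$; ${\rm Inj}_R(x)=\sup\{r>0: R_x|_{B(0_x,r)}\text{ is injective}\}$ and ${\rm Inj}_R(\mathcal M)=\inf_{x}{\rm Inj}_R(x)$. If $y=R_x(\eta_x)$ with $\|\eta_x\|<{\rm Inj}_R(\mathcal M)$, write $\eta_x=R_x^{-1}(y)$, $\mathcal T_{x\rightarrow y}=\mathcal T_{\eta_x}$, $\mathcal T_{x\leftarrow y}=\mathcal T_{\eta_x}^{-1}$ and $\hat{\mathcal T}_{x\leftarrow y}=\beta_{\eta_x}\mathcal T_{x\leftarrow y}$. For $a\in T_x\mathcal M$, $a^\flat$ is the linear form $v\mapsto\langle a,v\rangle_x$. Riemannian Clarke subdifferential: $\partial f(x):=\partial(f\circ R_x)(0_x)\subseteq T_x\mathcal M$, the Clarke subdifferential at $0_x$ of the pullback on $T_x\mathcal M$ (independent of the retraction). Line-search procedure $\mathrm{LS}(x,d,w,t_{\rm I},t_{\min})$. Fixed parameters: positive $\theta_{\rm A},\theta_{\rm L},\theta_{\rm R},\theta_{\rm T}$ with $\theta_{\rm T}+\theta_{\rm A}<\theta_{\rm R}<\tfrac12$, $\theta_{\rm L}<\theta_{\rm T}$; $\gamma>0$, $\theta>0$, $\kappa\in(0,\tfrac12)$, $\nu\ge1$. (L1) Set $t_{\rm A}=0$, $t=t_{\rm U}=t_{\rm I}$. (L2) Compute $f(R_x(td))$, some $g\in\partial f(R_x(td))$, and $\delta=\max\{|f(x)-f(R_x(td))+t\langle\hat{\mathcal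 T}_{x\leftarrow R_x(td)}(g),d\rangle|,\ \gamma(t\|d\|)^\nu\}$. (L3) If $f(R_x(td))\le f(x)-\theta_{\rm T}tw$, set $t_{\rm A}=t$; otherwise set $t_{\rm U}=t$. (L4) If $f(R_x(td))\le f(x)-\theta_{\rm L}tw$ and either $t\ge t_{\min}$ or $\delta>\theta_{\rm A}w$, return $t_{\rm R}=t_{\rm L}=t$, $\delta$, $\alpha=0$. (L5) If $-\delta+\langle\hat{\mathcal T}_{x\leftarrow R_x(td)}(g),d\rangle\ge-\theta_{\rm R}w$ and $(t-t_{\rm A})\|d\|<\theta$, return $t_{\rm R}=t$, $t_{\rm L}=0$, $\delta$, $\alpha=\delta$. (L6) Choose $t\in[t_{\rm A}+\kappa(t_{\rm U}-t_{\rm A}),t_{\rm U}-\kappa(t_{\rm U}-t_{\rm A})]$ and go to (L2). The output is $(t_{\rm L},t_{\rm R},\delta,\alpha)$. Algorithm RQNBM. Input: $x_1\in\mathcal M$; a symmetric positive-definite operator $\mathcal H_1$ on $T_{x_1}\mathcal M$; $\rho\in(0,1)$, $\Gamma\ge1$, $t_{\min}\in(0,1)$, $t_{\max}\ge1$, $0<\mu_0<{\rm Inj}_R(\mathcal M)$, $D>0$, $\varepsilon\ge0$. Initialize $y_1=x_1$, $g_1\in\partial f(y_1)$, $\tilde g_1=g_1$, $\alpha_1=\tilde\alpha_1=0$, $w_1=\langle\tilde g_1,\tilde g_1\rangle$, $m=1$, $i_{\rm C}=i_{\rm U}=n_{\rm C}=0$. For $k=1,2,\dots$: (a) If $w_k\le\varepsilon$,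 stop and return $x_k$. (b) Set $d_k=-\mathcal H_k\tilde g_k$; select $t_{\rm I}^k\in(0,\min\{t_{\max},\mu_0/\|d_k\|\}]$ (with $\mu_0/0=+\infty$); compute $(t_{\rm L}^k,t_{\rm R}^k,\delta_{k+1},\alpha_{k+1})=\mathrm{LS}(x_k,d_k,w_k,t_{\rm I}^k,t_{\min})$; set $x_{k+1}=R_{x_k}(t_{\rm L}^kd_k)$, $y_{k+1}=R_{x_k}(t_{\rm R}^kd_k)$, and let $g_{k+1}\in\partial f(y_{k+1})$ be the subgradient computed there. Iteration $k$ is a null step if $t_{\rm L}^k=0$ (then $x_{k+1}=x_k$) and a serious step if $t_{\rm L}^k>0$ (then $t_{\rm L}^k=t_{\rm R}^k$, $x_{k+1}=y_{k+1}$). (c) Set $u_k=g_{k+1}-\mathcal T_{x_k\to y_{k+1}}(g_m)$, $s_k=\mathcal T_{x_k\to x_{k+1}}(t_{\rm R}^kd_k)$, $\tilde u_k=\mathcal T_{x_{k+1}\leftarrow y_{k+1}}(u_k)$, $\tilde{\mathcal H}_k=\mathcal T_{x_k\to x_{k+1}}\circ\mathcal H_k\circ\mathcal T_{x_k\leftarrow x_{k+1}}$, $v_k=\tilde{\mathcal H}_k\tilde u_k-s_k$. (d) Null step. Let $\lambda_k=(\lambda_k^{(1)},\lambda_k^{(2)},\lambda_k^{(3)})$ minimize, over $\lambda\ge0$ with $\sum_j\lambda^{(j)}=1$, the function $\|\mathcal H_k^{1/2}(\lambda^{(1)}g_m+\lambda^{(2)}\hat{\mathcal T}_{x_k\leftarrow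 y_{k+1}}(g_{k+1})+\lambda^{(3)}\tilde g_k)\|^2+2(\lambda^{(2)}\alpha_{k+1}+\lambda^{(3)}\tilde\alpha_k)$. Set $\tilde g_{k+1}=\lambda_k^{(1)}g_m+\lambda_k^{(2)}\hat{\mathcal T}_{x_k\leftarrow y_{k+1}}(g_{k+1})+\lambda_k^{(3)}\tilde g_k$ and $\tilde\alpha_{k+1}=\lambda_k^{(2)}\alpha_{k+1}+\lambda_k^{(3)}\tilde\alpha_k$. If $\langle\tilde g_k,v_k\rangle<0$ and either $i_{\rm C}=0$ or [$\rho\|\tilde g_{k+1}\|^2\le\langle\tilde g_{k+1},v_k\rangle^2/\langle\tilde u_k,v_k\rangle$ and $\rho n\le\|v_k\|^2/\langle\tilde u_k,v_k\rangle$], set $i_{\rm U}=1$ and $\check{\mathcal H}_{k+1}=\tilde{\mathcal H}_k-\frac{v_kv_k^\flat}{\tilde u_k^\flat v_k}$ (SR1 update); otherwise set $i_{\rm U}=0$, $\check{\mathcal H}_{k+1}=\tilde{\mathcal H}_k$. (e) Serious step. Set $\tilde g_{k+1}=g_{k+1}$, $\tilde\alpha_{k+1}=0$, $m=k+1$. If $\langle u_k,s_k\rangle>\rho$, set $i_{\rm U}=1$ and $\check{\mathcal H}_{k+1}=\tilde{\mathcal H}_k-\frac{s_k(\tilde{\mathcal H}_k^*u_k)^\flat}{u_k^\flat s_k}-\frac{\tilde{\mathcal H}_ku_ks_k^\flat}{u_k^\flat s_k}+\frac{a_ks_ks_k^\flat}{(u_k^\flat s_k)^2}$ with $a_k=\langle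 u_k,\tilde{\mathcal H}_ku_k\rangle+\langle u_k,s_k\rangle$ (BFGS update); otherwise set $i_{\rm U}=0$, $\check{\mathcal H}_{k+1}=\tilde{\mathcal H}_k$. (f) If $\|\check{\mathcal H}_{k+1}\tilde g_{k+1}\|>D$, replace $\check{\mathcal H}_{k+1}$ by $(D/\|\check{\mathcal H}_{k+1}\tilde g_{k+1}\|)\check{\mathcal H}_{k+1}$. (g) Set $\check w_{k+1}=\langle\tilde g_{k+1},\check{\mathcal H}_{k+1}\tilde g_{k+1}\rangle+2\tilde\alpha_{k+1}$. If $\check w_{k+1}<\rho\|\tilde g_{k+1}\|^2$ or $i_{\rm C}=i_{\rm U}=1$, set $w_{k+1}=\check w_{k+1}+\rho\|\tilde g_{k+1}\|^2$, $\mathcal H_{k+1}=\check{\mathcal H}_{k+1}+\rho\,\mathrm{id}$, and increase $n_{\rm C}$ by 1; otherwise set $w_{k+1}=\check w_{k+1}$, $\mathcal H_{k+1}=\check{\mathcal H}_{k+1}$. If $n_{\rm C}\ge\Gamma$, set $i_{\rm C}=1$. *)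

theory Defs
  imports "HOL-Analysis.Analysis"
begin

section \<open>Smooth manifolds\<close>

primrec Ck_on :: "nat \<Rightarrow> 'a::real_normed_vector set \<Rightarrow> ('a \<Rightarrow> 'b::real_normed_vector) \<Rightarrow> bool" where
  "Ck_on 0 S f \<longleftrightarrow> continuous_on S f"
| "Ck_on (Suc k) S f \<longleftrightarrow>
     (\<forall>x\<in>S. f differentiable (at x)) \<and> (\<forall>v. Ck_on k S (\<lambda>x. frechet_derivative f (at x) v))"

text \<open>Only used for open subsets of finite-dimensional spaces, where it means \<open>C\<close>-infinity.\<close>

definition smooth_on :: "'a::real_normed_vector set \<Rightarrow> ('a \<Rightarrow> 'b::real_normed_vector) \<Rightarrow> bool" where
  "smooth_on S f \<longleftrightarrow> (\<forall>k. Ck_on k S f)"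

text \<open>A chart is its domain together with its coordinate map; values outside the domain are junk.\<close>

type_synonym ('m, 'e) chart = "'m set \<times> ('m \<Rightarrow> 'e)"

definition chart_image :: "('m, 'e) chart \<Rightarrow> 'e set" where
  "chart_image c = snd c ` fst c"

definition chart_inv :: "('m, 'e) chart \<Rightarrow> 'e \<Rightarrow> 'm" where
  "chart_inv c = inv_into (fst c) (snd c)"

definition smooth_atlas ::
    "('m::{t2_space, second_countable_topology}, 'e::euclidean_space) chart set \<Rightarrow> bool" where
  "smooth_atlas A \<longleftrightarrow>
     (\<forall>c\<in>A. open (fst c) \<and> open (chart_image c) \<and>
            homeomorphism (fst c) (chart_image c) (snd c) (chart_inv c)) \<and>
     (\<Union>c\<in>A. fst c) = UNIV \<and>
     (\<forall>c\<in>A. \<forall>c'\<in>A. smooth_on (snd c ` (fst c \<inter> fst c')) (snd c' \<circ> chart_inv c))"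

text \<open>
  Every point \<open>x\<close> gets a preferred chart \<open>chart_at A x\<close>, and the tangent space at \<open>x\<close> is
  identified with the model space \<open>'e\<close> through the coordinates of that chart.  Hence tangent
  vectors at \<open>x\<close> and linear maps between tangent spaces have types \<open>'e\<close> and \<open>'e \<Rightarrow> 'e\<close>; the base
  points are always passed explicitly.  The preferred chart need not vary continuously with \<open>x\<close>,
  so nothing about the tangent bundle is read off from \<open>'m \<times> 'e\<close> directly: regularity is stated
  in bundle charts, by means of the coordinate changes \<open>to_chart\<close> (tangent vector at \<open>x\<close> to its
  components in the chart \<open>c\<close>) and \<open>from_chart\<close> (components in \<open>c\<close> to the tangent vector at \<open>x\<close>).
\<close>

definition chart_at :: "('m, 'e) chart set \<Rightarrow> 'm \<Rightarrow> ('m, 'e) chart" where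
  "chart_at A x = (SOME c. c \<in> A \<and> x \<in> fst c)"

definition to_chart ::
    "('m, 'e::euclidean_space) chart set \<Rightarrow> ('m, 'e) chart \<Rightarrow> 'm \<Rightarrow> 'e \<Rightarrow> 'e" where
  "to_chart A c x v =
     frechet_derivative (snd c \<circ> chart_inv (chart_at A x)) (at (snd (chart_at A x) x)) v"

definition from_chart ::
    "('m, 'e::euclidean_space) chart set \<Rightarrow> ('m, 'e) chart \<Rightarrow> 'm \<Rightarrow> 'e \<Rightarrow> 'e" where
  "from_chart A c x a = frechet_derivative (snd (chart_at A x) \<circ> chart_inv c) (at (snd c x)) a"


section \<open>Riemannian structure\<close>

type_synonym ('m, 'e) metric = "'m \<Rightarrow> 'e \<Rightarrow> 'e \<Rightarrow> real"

definition riemannian_metric ::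
    "('m::{t2_space, second_countable_topology}, 'e::euclidean_space) chart set \<Rightarrow> ('m, 'e) metric \<Rightarrow> bool"
  where
  "riemannian_metric A G \<longleftrightarrow>
     (\<forall>x. bilinear (G x) \<and> (\<forall>u v. G x u v = G x v u) \<and> (\<forall>v. v \<noteq> 0 \<longrightarrow> 0 < G x v v)) \<and>
     (\<forall>c\<in>A. \<forall>a b. smooth_on (chart_image c)
        (\<lambda>p. let x = chart_inv c p in G x (from_chart A c x a) (from_chart A c x b)))"

definition riemannian_manifold ::
    "('m::{t2_space, second_countable_topology}, 'e::euclidean_space) chart set \<Rightarrow> ('m, 'e) metric \<Rightarrow> bool"
  where
  "riemannian_manifold A G \<longleftrightarrow> smooth_atlas A \<and> riemannian_metric A G"

definition tnorm :: "('m, 'e) metric \<Rightarrow> 'm \<Rightarrow> 'e \<Rightarrow> real" where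
  "tnorm G x v = sqrt (G x v v)"

definition tball :: "('m, 'e) metric \<Rightarrow> 'm \<Rightarrow> real \<Rightarrow> 'e set" where
  "tball G x r = {v. tnorm G x v < r}"

definition C1_curve ::
    "('m::topological_space, 'e::euclidean_space) chart set \<Rightarrow> real \<Rightarrow> real \<Rightarrow> (real \<Rightarrow> 'm) \<Rightarrow> bool" where
  "C1_curve A a b c \<longleftrightarrow> continuous_on {a..b} c \<and>
     (\<forall>(U, \<phi>)\<in>A.
        (\<forall>t\<in>{a..b}. c t \<in> U \<longrightarrow> (\<phi> \<circ> c) differentiable (at t within {a..b})) \<and>
        continuous_on {t\<in>{a..b}. c t \<in> U} (\<lambda>t. vector_derivative (\<phi> \<circ> c) (at t within {a..b})))"

definition piecewise_C1_curve ::
    "('m::topological_space, 'e::euclidean_space) chart set \<Rightarrow> (real \<Rightarrow> 'm) \<Rightarrow> bool" where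
  "piecewise_C1_curve A c \<longleftrightarrow>
     (\<exists>S. finite S \<and>
        (\<forall>a b. 0 \<le> a \<and> a < b \<and> b \<le> 1 \<and> {a<..<b} \<inter> S = {} \<longrightarrow> C1_curve A a b c))"

text \<open>At the finitely many break points the velocity is junk, which the integral ignores.\<close>

definition curve_length ::
    "('m::topological_space, 'e::euclidean_space) chart set \<Rightarrow> ('m, 'e) metric \<Rightarrow> (real \<Rightarrow> 'm) \<Rightarrow> real" where
  "curve_length A G c =
     integral {0..1} (\<lambda>t. tnorm G (c t) (vector_derivative (snd (chart_at A (c t)) \<circ> c) (at t)))"

text \<open>The distance is infinite between different connected components.\<close>

definition riem_dist ::
    "('m::topological_space, 'e::euclidean_space) chart set \<Rightarrow> ('m, 'e) metric \<Rightarrow> 'm \<Rightarrow> 'm \<Rightarrow> ennreal" where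
  "riem_dist A G p q =
     (INF c\<in>{c. piecewise_C1_curve A c \<and> c 0 = p \<and> c 1 = q}. ennreal (curve_length A G c))"

definition riem_complete ::
    "('m::topological_space, 'e::euclidean_space) chart set \<Rightarrow> ('m, 'e) metric \<Rightarrow> bool" where
  "riem_complete A G \<longleftrightarrow>
     (\<forall>X :: nat \<Rightarrow> 'm.
        (\<forall>e>0. \<exists>N. \<forall>i\<ge>N. \<forall>j\<ge>N. riem_dist A G (X i) (X j) < e) \<longrightarrow>
        (\<exists>l. (\<lambda>i. riem_dist A G (X i) l) \<longlonglongrightarrow> 0))"

definition riem_bounded ::
    "('m::topological_space, 'e::euclidean_space) chart set \<Rightarrow> ('m, 'e) metric \<Rightarrow> 'm set \<Rightarrow> bool" where
  "riem_bounded A G B \<longleftrightarrow> (\<exists>p. \<exists>r::real. \<forall>x\<in>B. riem_dist A G p x \<le> ennreal r)"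

definition riem_locally_lipschitz ::
    "('m::topological_space, 'e::euclidean_space) chart set \<Rightarrow> ('m, 'e) metric \<Rightarrow> ('m \<Rightarrow> real) \<Rightarrow> bool" where
  "riem_locally_lipschitz A G f \<longleftrightarrow>
     (\<forall>x. \<exists>U L. open U \<and> x \<in> U \<and> 0 < L \<and>
        (\<forall>y\<in>U. \<forall>z\<in>U. ennreal \<bar>f y - f z\<bar> \<le> ennreal L * riem_dist A G y z))"


section \<open>Retractions and vector transports\<close>

text \<open>\<open>DR A R x \<xi>\<close> maps the tangent space at \<open>x\<close> to the one at \<open>R x \<xi>\<close>.\<close>

definition DR ::
    "('m, 'e::euclidean_space) chart set \<Rightarrow> ('m \<Rightarrow> 'e \<Rightarrow> 'm) \<Rightarrow> 'm \<Rightarrow> 'e \<Rightarrow> 'e \<Rightarrow> 'e" where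
  "DR A R x \<xi> \<eta> = frechet_derivative (\<lambda>\<zeta>. snd (chart_at A (R x \<xi>)) (R x \<zeta>)) (at \<xi>) \<eta>"

text \<open>
  Smoothness of \<open>R\<close> as a map on the tangent bundle.  Requiring the sets \<open>S\<close> to be open
  amounts to continuity of \<open>R\<close>.
\<close>

definition manifold_retraction ::
    "('m::topological_space, 'e::euclidean_space) chart set \<Rightarrow> ('m \<Rightarrow> 'e \<Rightarrow> 'm) \<Rightarrow> bool" where
  "manifold_retraction A R \<longleftrightarrow>
     (\<forall>c\<in>A. \<forall>c'\<in>A.
        let Rc = (\<lambda>(p, a). R (chart_inv c p) (from_chart A c (chart_inv c p) a));
            S = {(p, a). p \<in> chart_image c \<and> Rc (p, a) \<in> fst c'}
        in open S \<and> smooth_on S (snd c' \<circ> Rc)) \<and>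
     (\<forall>x. R x 0 = x) \<and> (\<forall>x \<eta>. DR A R x 0 \<eta> = \<eta>)"

definition vector_transport ::
    "('m::topological_space, 'e::euclidean_space) chart set \<Rightarrow> ('m \<Rightarrow> 'e \<Rightarrow> 'm) \<Rightarrow>
     ('m \<Rightarrow> 'e \<Rightarrow> 'e \<Rightarrow> 'e) \<Rightarrow> bool" where
  "vector_transport A R T \<longleftrightarrow>
     (\<forall>c\<in>A. \<forall>c'\<in>A.
        continuous_on
          {(p, a, b). p \<in> chart_image c \<and>
             R (chart_inv c p) (from_chart A c (chart_inv c p) a) \<in> fst c'}
          (\<lambda>(p, a, b).
             let x = chart_inv c p; \<eta> = from_chart A c x a; \<xi> = from_chart A c x b
             in (snd c' (R x \<eta>), to_chart A c' (R x \<eta>) (T x \<eta> \<xi>)))) \<and>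
     (\<forall>x \<eta>. linear (T x \<eta>) \<and> bij (T x \<eta>)) \<and>
     (\<forall>x \<xi>. T x 0 \<xi> = \<xi>)"

definition isometric_transport ::
    "('m, 'e) metric \<Rightarrow> ('m \<Rightarrow> 'e \<Rightarrow> 'm) \<Rightarrow> ('m \<Rightarrow> 'e \<Rightarrow> 'e \<Rightarrow> 'e) \<Rightarrow> bool" where
  "isometric_transport G R T \<longleftrightarrow>
     (\<forall>x \<eta> \<xi> \<zeta>. G (R x \<eta>) (T x \<eta> \<xi>) (T x \<eta> \<zeta>) = G x \<xi> \<zeta>)"

definition beta ::
    "('m, 'e::euclidean_space) chart set \<Rightarrow> ('m, 'e) metric \<Rightarrow> ('m \<Rightarrow> 'e \<Rightarrow> 'm) \<Rightarrow> 'm \<Rightarrow> 'e \<Rightarrow> real" where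
  "beta A G R x \<xi> = (if \<xi> = 0 then 1 else tnorm G (R x \<xi>) (DR A R x \<xi> \<xi>) / tnorm G x \<xi>)"

definition locking_condition ::
    "('m, 'e::euclidean_space) chart set \<Rightarrow> ('m, 'e) metric \<Rightarrow> ('m \<Rightarrow> 'e \<Rightarrow> 'm) \<Rightarrow>
     ('m \<Rightarrow> 'e \<Rightarrow> 'e \<Rightarrow> 'e) \<Rightarrow> bool" where
  "locking_condition A G R T \<longleftrightarrow>
     (\<forall>x \<xi>. T x \<xi> \<xi> = inverse (beta A G R x \<xi>) *\<^sub>R DR A R x \<xi> \<xi>)"

definition Inj_at :: "('m, 'e) metric \<Rightarrow> ('m \<Rightarrow> 'e \<Rightarrow> 'm) \<Rightarrow> 'm \<Rightarrow> ereal" where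
  "Inj_at G R x = (SUP r\<in>{r::real. 0 < r \<and> inj_on (R x) (tball G x r)}. ereal r)"

definition Inj :: "('m, 'e) metric \<Rightarrow> ('m \<Rightarrow> 'e \<Rightarrow> 'm) \<Rightarrow> ereal" where
  "Inj G R = (INF x. Inj_at G R x)"

definition Rinv :: "('m, 'e) metric \<Rightarrow> ('m \<Rightarrow> 'e \<Rightarrow> 'm) \<Rightarrow> 'm \<Rightarrow> 'm \<Rightarrow> 'e" where
  "Rinv G R x y = (THE \<eta>. R x \<eta> = y \<and> ereal (tnorm G x \<eta>) < Inj G R)"

text \<open>
  \<open>transp_to\<close>, \<open>transp_from\<close> and \<open>transp_from_hat\<close> applied to \<open>x y\<close> are the operators
  with subscripts \<open>x \<rightarrow> y\<close>, \<open>x \<leftarrow> y\<close>, and \<open>x \<leftarrow> y\<close> with a hat.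
\<close>

definition transp_to ::
    "('m, 'e) metric \<Rightarrow> ('m \<Rightarrow> 'e \<Rightarrow> 'm) \<Rightarrow> ('m \<Rightarrow> 'e \<Rightarrow> 'e \<Rightarrow> 'e) \<Rightarrow> 'm \<Rightarrow> 'm \<Rightarrow> 'e \<Rightarrow> 'e" where
  "transp_to G R T x y = T x (Rinv G R x y)"

definition transp_from ::
    "('m, 'e) metric \<Rightarrow> ('m \<Rightarrow> 'e \<Rightarrow> 'm) \<Rightarrow> ('m \<Rightarrow> 'e \<Rightarrow> 'e \<Rightarrow> 'e) \<Rightarrow> 'm \<Rightarrow> 'm \<Rightarrow> 'e \<Rightarrow> 'e" where
  "transp_from G R T x y = inv (T x (Rinv G R x y))"

definition transp_from_hat ::
    "('m, 'e::euclidean_space) chart set \<Rightarrow> ('m, 'e) metric \<Rightarrow> ('m \<Rightarrow> 'e \<Rightarrow> 'm) \<Rightarrow>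
     ('m \<Rightarrow> 'e \<Rightarrow> 'e \<Rightarrow> 'e) \<Rightarrow> 'm \<Rightarrow> 'm \<Rightarrow> 'e \<Rightarrow> 'e" where
  "transp_from_hat A G R T x y \<xi> = beta A G R x (Rinv G R x y) *\<^sub>R transp_from G R T x y \<xi>"


section \<open>Clarke subdifferential\<close>

definition clarke_dd :: "('e::euclidean_space \<Rightarrow> real) \<Rightarrow> 'e \<Rightarrow> 'e \<Rightarrow> ereal" where
  "clarke_dd h z v =
     Limsup (nhds z \<times>\<^sub>F at_right 0) (\<lambda>(y, t). ereal ((h (y + t *\<^sub>R v) - h y) / t))"

text \<open>Clarke subdifferential on the space \<open>'e\<close> equipped with the inner product \<open>ip\<close>.\<close>

definition clarke_subdiff ::
    "('e::euclidean_space \<Rightarrow> 'e \<Rightarrow> real) \<Rightarrow> ('e \<Rightarrow> real) \<Rightarrow> 'e \<Rightarrow> 'e set" where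
  "clarke_subdiff ip h z = {\<xi>. \<forall>v. ereal (ip \<xi> v) \<le> clarke_dd h z v}"

definition riem_subdiff ::
    "('m, 'e::euclidean_space) metric \<Rightarrow> ('m \<Rightarrow> 'e \<Rightarrow> 'm) \<Rightarrow> ('m \<Rightarrow> real) \<Rightarrow> 'm \<Rightarrow> 'e set" where
  "riem_subdiff G R f x = clarke_subdiff (G x) (f \<circ> R x) 0"


section \<open>Operators on a tangent space\<close>

definition flat :: "('m, 'e) metric \<Rightarrow> 'm \<Rightarrow> 'e \<Rightarrow> 'e \<Rightarrow> real" where
  "flat G x a = (\<lambda>v. G x a v)"

definition rank_one :: "'e::real_vector \<Rightarrow> ('e \<Rightarrow> real) \<Rightarrow> 'e \<Rightarrow> 'e" where
  "rank_one b \<omega> = (\<lambda>v. \<omega> v *\<^sub>R b)"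

definition riem_adjoint :: "('m, 'e) metric \<Rightarrow> 'm \<Rightarrow> ('e \<Rightarrow> 'e) \<Rightarrow> 'e \<Rightarrow> 'e" where
  "riem_adjoint G x H = (SOME H'. \<forall>u v. G x (H u) v = G x u (H' v))"

definition spd_operator :: "('m, 'e::euclidean_space) metric \<Rightarrow> 'm \<Rightarrow> ('e \<Rightarrow> 'e) \<Rightarrow> bool" where
  "spd_operator G x H \<longleftrightarrow>
     linear H \<and> (\<forall>u v. G x (H u) v = G x u (H v)) \<and> (\<forall>u. u \<noteq> 0 \<longrightarrow> 0 < G x (H u) u)"

definition op_sqrt :: "('m, 'e::euclidean_space) metric \<Rightarrow> 'm \<Rightarrow> ('e \<Rightarrow> 'e) \<Rightarrow> 'e \<Rightarrow> 'e" where
  "op_sqrt G x H = (SOME S. spd_operator G x S \<and> S \<circ> S = H)"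


section \<open>Line search\<close>

record ls_params =
  \<theta>\<^sub>A :: real
  \<theta>\<^sub>L :: real
  \<theta>\<^sub>R :: real
  \<theta>\<^sub>T :: real
  \<gamma>\<^sub>l\<^sub>s :: real
  \<theta>\<^sub>l\<^sub>s :: real
  \<kappa>\<^sub>l\<^sub>s :: real
  \<nu>\<^sub>l\<^sub>s :: real

definition valid_ls_params :: "ls_params \<Rightarrow> bool" where
  "valid_ls_params L \<longleftrightarrow>
     0 < \<theta>\<^sub>A L \<and> 0 < \<theta>\<^sub>L L \<and> 0 < \<theta>\<^sub>R L \<and> 0 < \<theta>\<^sub>T L \<and>
     \<theta>\<^sub>T L + \<theta>\<^sub>A L < \<theta>\<^sub>R L \<and> \<theta>\<^sub>R L < 1/2 \<and> \<theta>\<^sub>L L < \<theta>\<^sub>T L \<and>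
     0 < \<gamma>\<^sub>l\<^sub>s L \<and> 0 < \<theta>\<^sub>l\<^sub>s L \<and> 0 < \<kappa>\<^sub>l\<^sub>s L \<and> \<kappa>\<^sub>l\<^sub>s L < 1/2 \<and> 1 \<le> \<nu>\<^sub>l\<^sub>s L"

definition ls_slope ::
    "('m, 'e::euclidean_space) chart set \<Rightarrow> ('m, 'e) metric \<Rightarrow> ('m \<Rightarrow> 'e \<Rightarrow> 'm) \<Rightarrow>
     ('m \<Rightarrow> 'e \<Rightarrow> 'e \<Rightarrow> 'e) \<Rightarrow> 'm \<Rightarrow> 'e \<Rightarrow> real \<Rightarrow> 'e \<Rightarrow> real" where
  "ls_slope A G R T x d t g = G x (transp_from_hat A G R T x (R x (t *\<^sub>R d)) g) d"

definition ls_delta ::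
    "('m, 'e::euclidean_space) chart set \<Rightarrow> ('m, 'e) metric \<Rightarrow> ('m \<Rightarrow> 'e \<Rightarrow> 'm) \<Rightarrow>
     ('m \<Rightarrow> 'e \<Rightarrow> 'e \<Rightarrow> 'e) \<Rightarrow> ('m \<Rightarrow> real) \<Rightarrow> ls_params \<Rightarrow> 'm \<Rightarrow> 'e \<Rightarrow> real \<Rightarrow> 'e \<Rightarrow> real" where
  "ls_delta A G R T f L x d t g =
     max \<bar>f x - f (R x (t *\<^sub>R d)) + t * ls_slope A G R T x d t g\<bar>
         (\<gamma>\<^sub>l\<^sub>s L * (t * tnorm G x d) powr \<nu>\<^sub>l\<^sub>s L)"

definition decrease :: "('m \<Rightarrow> 'e::real_vector \<Rightarrow> 'm) \<Rightarrow> ('m \<Rightarrow> real) \<Rightarrow> real \<Rightarrow> 'm \<Rightarrow> 'e \<Rightarrow> real \<Rightarrow> real \<Rightarrow> bool"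
  where
  "decrease R f \<sigma> x d w t \<longleftrightarrow> f (R x (t *\<^sub>R d)) \<le> f x - \<sigma> * t * w"

definition ls_serious_exit ::
    "('m \<Rightarrow> 'e::real_vector \<Rightarrow> 'm) \<Rightarrow> ('m \<Rightarrow> real) \<Rightarrow> ls_params \<Rightarrow> 'm \<Rightarrow> 'e \<Rightarrow> real \<Rightarrow> real \<Rightarrow> real \<Rightarrow> real \<Rightarrow> bool"
  where
  "ls_serious_exit R f L x d w t\<^sub>m\<^sub>i\<^sub>n t \<delta> \<longleftrightarrow>
     decrease R f (\<theta>\<^sub>L L) x d w t \<and> (t\<^sub>m\<^sub>i\<^sub>n \<le> t \<or> \<theta>\<^sub>A L * w < \<delta>)"

definition ls_null_exit ::
    "('m, 'e::euclidean_space) chart set \<Rightarrow> ('m, 'e) metric \<Rightarrow> ('m \<Rightarrow> 'e \<Rightarrow> 'm) \<Rightarrow>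
     ('m \<Rightarrow> 'e \<Rightarrow> 'e \<Rightarrow> 'e) \<Rightarrow> ls_params \<Rightarrow> 'm \<Rightarrow> 'e \<Rightarrow> real \<Rightarrow> real \<Rightarrow> real \<Rightarrow> 'e \<Rightarrow> real \<Rightarrow> bool" where
  "ls_null_exit A G R T L x d w t\<^sub>A t g \<delta> \<longleftrightarrow>
     - \<delta> + ls_slope A G R T x d t g \<ge> - (\<theta>\<^sub>R L * w) \<and> (t - t\<^sub>A) * tnorm G x d < \<theta>\<^sub>l\<^sub>s L"

text \<open>
  \<open>ls_loop \<dots> t\<^sub>A t\<^sub>U t out g\<close>: with the current values \<open>t\<^sub>A\<close>, \<open>t\<^sub>U\<close>, \<open>t\<close>, the procedure can
  terminate with output \<open>out = (t\<^sub>L, t\<^sub>R, \<delta>, \<alpha>)\<close>, \<open>g\<close> being the subgradient computed last.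
  It is a relation because subgradients and step sizes are chosen freely.  The primed
  \<open>t\<^sub>A'\<close>, \<open>t\<^sub>U'\<close> are the bracket after the sufficient decrease test.
\<close>

inductive ls_loop ::
    "('m, 'e::euclidean_space) chart set \<Rightarrow> ('m, 'e) metric \<Rightarrow> ('m \<Rightarrow> 'e \<Rightarrow> 'm) \<Rightarrow>
     ('m \<Rightarrow> 'e \<Rightarrow> 'e \<Rightarrow> 'e) \<Rightarrow> ('m \<Rightarrow> real) \<Rightarrow> ls_params \<Rightarrow> 'm \<Rightarrow> 'e \<Rightarrow> real \<Rightarrow> real \<Rightarrow>
     real \<Rightarrow> real \<Rightarrow> real \<Rightarrow> real \<times> real \<times> real \<times> real \<Rightarrow> 'e \<Rightarrow> bool"
  for A G R T f L x d w t\<^sub>m\<^sub>i\<^sub>n where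
  serious:
    "\<lbrakk>g \<in> riem_subdiff G R f (R x (t *\<^sub>R d)); \<delta> = ls_delta A G R T f L x d t g;
      ls_serious_exit R f L x d w t\<^sub>m\<^sub>i\<^sub>n t \<delta>\<rbrakk>
     \<Longrightarrow> ls_loop A G R T f L x d w t\<^sub>m\<^sub>i\<^sub>n t\<^sub>A t\<^sub>U t (t, t, \<delta>, 0) g"
| null:
    "\<lbrakk>g \<in> riem_subdiff G R f (R x (t *\<^sub>R d)); \<delta> = ls_delta A G R T f L x d t g;
      t\<^sub>A' = (if decrease R f (\<theta>\<^sub>T L) x d w t then t else t\<^sub>A);
      \<not> ls_serious_exit R f L x d w t\<^sub>m\<^sub>i\<^sub>n t \<delta>;
      ls_null_exit A G R T L x d w t\<^sub>A' t g \<delta>\<rbrakk>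
     \<Longrightarrow> ls_loop A G R T f L x d w t\<^sub>m\<^sub>i\<^sub>n t\<^sub>A t\<^sub>U t (0, t, \<delta>, \<delta>) g"
| loop:
    "\<lbrakk>g \<in> riem_subdiff G R f (R x (t *\<^sub>R d)); \<delta> = ls_delta A G R T f L x d t g;
      t\<^sub>A' = (if decrease R f (\<theta>\<^sub>T L) x d w t then t else t\<^sub>A);
      t\<^sub>U' = (if decrease R f (\<theta>\<^sub>T L) x d w t then t\<^sub>U else t);
      \<not> ls_serious_exit R f L x d w t\<^sub>m\<^sub>i\<^sub>n t \<delta>;
      \<not> ls_null_exit A G R T L x d w t\<^sub>A' t g \<delta>;
      t' \<in> {t\<^sub>A' + \<kappa>\<^sub>l\<^sub>s L * (t\<^sub>U' - t\<^sub>A') .. t\<^sub>U' - \<kappa>\<^sub>l\<^sub>s L * (t\<^sub>U' - t\<^sub>A')};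
      ls_loop A G R T f L x d w t\<^sub>m\<^sub>i\<^sub>n t\<^sub>A' t\<^sub>U' t' out g'\<rbrakk>
     \<Longrightarrow> ls_loop A G R T f L x d w t\<^sub>m\<^sub>i\<^sub>n t\<^sub>A t\<^sub>U t out g'"

definition line_search ::
    "('m, 'e::euclidean_space) chart set \<Rightarrow> ('m, 'e) metric \<Rightarrow> ('m \<Rightarrow> 'e \<Rightarrow> 'm) \<Rightarrow>
     ('m \<Rightarrow> 'e \<Rightarrow> 'e \<Rightarrow> 'e) \<Rightarrow> ('m \<Rightarrow> real) \<Rightarrow> ls_params \<Rightarrow> 'm \<Rightarrow> 'e \<Rightarrow> real \<Rightarrow> real \<Rightarrow> real \<Rightarrow>
     real \<times> real \<times> real \<times> real \<Rightarrow> 'e \<Rightarrow> bool" where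
  "line_search A G R T f L x d w t\<^sub>I t\<^sub>m\<^sub>i\<^sub>n out g \<longleftrightarrow>
     ls_loop A G R T f L x d w t\<^sub>m\<^sub>i\<^sub>n 0 t\<^sub>I t\<^sub>I out g"


section \<open>Algorithm RQNBM\<close>

record rq_params =
  \<rho>\<^sub>r\<^sub>q :: real
  \<Gamma>\<^sub>r\<^sub>q :: real
  tmin\<^sub>r\<^sub>q :: real
  tmax\<^sub>r\<^sub>q :: real
  \<mu>\<^sub>r\<^sub>q :: real
  D\<^sub>r\<^sub>q :: real
  \<epsilon>\<^sub>r\<^sub>q :: real

definition valid_rq_params :: "('m, 'e) metric \<Rightarrow> ('m \<Rightarrow> 'e \<Rightarrow> 'm) \<Rightarrow> rq_params \<Rightarrow> bool" where
  "valid_rq_params G R P \<longleftrightarrow>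
     0 < \<rho>\<^sub>r\<^sub>q P \<and> \<rho>\<^sub>r\<^sub>q P < 1 \<and> 1 \<le> \<Gamma>\<^sub>r\<^sub>q P \<and> 0 < tmin\<^sub>r\<^sub>q P \<and> tmin\<^sub>r\<^sub>q P < 1 \<and> 1 \<le> tmax\<^sub>r\<^sub>q P \<and>
     0 < \<mu>\<^sub>r\<^sub>q P \<and> ereal (\<mu>\<^sub>r\<^sub>q P) < Inj G R \<and> 0 < D\<^sub>r\<^sub>q P \<and> 0 \<le> \<epsilon>\<^sub>r\<^sub>q P"

text \<open>
  The values produced by a run; index \<open>k\<close> (starting at 1) is the iteration counter.
  \<open>gts\<close>, \<open>alts\<close> hold the aggregate quantities (with tildes), \<open>Hcs\<close> the operators with a
  check mark after they have been scaled to meet the bound \<open>D\<close>.  \<open>iCs k\<close>, \<open>iUs k\<close>, \<open>nCs k\<close>, \<open>ms k\<close> are the values at the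
  beginning of iteration \<open>k\<close>.
\<close>

record ('m, 'e) rq_run =
  xs :: "nat \<Rightarrow> 'm"
  ys :: "nat \<Rightarrow> 'm"
  gs :: "nat \<Rightarrow> 'e"
  gts :: "nat \<Rightarrow> 'e"
  als :: "nat \<Rightarrow> real"
  alts :: "nat \<Rightarrow> real"
  dels :: "nat \<Rightarrow> real"
  ws :: "nat \<Rightarrow> real"
  ds :: "nat \<Rightarrow> 'e"
  tIs :: "nat \<Rightarrow> real"
  tLs :: "nat \<Rightarrow> real"
  tRs :: "nat \<Rightarrow> real"
  lams :: "nat \<Rightarrow> real \<times> real \<times> real"
  Hs :: "nat \<Rightarrow> 'e \<Rightarrow> 'e"
  Hcs :: "nat \<Rightarrow> 'e \<Rightarrow> 'e"
  ms :: "nat \<Rightarrow> nat"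
  iCs :: "nat \<Rightarrow> bool"
  iUs :: "nat \<Rightarrow> bool"
  nCs :: "nat \<Rightarrow> nat"

definition simplex3 :: "(real \<times> real \<times> real) set" where
  "simplex3 = {(l1, l2, l3). 0 \<le> l1 \<and> 0 \<le> l2 \<and> 0 \<le> l3 \<and> l1 + l2 + l3 = 1}"

definition comb3 :: "'e::real_vector \<Rightarrow> 'e \<Rightarrow> 'e \<Rightarrow> real \<times> real \<times> real \<Rightarrow> 'e" where
  "comb3 a b c = (\<lambda>(l1, l2, l3). l1 *\<^sub>R a + l2 *\<^sub>R b + l3 *\<^sub>R c)"

definition sr1_update ::
    "('m, 'e::euclidean_space) metric \<Rightarrow> 'm \<Rightarrow> ('e \<Rightarrow> 'e) \<Rightarrow> 'e \<Rightarrow> 'e \<Rightarrow> 'e \<Rightarrow> 'e" where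
  "sr1_update G x H u v = (\<lambda>z. H z - (1 / flat G x u v) *\<^sub>R rank_one v (flat G x v) z)"

definition bfgs_update ::
    "('m, 'e::euclidean_space) metric \<Rightarrow> 'm \<Rightarrow> ('e \<Rightarrow> 'e) \<Rightarrow> 'e \<Rightarrow> 'e \<Rightarrow> 'e \<Rightarrow> 'e" where
  "bfgs_update G x H u s =
     (let c = flat G x u s; a = G x u (H u) + G x u s in
      (\<lambda>z. H z
         - (1 / c) *\<^sub>R rank_one s (flat G x (riem_adjoint G x H u)) z
         - (1 / c) *\<^sub>R rank_one (H u) (flat G x s) z
         + (a / c\<^sup>2) *\<^sub>R rank_one s (flat G x s) z))"

definition rq_init ::
    "('m, 'e::euclidean_space) metric \<Rightarrow> ('m \<Rightarrow> 'e \<Rightarrow> 'm) \<Rightarrow> ('m \<Rightarrow> real) \<Rightarrow> ('m, 'e) rq_run \<Rightarrow> bool" where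
  "rq_init G R f S \<longleftrightarrow>
     spd_operator G (xs S 1) (Hs S 1) \<and>
     ys S 1 = xs S 1 \<and> gs S 1 \<in> riem_subdiff G R f (ys S 1) \<and> gts S 1 = gs S 1 \<and>
     als S 1 = 0 \<and> alts S 1 = 0 \<and> ws S 1 = G (xs S 1) (gts S 1) (gts S 1) \<and>
     ms S 1 = 1 \<and> \<not> iCs S 1 \<and> \<not> iUs S 1 \<and> nCs S 1 = 0"

text \<open>
  Iteration \<open>k\<close> does not stop and takes the variables from index \<open>k\<close> to index \<open>Suc k\<close>.
\<close>

definition rq_step ::
    "('m, 'e::euclidean_space) chart set \<Rightarrow> ('m, 'e) metric \<Rightarrow> ('m \<Rightarrow> 'e \<Rightarrow> 'm) \<Rightarrow>
     ('m \<Rightarrow> 'e \<Rightarrow> 'e \<Rightarrow> 'e) \<Rightarrow> ('m \<Rightarrow> real) \<Rightarrow> ls_params \<Rightarrow> rq_params \<Rightarrow> ('m, 'e) rq_run \<Rightarrow> nat \<Rightarrow> bool"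
  where
  "rq_step A G R T f L P S k \<longleftrightarrow>
    (let \<rho> = \<rho>\<^sub>r\<^sub>q P; x = xs S k; x' = xs S (Suc k); y' = ys S (Suc k);
         H = Hs S k; d = ds S k; gt = gts S k; gt' = gts S (Suc k);
         gm = gs S (ms S k); g' = gs S (Suc k); \<alpha>' = als S (Suc k);
         null = (tLs S k = 0);
         u = g' - transp_to G R T x y' gm;
         s = transp_to G R T x x' (tRs S k *\<^sub>R d);
         ut = transp_from G R T x' y' u;
         Ht = transp_to G R T x x' \<circ> H \<circ> transp_from G R T x x';
         v = Ht ut - s;
         Hu = (if \<not> iUs S (Suc k) then Ht
               else if null then sr1_update G x' Ht ut v
               else bfgs_update G x' Ht u s);
         Hc' = Hcs S (Suc k);
         wc' = G x' gt' (Hc' gt') + 2 * alts S (Suc k);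
         correct = (wc' < \<rho> * (tnorm G x' gt')\<^sup>2 \<or> iCs S k \<and> iUs S (Suc k))
     in
       ws S k > \<epsilon>\<^sub>r\<^sub>q P \<and>
       d = - H gt \<and>
       0 < tIs S k \<and> tIs S k \<le> tmax\<^sub>r\<^sub>q P \<and> (d \<noteq> 0 \<longrightarrow> tIs S k \<le> \<mu>\<^sub>r\<^sub>q P / tnorm G x d) \<and>
       line_search A G R T f L x d (ws S k) (tIs S k) (tmin\<^sub>r\<^sub>q P)
         (tLs S k, tRs S k, dels S (Suc k), \<alpha>') g' \<and>
       x' = R x (tLs S k *\<^sub>R d) \<and> y' = R x (tRs S k *\<^sub>R d) \<and>
       (if null then
          let comb = comb3 gm (transp_from_hat A G R T x y' g') gt;
              acomb = comb3 0 \<alpha>' (alts S k)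
          in is_arg_min (\<lambda>l. (tnorm G x (op_sqrt G x H (comb l)))\<^sup>2 + 2 * acomb l)
               (\<lambda>l. l \<in> simplex3) (lams S k) \<and>
             gt' = comb (lams S k) \<and> alts S (Suc k) = acomb (lams S k) \<and> ms S (Suc k) = ms S k \<and>
             (iUs S (Suc k) \<longleftrightarrow>
                G x' gt v < 0 \<and>
                (\<not> iCs S k \<or>
                 \<rho> * (tnorm G x' gt')\<^sup>2 \<le> (G x' gt' v)\<^sup>2 / G x' ut v \<and>
                 \<rho> * real DIM('e) \<le> (tnorm G x' v)\<^sup>2 / G x' ut v))
        else
          gt' = g' \<and> alts S (Suc k) = 0 \<and> ms S (Suc k) = Suc k \<and>
          (iUs S (Suc k) \<longleftrightarrow> G x' u s > \<rho>)) \<and>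
       Hc' = (if tnorm G x' (Hu gt') > D\<^sub>r\<^sub>q P
              then (\<lambda>z. (D\<^sub>r\<^sub>q P / tnorm G x' (Hu gt')) *\<^sub>R Hu z) else Hu) \<and>
       ws S (Suc k) = (if correct then wc' + \<rho> * (tnorm G x' gt')\<^sup>2 else wc') \<and>
       Hs S (Suc k) = (if correct then (\<lambda>z. Hc' z + \<rho> *\<^sub>R z) else Hc') \<and>
       nCs S (Suc k) = (if correct then Suc (nCs S k) else nCs S k) \<and>
       (iCs S (Suc k) \<longleftrightarrow> real (nCs S (Suc k)) \<ge> \<Gamma>\<^sub>r\<^sub>q P \<or> iCs S k))"

text \<open>A run that never stops.\<close>

definition rq_infinite_run ::
    "('m, 'e::euclidean_space) chart set \<Rightarrow> ('m, 'e) metric \<Rightarrow> ('m \<Rightarrow> 'e \<Rightarrow> 'm) \<Rightarrow>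
     ('m \<Rightarrow> 'e \<Rightarrow> 'e \<Rightarrow> 'e) \<Rightarrow> ('m \<Rightarrow> real) \<Rightarrow> ls_params \<Rightarrow> rq_params \<Rightarrow> ('m, 'e) rq_run \<Rightarrow> bool" where
  "rq_infinite_run A G R T f L P S \<longleftrightarrow>
     rq_init G R f S \<and> (\<forall>k\<ge>1. rq_step A G R T f L P S k)"

definition serious_steps :: "('m, 'e) rq_run \<Rightarrow> nat set" where
  "serious_steps S = {k. 1 \<le> k \<and> 0 < tLs S k}"

end

theory Submission
  imports Defs
begin

text \<open>
  Suppose that \<open>x\<^sup>*\<close> is a cluster point and not stationary.  In a chart around \<open>x\<^sup>*\<close> there is
  a direction \<open>b\<close> along which the Clarke directional derivative of \<open>f\<close> is negative, uniformly near
  \<open>x\<^sup>*\<close>.  For \<open>x\<close> near \<open>x\<^sup>*\<close> and small \<open>\<eta>\<close>, every subgradient at \<open>R x \<eta>\<close>, pulled back to \<open>x\<close>, has inner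
  product at most \<open>-\<sigma>\<close> with \<open>b\<close>; for larger \<open>\<eta>\<close> this inner product is merely bounded, but then the
  linearization error is bounded away from \<open>0\<close>.  An aggregate subgradient is a convex combination
  of such pulled back subgradients, so it cannot be small together with its aggregate error, and
  hence \<open>w\<^sub>k\<close> is bounded below near \<open>x\<^sup>*\<close>.  The exit test of the line search then bounds the
  lengths of serious steps from below, so \<open>f\<close> drops by a fixed amount infinitely often although it
  decreases along the iterates to \<open>f x\<^sup>*\<close>.
\<close>

section \<open>Uniform limits and strict derivatives\<close>

text \<open>The obstacle is that the subdifferential at y is defined by pulling \<open>f\<close>
  back along \<open>R y\<close>, a different map for every y, on a tangent space identified with the
  model space through a preferred chart that may jump with y. The negative slope is therefore stated
  as a bound on difference quotients of \<open>f\<close> in one fixed chart, uniform over a ball.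
  Composing with a strictly differentiable map changes such a slope by at most the Lipschitz
  constant times the error in the direction; this does the work of upper semicontinuity of the
  Clarke subdifferential. A bound on aggregates comes from one affine inequality: inner product with
  the descent vector plus \<sigma> is at most K a. The constant K is so large that the locality term
  in a pays for distant subgradients. A small w_k contradicts this because, H_k being semidefinite,
  w_k dominates both \<rho> times the squared norm of the aggregate and twice its error. The scaling
  by D bounds the length of d_k, so a small step size means a short move, whose linearization error
  is too small for the alternative \<delta> > \<theta>_A w in the serious exit.\<close>

lemma uniform_linear_limit:
  fixes F :: "'z \<Rightarrow> 'e::euclidean_space \<Rightarrow> 'b::real_normed_vector"
  assumes "\<forall>\<^sub>F z in Z. linear (F z)" and "linear F0"
    and lim: "\<And>w. ((\<lambda>z. F z w) \<longlongrightarrow> F0 w) Z" and "0 < \<epsilon>"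
  shows "\<forall>\<^sub>F z in Z. \<forall>w. norm (F z w - F0 w) \<le> \<epsilon> * norm w"
proof -
  \<comment> \<open>The errors on the finitely many basis vectors control the error on
    \<open>w\<close>, whose coordinates are at most \<open>norm w\<close>; so pointwise convergence
    is enough.\<close>
  have "((\<lambda>z. \<Sum>i\<in>Basis. norm (F z i - F0 i)) \<longlongrightarrow> (\<Sum>i\<in>(Basis::'e set). 0)) Z"
    by (intro tendsto_sum tendsto_norm_zero LIM_zero lim)
  then have "\<forall>\<^sub>F z in Z. (\<Sum>i\<in>Basis. norm (F z i - F0 i)) < \<epsilon>"
    using \<open>0 < \<epsilon>\<close> by (auto dest: order_tendstoD)
  with assms(1) show ?thesis
  proof eventually_elim
    case (elim z)
    show ?case
    proof
      fix w
      interpret L: linear "\<lambda>w. F z w - F0 w"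
        using elim(1) assms(2) by (rule linear_compose_sub)
      have "F z w - F0 w = F z (\<Sum>i\<in>Basis. (w \<bullet> i) *\<^sub>R i) - F0 (\<Sum>i\<in>Basis. (w \<bullet> i) *\<^sub>R i)"
        by (simp only: euclidean_representation)
      also have "\<dots> = (\<Sum>i\<in>Basis. (w \<bullet> i) *\<^sub>R (F z i - F0 i))"
        by (simp only: L.sum L.scale)
      finally have "norm (F z w - F0 w) = norm (\<Sum>i\<in>Basis. (w \<bullet> i) *\<^sub>R (F z i - F0 i))"
        by (rule arg_cong)
      also have "\<dots> \<le> (\<Sum>i\<in>Basis. norm w * norm (F z i - F0 i))"
        by (intro sum_norm_le) (simp add: mult_right_mono Basis_le_norm)
      also have "\<dots> \<le> norm w * \<epsilon>"
        using elim(2) by (simp flip: sum_distrib_left add: mult_left_mono)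
      finally show "norm (F z w - F0 w) \<le> \<epsilon> * norm w" by (simp add: mult.commute)
    qed
  qed
qed

text \<open>Only the first argument is expanded in the basis, as the linear case is already uniform
  in the second. The tolerance \<epsilon>/n compensates for the n summands.\<close>

lemma uniform_bilinear_limit:
  fixes B :: "'z \<Rightarrow> 'e::euclidean_space \<Rightarrow> 'e \<Rightarrow> real"
  assumes "\<forall>\<^sub>F z in Z. bilinear (B z)" and "bilinear B0"
    and lim: "\<And>a b. ((\<lambda>z. B z a b) \<longlongrightarrow> B0 a b) Z" and "0 < \<epsilon>"
  shows "\<forall>\<^sub>F z in Z. \<forall>a b. \<bar>B z a b - B0 a b\<bar> \<le> \<epsilon> * norm a * norm b"
proof -
  define n where "n = real DIM('e)"
  have "0 < n" by (simp add: n_def)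
  have "\<forall>\<^sub>F z in Z. \<forall>i\<in>Basis. \<forall>b. norm (B z i b - B0 i b) \<le> \<epsilon> / n * norm b"
    unfolding eventually_ball_finite_distrib[OF finite_Basis]
  proof
    fix i :: 'e
    show "\<forall>\<^sub>F z in Z. \<forall>b. norm (B z i b - B0 i b) \<le> \<epsilon> / n * norm b"
    proof (rule uniform_linear_limit)
      show "\<forall>\<^sub>F z in Z. linear (B z i)"
        using assms(1) by eventually_elim (simp add: bilinear_def)
    qed (use assms \<open>0 < n\<close> in \<open>auto simp: bilinear_def\<close>)
  qed
  with assms(1) show ?thesis
  proof eventually_elim
    case (elim z)
    show ?case
    proof (intro allI)
      fix a b
      interpret L: linear "\<lambda>a. B z a b - B0 a b"
        using elim(1) assms(2) by (intro linear_compose_sub) (auto simp: bilinear_def)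
      have "B z a b - B0 a b = B z (\<Sum>i\<in>Basis. (a \<bullet> i) *\<^sub>R i) b - B0 (\<Sum>i\<in>Basis. (a \<bullet> i) *\<^sub>R i) b"
        by (simp only: euclidean_representation)
      also have "\<dots> = (\<Sum>i\<in>Basis. (a \<bullet> i) *\<^sub>R (B z i b - B0 i b))"
        by (simp only: L.sum L.scale)
      finally have "\<bar>B z a b - B0 a b\<bar> = \<bar>\<Sum>i\<in>Basis. (a \<bullet> i) *\<^sub>R (B z i b - B0 i b)\<bar>"
        by (rule arg_cong)
      also have "\<dots> \<le> (\<Sum>i\<in>(Basis::'e set). norm a * (\<epsilon> / n * norm b))"
        unfolding real_norm_def[symmetric]
        by (intro sum_norm_le, simp only: norm_scaleR)
          (intro mult_mono, use elim in \<open>auto simp: Basis_le_norm\<close>)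
      also have "\<dots> = \<epsilon> * norm a * norm b"
        using \<open>0 < n\<close> by (simp add: n_def)
      finally show "\<bar>B z a b - B0 a b\<bar> \<le> \<epsilon> * norm a * norm b" .
    qed
  qed
qed

text \<open>Mean value inequality along the segment from y to y + t v for \<phi> minus its linear
  part at z. The estimate is uniform in y, as the moving base point of a Clarke quotient
  demands.\<close>

lemma strict_derivative:
  fixes \<phi> :: "'a::real_normed_vector \<Rightarrow> 'b::real_normed_vector"
  assumes "\<forall>\<^sub>F \<zeta> in nhds z. (\<phi> has_derivative D \<zeta>) (at \<zeta>)"
    and "((\<lambda>\<zeta>. D \<zeta> v) \<longlongrightarrow> D z v) (nhds z)" and "0 < \<epsilon>"
  shows "\<exists>r>0. \<forall>y\<in>ball z r. \<forall>t. 0 < t \<and> t < r \<longrightarrow>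
           norm (\<phi> (y + t *\<^sub>R v) - \<phi> y - t *\<^sub>R D z v) \<le> \<epsilon> * t"
proof -
  have "\<forall>\<^sub>F \<zeta> in nhds z. (\<phi> has_derivative D \<zeta>) (at \<zeta>) \<and> dist (D \<zeta> v) (D z v) < \<epsilon>"
    using assms by (intro eventually_conj) (auto simp: tendsto_iff)
  then obtain r where "0 < r" and r: "\<And>\<zeta>. dist \<zeta> z < r \<Longrightarrow>
      (\<phi> has_derivative D \<zeta>) (at \<zeta>) \<and> dist (D \<zeta> v) (D z v) < \<epsilon>"
    unfolding eventually_nhds_metric by blast
  \<comment> \<open>Since \<open>r' * (1 + norm v) = r\<close>, the whole segment stays within
    distance r of z.\<close>
  define r' where "r' = r / (1 + norm v)"
  have pos: "0 < 1 + norm v"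
    by (simp add: add_pos_nonneg)
  have "0 < r'"
    unfolding r'_def using \<open>0 < r\<close> pos by simp
  moreover have "norm (\<phi> (y + t *\<^sub>R v) - \<phi> y - t *\<^sub>R D z v) \<le> \<epsilon> * t"
    if y: "y \<in> ball z r'" and t: "0 < t" "t < r'" for y t
  proof -
    have near: "dist (y + \<tau> *\<^sub>R v) z < r" if "\<tau> \<in> {0..t}" for \<tau>
    proof -
      have "dist (y + \<tau> *\<^sub>R v) z = norm ((y - z) + \<tau> *\<^sub>R v)"
        by (simp add: dist_norm algebra_simps)
      also have "\<dots> \<le> norm (y - z) + \<tau> * norm v"
        using that by (intro order_trans[OF norm_triangle_ineq]) simp
      also have "\<dots> \<le> norm (y - z) + t * norm v"
        using that by (intro add_left_mono mult_right_mono) auto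
      also have "\<dots> < r' + r' * norm v"
        using y t by (intro add_less_le_mono mult_right_mono) (auto simp: dist_norm norm_minus_commute)
      also have "\<dots> = r' * (1 + norm v)"
        by (simp add: algebra_simps)
      also have "\<dots> = r"
        using pos by (simp add: r'_def)
      finally show ?thesis .
    qed
    define k where "k = (\<lambda>\<tau>. \<phi> (y + \<tau> *\<^sub>R v) - \<tau> *\<^sub>R D z v)"
    have "norm (k t - k 0) \<le> \<epsilon> * norm (t - 0)"
    proof (rule differentiable_bound[of "{0..t}" k "\<lambda>\<tau> h. h *\<^sub>R (D (y + \<tau> *\<^sub>R v) v - D z v)"])
      fix \<tau> assume \<tau>: "\<tau> \<in> {0..t}"
      have D: "(\<phi> has_derivative D (y + \<tau> *\<^sub>R v)) (at (y + \<tau> *\<^sub>R v))"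
        using r near[OF \<tau>] by blast
      then have lin: "linear (D (y + \<tau> *\<^sub>R v))"
        by (rule has_derivative_linear)
      have "((\<lambda>\<tau>. \<phi> (y + \<tau> *\<^sub>R v)) has_derivative (\<lambda>h. D (y + \<tau> *\<^sub>R v) (h *\<^sub>R v))) (at \<tau> within {0..t})"
        by (rule has_derivative_compose[where f = "\<lambda>\<tau>. y + \<tau> *\<^sub>R v" and g = \<phi> and g' = "D (y + \<tau> *\<^sub>R v)"])
          (auto intro!: derivative_eq_intros D)
      then show "(k has_derivative (\<lambda>h. h *\<^sub>R (D (y + \<tau> *\<^sub>R v) v - D z v))) (at \<tau> within {0..t})"
        unfolding k_def
        by (auto intro!: derivative_eq_intros simp: linear_scale[OF lin] algebra_simps)
      show "onorm (\<lambda>h. h *\<^sub>R (D (y + \<tau> *\<^sub>R v) v - D z v)) \<le> \<epsilon>"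
        using r[OF near[OF \<tau>]]
        by (intro onorm_le) (auto simp: dist_norm mult.commute[of \<epsilon>] intro!: mult_left_mono)
    qed (use t in auto)
    then show ?thesis
      using t by (simp add: k_def algebra_simps)
  qed
  ultimately show ?thesis by blast
qed

section \<open>Clarke directional derivatives\<close>

text \<open>A concrete stand-in for an upper bound \<open>s\<close> on
  \<open>clarke_dd h z v\<close>: it follows from \<open>clarke_dd h z v < s\<close> and implies
  \<open>clarke_dd h z v \<le> s\<close>. The explicit ball lets the same bound be used at base
  points other than the centre.\<close>

definition dquot_le :: "('e::euclidean_space \<Rightarrow> real) \<Rightarrow> 'e \<Rightarrow> 'e \<Rightarrow> real \<Rightarrow> real \<Rightarrow> bool" where
  "dquot_le h z v s r \<longleftrightarrow> (\<forall>y\<in>ball z r. \<forall>t. 0 < t \<and> t < r \<longrightarrow> h (y + t *\<^sub>R v) - h y \<le> s * t)"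

lemma dquot_le_mono: "dquot_le h z v s r \<Longrightarrow> r' \<le> r \<Longrightarrow> dquot_le h z v s r'"
  by (auto simp: dquot_le_def)

lemma clarke_dd_lessD:
  assumes "clarke_dd h z v < ereal s"
  shows "\<exists>r>0. dquot_le h z v s r"
proof -
  have "\<forall>\<^sub>F p in nhds z \<times>\<^sub>F at_right 0. (\<lambda>(y, t). ereal ((h (y + t *\<^sub>R v) - h y) / t)) p < ereal s"
    using assms unfolding clarke_dd_def by (rule Limsup_lessD)
  then obtain Pf Pg where Pf: "eventually Pf (nhds z)" and Pg: "eventually Pg (at_right (0::real))"
    and P: "\<And>y t. Pf y \<Longrightarrow> Pg t \<Longrightarrow> (h (y + t *\<^sub>R v) - h y) / t < s"
    unfolding eventually_prod_filter by auto
  obtain r1 where "0 < r1" and r1: "\<And>y. dist y z < r1 \<Longrightarrow> Pf y"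
    using Pf unfolding eventually_nhds_metric by blast
  obtain r2 where "0 < r2" and r2: "\<And>t. 0 < t \<Longrightarrow> t < r2 \<Longrightarrow> Pg t"
    using Pg unfolding eventually_at_right_field by blast
  have "h (y + t *\<^sub>R v) - h y \<le> s * t" if "y \<in> ball z (min r1 r2)" "0 < t" "t < min r1 r2" for y t
    using P[OF r1 r2, of y t] that by (auto simp: dist_commute field_simps)
  then show ?thesis
    using \<open>0 < r1\<close> \<open>0 < r2\<close> by (intro exI[of _ "min r1 r2"]) (auto simp: dquot_le_def)
qed

lemma clarke_dd_leI:
  assumes "0 < r" and "dquot_le h z v s r"
  shows "clarke_dd h z v \<le> ereal s"
  unfolding clarke_dd_def
proof (rule Limsup_bounded)
  have "\<forall>\<^sub>F y in nhds z. y \<in> ball z r"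
    using assms by (intro eventually_nhds_in_open) auto
  moreover have "\<forall>\<^sub>F t in at_right 0. 0 < t \<and> t < r"
    using assms unfolding eventually_at_right_field by (intro exI[of _ r]) auto
  ultimately have "\<forall>\<^sub>F p in nhds z \<times>\<^sub>F at_right 0. fst p \<in> ball z r \<and> 0 < snd p \<and> snd p < r"
    unfolding eventually_prod_filter by fastforce
  then show "\<forall>\<^sub>F p in nhds z \<times>\<^sub>F at_right 0. (\<lambda>(y, t). ereal ((h (y + t *\<^sub>R v) - h y) / t)) p \<le> ereal s"
    by eventually_elim (use assms(2) in \<open>auto simp: dquot_le_def field_simps\<close>)
qed

text \<open>By the strict derivative, \<open>\<phi> (y + t *\<^sub>R v)\<close> is within t (norm (D
  z v - b) + \<epsilon>) of \<open>\<phi> y + t *\<^sub>R b\<close>, and the Lipschitz bound turns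
  this into a change of \<open>h\<close>. As \<open>\<phi> z\<close> may be any point of the ball,
  one slope bound at \<open>q0\<close> serves all nearby points.\<close>

lemma dquot_le_compose:
  fixes \<phi> :: "'a::euclidean_space \<Rightarrow> 'e::euclidean_space"
  assumes lip: "K-lipschitz_on (ball q0 r0) h" and h: "dquot_le h q0 b s r0"
    and \<phi>0: "\<phi> z \<in> ball q0 r0"
    and D: "\<forall>\<^sub>F \<zeta> in nhds z. (\<phi> has_derivative D \<zeta>) (at \<zeta>)"
    and lim: "((\<lambda>\<zeta>. D \<zeta> v) \<longlongrightarrow> D z v) (nhds z)" and "0 < \<epsilon>"
  shows "\<exists>r>0. dquot_le (h \<circ> \<phi>) z v (s + K * (norm (D z v - b) + \<epsilon>)) r"
proof -
  have "0 \<le> K" using lip by (rule lipschitz_on_nonneg)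
  have "0 < r0" using \<phi>0 by (metis ball_eq_empty empty_iff linorder_not_less)
  have "isCont \<phi> z"
    using eventually_nhds_x_imp_x[OF D] by (rule has_derivative_continuous)
  obtain r1 where "0 < r1" and r1: "\<And>y t. y \<in> ball z r1 \<Longrightarrow> 0 < t \<Longrightarrow> t < r1 \<Longrightarrow>
      norm (\<phi> (y + t *\<^sub>R v) - \<phi> y - t *\<^sub>R D z v) \<le> \<epsilon> * t"
    using strict_derivative[OF D lim \<open>0 < \<epsilon>\<close>] by blast
  have in_ball: "\<forall>\<^sub>F p in nhds (z, 0). k p \<in> ball q0 r0"
    if "k (z, 0) = \<phi> z" "(k \<longlongrightarrow> \<phi> z) (nhds (z, 0::real))" for k
    using topological_tendstoD[OF that(2), of "ball q0 r0"] \<phi>0 by auto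
  have "((\<lambda>p. fst p + snd p *\<^sub>R v) \<longlongrightarrow> fst (z, 0::real) + snd (z, 0::real) *\<^sub>R v) (nhds (z, 0::real))"
    and "((\<lambda>p. fst p) \<longlongrightarrow> fst (z, 0::real)) (nhds (z, 0::real))"
    and "((\<lambda>p. snd p *\<^sub>R b) \<longlongrightarrow> snd (z, 0::real) *\<^sub>R b) (nhds (z, 0::real))"
    by (intro tendsto_intros filterlim_ident)+
  then have lims: "((\<lambda>p. fst p + snd p *\<^sub>R v) \<longlongrightarrow> z) (nhds (z, 0::real))"
             "((\<lambda>p. fst p) \<longlongrightarrow> z) (nhds (z, 0::real))" "((\<lambda>p. snd p *\<^sub>R b) \<longlongrightarrow> 0) (nhds (z, 0::real))"
    by simp_all
  have \<phi>lim: "(\<phi> \<longlongrightarrow> \<phi> z) (nhds z)"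
    using \<open>isCont \<phi> z\<close> by (simp add: isCont_def tendsto_at_iff_tendsto_nhds)
  have "\<forall>\<^sub>F p in nhds (z, 0::real). \<phi> (fst p) \<in> ball q0 r0 \<and> \<phi> (fst p + snd p *\<^sub>R v) \<in> ball q0 r0 \<and>
          \<phi> (fst p) + snd p *\<^sub>R b \<in> ball q0 r0"
  proof (intro eventually_conj in_ball)
    show "((\<lambda>p. \<phi> (fst p)) \<longlongrightarrow> \<phi> z) (nhds (z, 0::real))"
      by (rule filterlim_compose[OF \<phi>lim lims(2)])
    show "((\<lambda>p. \<phi> (fst p + snd p *\<^sub>R v)) \<longlongrightarrow> \<phi> z) (nhds (z, 0::real))"
      by (rule filterlim_compose[OF \<phi>lim lims(1)])
    have "((\<lambda>p. \<phi> (fst p) + snd p *\<^sub>R b) \<longlongrightarrow> \<phi> z + 0) (nhds (z, 0::real))"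
      by (intro tendsto_add lims(3)) (rule filterlim_compose[OF \<phi>lim lims(2)])
    then show "((\<lambda>p. \<phi> (fst p) + snd p *\<^sub>R b) \<longlongrightarrow> \<phi> z) (nhds (z, 0::real))" by simp
  qed auto
  then obtain r2 where "0 < r2" and r2: "\<And>p. dist p (z, 0::real) < r2 \<Longrightarrow> \<phi> (fst p) \<in> ball q0 r0 \<and>
      \<phi> (fst p + snd p *\<^sub>R v) \<in> ball q0 r0 \<and> \<phi> (fst p) + snd p *\<^sub>R b \<in> ball q0 r0"
    unfolding eventually_nhds_metric by blast
  \<comment> \<open>Half of \<open>r2\<close> is left for each component, since (y, t) is within
    dist y z + t of (z, 0).\<close>
  define r where "r = Min {r0, r1, r2 / 2}"
  have "0 < r" "r \<le> r0" "r \<le> r1" "r \<le> r2 / 2"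
    using \<open>0 < r0\<close> \<open>0 < r1\<close> \<open>0 < r2\<close> by (auto simp: r_def)
  have "(h \<circ> \<phi>) (y + t *\<^sub>R v) - (h \<circ> \<phi>) y \<le> (s + K * (norm (D z v - b) + \<epsilon>)) * t"
    if y: "y \<in> ball z r" and t: "0 < t" "t < r" for y t
  proof -
    have "dist (y, t) (z, 0) \<le> dist y z + dist t 0"
      using sqrt_sum_squares_le_sum_abs[of "dist y z" t] by (simp add: dist_Pair_Pair)
    also have "\<dots> < r2"
      using y t \<open>r \<le> r2 / 2\<close> by (simp add: dist_commute)
    finally have B: "\<phi> y \<in> ball q0 r0" "\<phi> (y + t *\<^sub>R v) \<in> ball q0 r0" "\<phi> y + t *\<^sub>R b \<in> ball q0 r0"
      using r2[of "(y, t)"] by auto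
    have "norm (\<phi> (y + t *\<^sub>R v) - (\<phi> y + t *\<^sub>R b))
          = norm ((\<phi> (y + t *\<^sub>R v) - \<phi> y - t *\<^sub>R D z v) + t *\<^sub>R (D z v - b))"
      by (simp add: algebra_simps)
    also have "\<dots> \<le> \<epsilon> * t + t * norm (D z v - b)"
      using r1[of y t] y t \<open>r \<le> r1\<close> by (intro order_trans[OF norm_triangle_ineq] add_mono) auto
    finally have n: "norm (\<phi> (y + t *\<^sub>R v) - (\<phi> y + t *\<^sub>R b)) \<le> (norm (D z v - b) + \<epsilon>) * t"
      by (simp add: algebra_simps)
    have "h (\<phi> (y + t *\<^sub>R v)) - h (\<phi> y + t *\<^sub>R b) \<le> K * norm (\<phi> (y + t *\<^sub>R v) - (\<phi> y + t *\<^sub>R b))"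
      using lipschitz_onD[OF lip B(2,3)] by (simp add: dist_norm)
    also have "\<dots> \<le> K * ((norm (D z v - b) + \<epsilon>) * t)"
      using n \<open>0 \<le> K\<close> by (rule mult_left_mono)
    moreover have "h (\<phi> y + t *\<^sub>R b) - h (\<phi> y) \<le> s * t"
      using h B(1) t \<open>r \<le> r0\<close> by (auto simp: dquot_le_def)
    ultimately show ?thesis by (simp add: algebra_simps)
  qed
  then show ?thesis
    using \<open>0 < r\<close> by (auto simp: dquot_le_def)
qed

lemma isCont_tendsto_nhds: "isCont g l \<Longrightarrow> (g \<longlongrightarrow> g l) (nhds l)"
  by (simp add: isCont_def tendsto_at_iff_tendsto_nhds)

section \<open>Charts and tangent norms\<close>

locale riemannian_retraction =
  fixes A :: "('m::{t2_space, second_countable_topology}, 'e::euclidean_space) chart set"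
    and G :: "('m, 'e) metric"
    and R :: "'m \<Rightarrow> 'e \<Rightarrow> 'm"
    and f :: "'m \<Rightarrow> real"
  assumes riemannian: "riemannian_manifold A G"
    and retraction: "manifold_retraction A R"
    and locally_lipschitz: "riem_locally_lipschitz A G f"
begin

lemma
  assumes "c \<in> A"
  shows open_chart_domain: "open (fst c)" and open_chart_image: "open (chart_image c)"
    and chart_homeomorphism: "homeomorphism (fst c) (chart_image c) (snd c) (chart_inv c)"
  using riemannian assms by (auto simp: riemannian_manifold_def smooth_atlas_def)

lemma chart_at: "chart_at A x \<in> A" "x \<in> fst (chart_at A x)"
proof -
  have "(\<Union>c\<in>A. fst c) = UNIV"
    using riemannian unfolding riemannian_manifold_def smooth_atlas_def by blast
  then have "\<exists>c. c \<in> A \<and> x \<in> fst c" by blast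
  from someI_ex[OF this] show "chart_at A x \<in> A" "x \<in> fst (chart_at A x)"
    by (auto simp: chart_at_def)
qed

lemma chart_inv_snd [simp]: "c \<in> A \<Longrightarrow> x \<in> fst c \<Longrightarrow> chart_inv c (snd c x) = x"
  using chart_homeomorphism unfolding homeomorphism_def by blast

lemma snd_chart_inv [simp]: "c \<in> A \<Longrightarrow> p \<in> chart_image c \<Longrightarrow> snd c (chart_inv c p) = p"
  using chart_homeomorphism unfolding homeomorphism_def by blast

lemma chart_inv_in [simp]: "c \<in> A \<Longrightarrow> p \<in> chart_image c \<Longrightarrow> chart_inv c p \<in> fst c"
  using chart_homeomorphism unfolding homeomorphism_def by blast

lemma chart_in [simp]: "x \<in> fst c \<Longrightarrow> snd c x \<in> chart_image c"
  by (simp add: chart_image_def)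

lemma continuous_on_chart: "c \<in> A \<Longrightarrow> continuous_on (fst c) (snd c)"
  using chart_homeomorphism unfolding homeomorphism_def by blast

lemma continuous_on_chart_inv: "c \<in> A \<Longrightarrow> continuous_on (chart_image c) (chart_inv c)"
  using chart_homeomorphism unfolding homeomorphism_def by blast

lemma open_chart_inv_preimage:
  "c \<in> A \<Longrightarrow> open U \<Longrightarrow> open {p \<in> chart_image c. chart_inv c p \<in> U}"
  using continuous_open_preimage[OF continuous_on_chart_inv open_chart_image]
  by (simp add: vimage_def Int_def)

text \<open>Both \<open>to_chart\<close> and \<open>from_chart\<close> are instances, with the
  preferred chart as target or source, respectively source or target; that they are linear and
  mutually inverse then follows from the chain rule for transition maps.\<close>

definition dtrans :: "('m, 'e) chart \<Rightarrow> ('m, 'e) chart \<Rightarrow> 'm \<Rightarrow> 'e \<Rightarrow> 'e" where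
  "dtrans c c' x = frechet_derivative (snd c' \<circ> chart_inv c) (at (snd c x))"

lemma from_chart_eq: "from_chart A c x = dtrans c (chart_at A x) x"
  and to_chart_eq: "to_chart A c x = dtrans (chart_at A x) c x"
  by (auto simp: from_chart_def to_chart_def dtrans_def)

lemma transition_smooth:
  assumes "c \<in> A" "c' \<in> A"
  shows "smooth_on (snd c ` (fst c \<inter> fst c')) (snd c' \<circ> chart_inv c)"
  using riemannian assms by (auto simp: riemannian_manifold_def smooth_atlas_def)

lemma smooth_on_C1:
  assumes "smooth_on U h"
  shows "p \<in> U \<Longrightarrow> (h has_derivative frechet_derivative h (at p)) (at p)"
    and "continuous_on U (\<lambda>p. frechet_derivative h (at p) v)"
proof -
  have "Ck_on (Suc 0) U h"
    using assms by (simp only: smooth_on_def)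
  then show "p \<in> U \<Longrightarrow> (h has_derivative frechet_derivative h (at p)) (at p)"
    and "continuous_on U (\<lambda>p. frechet_derivative h (at p) v)"
    by (auto simp: frechet_derivative_works)
qed

lemma transition_derivative:
  assumes "c \<in> A" "c' \<in> A" "x \<in> fst c" "x \<in> fst c'"
  shows "((snd c' \<circ> chart_inv c) has_derivative dtrans c c' x) (at (snd c x))"
  unfolding dtrans_def
  by (rule smooth_on_C1(1)[OF transition_smooth[OF assms(1,2)]]) (use assms in auto)

lemma linear_dtrans:
  assumes "c \<in> A" "c' \<in> A" "x \<in> fst c" "x \<in> fst c'"
  shows "linear (dtrans c c' x)"
  using transition_derivative[OF assms] by (rule has_derivative_linear)

lemma dtrans_dtrans:
  assumes "c \<in> A" "c' \<in> A" "c'' \<in> A" "x \<in> fst c" "x \<in> fst c'" "x \<in> fst c''"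
  shows "dtrans c' c'' x (dtrans c c' x a) = dtrans c c'' x a"
proof -
  have *: "((snd c'' \<circ> chart_inv c') has_derivative dtrans c' c'' x) (at ((snd c' \<circ> chart_inv c) (snd c x)))"
    using transition_derivative[of c' c'' x] assms by simp
  have "((snd c'' \<circ> chart_inv c') \<circ> (snd c' \<circ> chart_inv c) has_derivative dtrans c' c'' x \<circ> dtrans c c' x)
          (at (snd c x))"
    by (rule diff_chain_at[OF transition_derivative *]) (use assms in auto)
  \<comment> \<open>The composite is the direct transition map only where \<open>chart_inv c\<close>
    lands in the domain of \<open>c'\<close>; this set is open, so the derivatives agree.\<close>
  then have "((snd c'' \<circ> chart_inv c) has_derivative dtrans c' c'' x \<circ> dtrans c c' x) (at (snd c x))"
    by (rule has_derivative_transform_within_open[OF _ open_chart_inv_preimage[of c "fst c'"]])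
      (use assms open_chart_domain in auto)
  from has_derivative_unique[OF this transition_derivative[of c c'' x]] show ?thesis
    using assms by (auto simp: fun_eq_iff)
qed

lemma dtrans_self:
  assumes "c \<in> A" "x \<in> fst c"
  shows "dtrans c c x a = a"
proof -
  have "((\<lambda>p. p) has_derivative dtrans c c x) (at (snd c x))"
  proof (rule has_derivative_transform_within_open[OF transition_derivative[OF assms(1,1,2,2)] open_chart_image[OF assms(1)]])
    show "snd c x \<in> chart_image c"
      by (rule chart_in[OF assms(2)])
    show "(snd c \<circ> chart_inv c) p = p" if "p \<in> chart_image c" for p
      using snd_chart_inv[OF assms(1) that] by simp
  qed
  from has_derivative_unique[OF this has_derivative_ident] show ?thesis by (simp add: fun_eq_iff)
qed

lemma to_from_chart [simp]: "c \<in> A \<Longrightarrow> x \<in> fst c \<Longrightarrow> to_chart A c x (from_chart A c x a) = a"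
  by (simp add: from_chart_eq to_chart_eq dtrans_dtrans chart_at dtrans_self)

lemma from_to_chart [simp]: "c \<in> A \<Longrightarrow> x \<in> fst c \<Longrightarrow> from_chart A c x (to_chart A c x v) = v"
  by (simp add: from_chart_eq to_chart_eq dtrans_dtrans chart_at dtrans_self)

lemma linear_from_chart: "c \<in> A \<Longrightarrow> x \<in> fst c \<Longrightarrow> linear (from_chart A c x)"
  by (simp add: from_chart_eq linear_dtrans chart_at)

lemma linear_to_chart: "c \<in> A \<Longrightarrow> x \<in> fst c \<Longrightarrow> linear (to_chart A c x)"
  by (simp add: to_chart_eq linear_dtrans chart_at)

section \<open>The metric in coordinates\<close>

lemma bilinear_metric: "bilinear (G x)"
  and metric_commute: "G x u v = G x v u"
  and metric_pos: "v \<noteq> 0 \<Longrightarrow> 0 < G x v v"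
  using riemannian by (auto simp: riemannian_manifold_def riemannian_metric_def)

text \<open>Gram form of the metric in the coordinate frame of \<open>c\<close>. Smoothness is
  available for this function of the coordinates, whereas \<open>G x\<close> refers to the preferred
  chart at \<open>x\<close>, which can jump.\<close>

definition chart_metric :: "('m, 'e) chart \<Rightarrow> 'e \<Rightarrow> 'e \<Rightarrow> 'e \<Rightarrow> real" where
  "chart_metric c p a b = (let x = chart_inv c p in G x (from_chart A c x a) (from_chart A c x b))"

lemma bilinear_chart_metric:
  assumes "c \<in> A" "p \<in> chart_image c"
  shows "bilinear (chart_metric c p)"
  unfolding bilinear_def
proof (intro conjI allI)
  let ?x = "chart_inv c p"
  have lin: "linear (from_chart A c ?x)"
    using assms by (simp add: linear_from_chart)
  have "linear (G ?x u)" "linear (\<lambda>v. G ?x v u)" for u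
    using bilinear_metric[of ?x] by (auto simp: bilinear_def)
  from linear_compose[OF lin this(1)] linear_compose[OF lin this(2)]
  show "linear (chart_metric c p a)" "linear (\<lambda>a. chart_metric c p a b)" for a b
    by (simp_all add: chart_metric_def[abs_def] Let_def o_def)
qed

lemma chart_metric_tendsto:
  assumes "c \<in> A" "p \<in> chart_image c"
  shows "((\<lambda>q. chart_metric c q a b) \<longlongrightarrow> chart_metric c p a b) (nhds p)"
proof -
  have "smooth_on (chart_image c) (\<lambda>q. chart_metric c q a b)"
    using riemannian assms unfolding riemannian_manifold_def riemannian_metric_def chart_metric_def by blast
  then have "Ck_on 0 (chart_image c) (\<lambda>q. chart_metric c q a b)"
    by (simp only: smooth_on_def)
  then have "continuous_on (chart_image c) (\<lambda>q. chart_metric c q a b)" by simp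
  then have "isCont (\<lambda>q. chart_metric c q a b) p"
    using assms open_chart_image by (simp add: continuous_on_eq_continuous_at)
  then show ?thesis by (rule isCont_tendsto_nhds)
qed

lemma tnorm_nonneg [simp]: "0 \<le> tnorm G x v"
proof -
  have "0 \<le> G x v v"
    using metric_pos[of v x] bilinear_lzero[OF bilinear_metric, of x v] by (cases "v = 0") auto
  then show ?thesis by (simp add: tnorm_def)
qed

lemma metric_nonneg: "0 \<le> G x v v"
  using tnorm_nonneg[of x v] by (simp add: tnorm_def)

lemma metric_self: "G x v v = (tnorm G x v)\<^sup>2"
  by (simp add: tnorm_def metric_nonneg)

lemma tnorm_scale [simp]: "tnorm G x (t *\<^sub>R v) = \<bar>t\<bar> * tnorm G x v"
  by (simp add: tnorm_def bilinear_lmul[OF bilinear_metric] bilinear_rmul[OF bilinear_metric]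
      real_sqrt_mult flip: mult.assoc)

lemma tnorm_zero [simp]: "tnorm G x 0 = 0"
  using tnorm_scale[of x 0 0] by simp

lemma tnorm_pos: "v \<noteq> 0 \<Longrightarrow> 0 < tnorm G x v"
  by (simp add: tnorm_def metric_pos)

text \<open>In one chart the tangent norms are locally equivalent to the Euclidean norm. At
  \<open>p\<close> the quadratic form has a positive minimum m on the unit sphere by compactness;
  near \<open>p\<close> the forms differ from it by at most m/2, which leaves m/2 below and M + m/2
  above.\<close>

lemma tnorm_chart_bounds:
  assumes c: "c \<in> A" and p: "p \<in> chart_image c"
  obtains m M where "0 < m" "0 < M"
    "\<forall>\<^sub>F q in nhds p. \<forall>a. m * norm a \<le> tnorm G (chart_inv c q) (from_chart A c (chart_inv c q) a) \<and>
        tnorm G (chart_inv c q) (from_chart A c (chart_inv c q) a) \<le> M * norm a"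
proof -
  let ?B = "chart_metric c p"
  have bl: "bounded_bilinear ?B"
    using bilinear_chart_metric[OF c p] by (simp add: bilinear_conv_bounded_bilinear)
  have pos: "0 < ?B a a" if "a \<noteq> 0" for a
  proof -
    have "from_chart A c (chart_inv c p) a \<noteq> 0"
      using that to_from_chart[OF c chart_inv_in[OF c p], of a]
        linear_0[OF linear_to_chart[OF c chart_inv_in[OF c p]]] by metis
    then show ?thesis by (simp add: chart_metric_def Let_def metric_pos)
  qed
  have "continuous_on (sphere 0 1) (\<lambda>a. ?B a a)"
    by (intro bounded_bilinear.continuous_on[OF bl] continuous_intros)
  then have "\<exists>a\<in>sphere 0 1. \<forall>a'\<in>sphere 0 1. ?B a a \<le> ?B a' a'"
    by (intro continuous_attains_inf) auto
  then obtain a0 where a0: "a0 \<in> sphere 0 1" "\<And>a'. a' \<in> sphere 0 1 \<Longrightarrow> ?B a0 a0 \<le> ?B a' a'"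
    by blast
  define m where "m = ?B a0 a0"
  have "0 < m" unfolding m_def using a0(1) by (intro pos) auto
  have low: "m * (norm a)\<^sup>2 \<le> ?B a a" for a
  proof (cases "a = 0")
    case False
    have "m \<le> ?B (a /\<^sub>R norm a) (a /\<^sub>R norm a)"
      unfolding m_def using False by (intro a0(2)) auto
    also have "\<dots> = ?B a a / (norm a)\<^sup>2"
      by (simp add: bounded_bilinear.scaleR_left[OF bl] bounded_bilinear.scaleR_right[OF bl]
          power2_eq_square divide_inverse mult_ac)
    finally show ?thesis using False by (simp add: field_simps)
  qed (simp add: bounded_bilinear.zero_left[OF bl])
  obtain M where "0 < M" and M: "\<And>a b. norm (?B a b) \<le> norm a * norm b * M"
    using bounded_bilinear.pos_bounded[OF bl] by blast
  have "\<forall>\<^sub>F q in nhds p. \<forall>a b. \<bar>chart_metric c q a b - ?B a b\<bar> \<le> m / 2 * norm a * norm b"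
  proof (rule uniform_bilinear_limit)
    show "\<forall>\<^sub>F q in nhds p. bilinear (chart_metric c q)"
      using eventually_nhds_in_open[OF open_chart_image[OF c] p]
      by eventually_elim (rule bilinear_chart_metric[OF c])
  qed (use c p \<open>0 < m\<close> in \<open>auto simp: bilinear_chart_metric chart_metric_tendsto\<close>)
  then have "\<forall>\<^sub>F q in nhds p. \<forall>a. sqrt (m / 2) * norm a \<le> tnorm G (chart_inv c q) (from_chart A c (chart_inv c q) a) \<and>
        tnorm G (chart_inv c q) (from_chart A c (chart_inv c q) a) \<le> sqrt (M + m / 2) * norm a"
  proof eventually_elim
    case (elim q)
    have "m / 2 * (norm a)\<^sup>2 \<le> chart_metric c q a a \<and> chart_metric c q a a \<le> (M + m / 2) * (norm a)\<^sup>2" for a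
    proof -
      have "\<bar>chart_metric c q a a - ?B a a\<bar> \<le> m / 2 * (norm a)\<^sup>2" "?B a a \<le> M * (norm a)\<^sup>2"
        using elim[rule_format, of a a] M[of a a] by (simp_all add: power2_eq_square mult_ac abs_le_iff)
      with low[of a] show ?thesis
        unfolding abs_le_iff distrib_right by (intro conjI; linarith)
    qed
    then have "sqrt (m / 2 * (norm a)\<^sup>2) \<le> sqrt (chart_metric c q a a) \<and>
        sqrt (chart_metric c q a a) \<le> sqrt ((M + m / 2) * (norm a)\<^sup>2)" for a
      by (blast intro: real_sqrt_le_mono)
    then show ?case
      by (simp only: real_sqrt_mult real_sqrt_abs abs_norm_cancel tnorm_def chart_metric_def Let_def simp_thms)
  qed
  then show thesis
    using that[of "sqrt (m / 2)" "sqrt (M + m / 2)"] \<open>0 < m\<close> \<open>0 < M\<close> by auto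
qed

section \<open>Lipschitz continuity in charts\<close>

lemma segment_curve_derivative:
  assumes c: "c \<in> A" "c' \<in> A" and t: "u + t *\<^sub>R d \<in> chart_image c" "chart_inv c (u + t *\<^sub>R d) \<in> fst c'"
  shows "((snd c' \<circ> (\<lambda>t. chart_inv c (u + t *\<^sub>R d))) has_vector_derivative
           frechet_derivative (snd c' \<circ> chart_inv c) (at (u + t *\<^sub>R d)) d) (at t)"
proof -
  let ?x = "chart_inv c (u + t *\<^sub>R d)"
  have D: "((snd c' \<circ> chart_inv c) has_derivative frechet_derivative (snd c' \<circ> chart_inv c) (at (u + t *\<^sub>R d)))
      (at (u + t *\<^sub>R d))"
    using transition_derivative[of c c' ?x] c t by (simp add: dtrans_def)
  have "((\<lambda>t. u + t *\<^sub>R d) has_derivative (\<lambda>h. h *\<^sub>R d)) (at t)"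
    by (auto intro!: derivative_eq_intros)
  from diff_chain_at[OF this D] show ?thesis
    by (simp add: has_vector_derivative_def o_def linear_scale[OF has_derivative_linear[OF D, unfolded o_def]])
qed

text \<open>The coordinate segment competes in the infimum that defines the distance. In the
  preferred charts its velocity is the image of the constant vector v - u under
  \<open>from_chart\<close>, so its speed is at most \<open>M * norm (v - u)\<close>.\<close>

lemma riem_dist_chart_le:
  assumes c: "c \<in> A" and B: "ball p r \<subseteq> chart_image c"
    and M: "\<And>q a. q \<in> ball p r \<Longrightarrow> tnorm G (chart_inv c q) (from_chart A c (chart_inv c q) a) \<le> M * norm a"
    and u: "u \<in> ball p r" and v: "v \<in> ball p r"
  shows "riem_dist A G (chart_inv c u) (chart_inv c v) \<le> ennreal (M * norm (v - u))"
proof -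
  define d where "d = v - u"
  define w where "w = (\<lambda>t::real. u + t *\<^sub>R d)"
  define \<gamma> where "\<gamma> = (\<lambda>t. chart_inv c (w t))"
  have w: "w t \<in> ball p r" if "t \<in> {0..1}" for t
  proof -
    have "w t = (1 - t) *\<^sub>R u + t *\<^sub>R v"
      by (simp add: w_def d_def algebra_simps)
    then show ?thesis
      using convexD_alt[OF convex_ball u v, of t] that by auto
  qed
  have cw: "continuous_on X w" for X
    unfolding w_def by (intro continuous_intros)
  have deriv: "((snd c' \<circ> \<gamma>) has_vector_derivative frechet_derivative (snd c' \<circ> chart_inv c) (at (w t)) d) (at t)"
    if "c' \<in> A" "t \<in> {0..1}" "\<gamma> t \<in> fst c'" for c' t
    using segment_curve_derivative[of c c' u t d] c that w[of t] B by (auto simp: \<gamma>_def w_def)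
  have "C1_curve A a b \<gamma>" if ab: "0 \<le> a" "a < b" "b \<le> 1" for a b
    unfolding C1_curve_def
  proof (intro conjI ballI, safe)
    have "w ` {a..b} \<subseteq> chart_image c"
      using w B ab by force
    then show "continuous_on {a..b} \<gamma>"
      unfolding \<gamma>_def by (rule continuous_on_compose2[OF continuous_on_chart_inv[OF c] cw])
    fix U \<phi> assume c': "(U, \<phi>) \<in> A"
    show "(\<phi> \<circ> \<gamma>) differentiable (at t within {a..b})" if "t \<in> {a..b}" "\<gamma> t \<in> U" for t
      using deriv[OF c', of t] that ab
      by (auto simp: has_vector_derivative_def differentiable_def intro: has_derivative_at_withinI)
    have "continuous_on {t \<in> {a..b}. \<gamma> t \<in> U} (\<lambda>t. frechet_derivative (\<phi> \<circ> chart_inv c) (at (w t)) d)"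
    proof (rule continuous_on_compose2[OF _ cw])
      show "continuous_on (snd c ` (fst c \<inter> U)) (\<lambda>q. frechet_derivative (\<phi> \<circ> chart_inv c) (at q) d)"
        using smooth_on_C1(2)[OF transition_smooth[OF c c']] by simp
      show "w ` {t \<in> {a..b}. \<gamma> t \<in> U} \<subseteq> snd c ` (fst c \<inter> U)"
      proof (intro image_subsetI)
        fix t assume t: "t \<in> {t \<in> {a..b}. \<gamma> t \<in> U}"
        then have "w t \<in> chart_image c" using w[of t] B ab by auto
        then show "w t \<in> snd c ` (fst c \<inter> U)"
          using t c by (intro image_eqI[of _ _ "\<gamma> t"]) (auto simp: \<gamma>_def)
      qed
    qed
    moreover have "vector_derivative (\<phi> \<circ> \<gamma>) (at t within {a..b}) = frechet_derivative (\<phi> \<circ> chart_inv c) (at (w t)) d"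
      if "t \<in> {a..b}" "\<gamma> t \<in> U" for t
      using deriv[OF c', of t] that ab
      by (intro vector_derivative_within_closed_interval[OF ab(2)])
        (auto intro: has_vector_derivative_at_within)
    ultimately show "continuous_on {t \<in> {a..b}. \<gamma> t \<in> U} (\<lambda>t. vector_derivative (\<phi> \<circ> \<gamma>) (at t within {a..b}))"
      by (metis (mono_tags, lifting) continuous_on_cong mem_Collect_eq)
  qed
  then have "piecewise_C1_curve A \<gamma>"
    unfolding piecewise_C1_curve_def by blast
  moreover have "\<gamma> 0 = chart_inv c u" "\<gamma> 1 = chart_inv c v"
    by (simp_all add: \<gamma>_def w_def d_def)
  ultimately have "riem_dist A G (chart_inv c u) (chart_inv c v) \<le> ennreal (curve_length A G \<gamma>)"
    unfolding riem_dist_def by (intro INF_lower) auto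
  also have "curve_length A G \<gamma> \<le> M * norm d"
  proof -
    let ?F = "\<lambda>t. tnorm G (\<gamma> t) (vector_derivative (snd (chart_at A (\<gamma> t)) \<circ> \<gamma>) (at t))"
    have F: "?F t \<le> M * norm d" if "t \<in> {0..1}" for t
    proof -
      have "w t \<in> chart_image c" using w[OF that] B by auto
      then have "vector_derivative (snd (chart_at A (\<gamma> t)) \<circ> \<gamma>) (at t) = from_chart A c (\<gamma> t) d"
        using vector_derivative_at[OF deriv[OF chart_at(1) that chart_at(2)]] c by (simp add: from_chart_def \<gamma>_def)
      then show ?thesis using M[OF w[OF that], of d] by (simp add: \<gamma>_def)
    qed
    have "0 \<le> M * norm d" using order_trans[OF tnorm_nonneg F[of 0]] by simp
    show ?thesis
    proof (cases "?F integrable_on {0..1}")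
      case True
      have "integral {0..1} ?F \<le> integral {0..1::real} (\<lambda>_. M * norm d)"
        by (rule integral_le[OF True]) (use F in auto)
      then show ?thesis by (simp add: curve_length_def)
    next
      \<comment> \<open>A nonintegrable speed has integral 0 by convention, and 0 is below the
        nonnegative bound.\<close>
      case False
      then show ?thesis
        using \<open>0 \<le> M * norm d\<close> by (simp add: curve_length_def not_integrable_integral)
    qed
  qed
  finally show ?thesis
    by (simp add: d_def ennreal_leI)
qed

text \<open>Converts the Lipschitz condition for the Riemannian distance into one for the Euclidean
  distance of coordinates; all later estimates on \<open>f\<close> use this form.\<close>

lemma chart_lipschitz:
  assumes c: "c \<in> A" and p: "p \<in> chart_image c"
  obtains r K where "0 < r" "ball p r \<subseteq> chart_image c" "K-lipschitz_on (ball p r) (f \<circ> chart_inv c)"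
proof -
  obtain U K where U: "open U" "chart_inv c p \<in> U" and "0 < K"
    and K: "\<And>y z. y \<in> U \<Longrightarrow> z \<in> U \<Longrightarrow> ennreal \<bar>f y - f z\<bar> \<le> ennreal K * riem_dist A G y z"
    using locally_lipschitz unfolding riem_locally_lipschitz_def by metis
  obtain m M where "0 < M" and ev: "\<forall>\<^sub>F q in nhds p. \<forall>a. m * norm a \<le> tnorm G (chart_inv c q) (from_chart A c (chart_inv c q) a) \<and>
        tnorm G (chart_inv c q) (from_chart A c (chart_inv c q) a) \<le> M * norm a"
    by (rule tnorm_chart_bounds[OF c p])
  have "\<forall>\<^sub>F q in nhds p. q \<in> {q \<in> chart_image c. chart_inv c q \<in> U}"
    using p U by (intro eventually_nhds_in_open open_chart_inv_preimage[OF c]) auto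
  with ev have "\<forall>\<^sub>F q in nhds p. q \<in> chart_image c \<and> chart_inv c q \<in> U \<and>
      (\<forall>a. tnorm G (chart_inv c q) (from_chart A c (chart_inv c q) a) \<le> M * norm a)"
    by eventually_elim auto
  then obtain r where "0 < r" and r: "\<And>q. q \<in> ball p r \<Longrightarrow> q \<in> chart_image c \<and> chart_inv c q \<in> U \<and>
      (\<forall>a. tnorm G (chart_inv c q) (from_chart A c (chart_inv c q) a) \<le> M * norm a)"
    unfolding eventually_nhds_metric by (metis dist_commute mem_ball)
  have B: "ball p r \<subseteq> chart_image c" using r by blast
  have "(K * M)-lipschitz_on (ball p r) (f \<circ> chart_inv c)"
  proof (rule lipschitz_onI)
    fix u v assume uv: "u \<in> ball p r" "v \<in> ball p r"
    have "ennreal \<bar>f (chart_inv c u) - f (chart_inv c v)\<bar>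
        \<le> ennreal K * riem_dist A G (chart_inv c u) (chart_inv c v)"
      using r uv by (intro K) auto
    also have "\<dots> \<le> ennreal K * ennreal (M * norm (v - u))"
      using r uv by (intro mult_left_mono riem_dist_chart_le[OF c B]) auto
    also have "\<dots> = ennreal (K * M * norm (v - u))"
      using \<open>0 < K\<close> \<open>0 < M\<close> by (simp add: ennreal_mult[symmetric] mult.assoc)
    finally have "\<bar>f (chart_inv c u) - f (chart_inv c v)\<bar> \<le> K * M * norm (v - u)"
      using \<open>0 < K\<close> \<open>0 < M\<close> by simp
    then show "dist ((f \<circ> chart_inv c) u) ((f \<circ> chart_inv c) v) \<le> K * M * dist u v"
      by (simp add: dist_norm norm_minus_commute)
  qed (use \<open>0 < K\<close> \<open>0 < M\<close> in auto)
  with \<open>0 < r\<close> B show thesis by (rule that)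
qed

lemma chart_tendsto: "c \<in> A \<Longrightarrow> x \<in> fst c \<Longrightarrow> (snd c \<longlongrightarrow> snd c x) (nhds x)"
  using continuous_on_chart[of c] open_chart_domain[of c]
  by (intro isCont_tendsto_nhds) (simp add: continuous_on_eq_continuous_at)

lemma tendsto_locally_lipschitz: "(f \<longlongrightarrow> f x) (nhds x)"
proof -
  define c where "c = chart_at A x"
  have c: "c \<in> A" "x \<in> fst c" by (simp_all add: c_def chart_at)
  obtain r K where "0 < r" "ball (snd c x) r \<subseteq> chart_image c"
    "K-lipschitz_on (ball (snd c x) r) (f \<circ> chart_inv c)"
    by (rule chart_lipschitz[OF c(1) chart_in[OF c(2)]])
  from this(3) have "continuous_on (ball (snd c x) r) (f \<circ> chart_inv c)"
    by (intro lipschitz_on_continuous_on)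
  then have "isCont (f \<circ> chart_inv c) (snd c x)"
    using continuous_on_eq_continuous_at[OF open_ball] \<open>0 < r\<close> centre_in_ball by blast
  then have "((f \<circ> chart_inv c) \<longlongrightarrow> (f \<circ> chart_inv c) (snd c x)) (nhds (snd c x))"
    by (rule isCont_tendsto_nhds)
  then have "((\<lambda>y. (f \<circ> chart_inv c) (snd c y)) \<longlongrightarrow> f x) (nhds x)"
    using filterlim_compose[where g = "f \<circ> chart_inv c", OF _ chart_tendsto[OF c]] c
    by (simp only: o_apply chart_inv_snd)
  moreover have "\<forall>\<^sub>F y in nhds x. (f \<circ> chart_inv c) (snd c y) = f y"
    using eventually_nhds_in_open[OF open_chart_domain[OF c(1)] c(2)] by eventually_elim (simp add: c)
  ultimately show ?thesis by (rule Lim_transform_eventually)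
qed

end

text \<open>Monotonicity in the constant lets the finitely many constants of a subcover be replaced
  by their maximum.\<close>

lemma compact_eventually_bound:
  fixes P :: "real \<Rightarrow> 'z::topological_space \<Rightarrow> bool"
  assumes "compact Z" and mono: "\<And>C C' z. P C z \<Longrightarrow> C \<le> C' \<Longrightarrow> P C' z"
    and loc: "\<And>z. z \<in> Z \<Longrightarrow> \<exists>C. \<forall>\<^sub>F z' in nhds z. P C z'"
  shows "\<exists>C. \<forall>z\<in>Z. P C z"
proof -
  have "\<exists>C U. open U \<and> z \<in> U \<and> (\<forall>z'\<in>U. P C z')" if "z \<in> Z" for z
    using loc[OF that] unfolding eventually_nhds by blast
  then obtain C U where U: "\<And>z. z \<in> Z \<Longrightarrow> open (U z) \<and> z \<in> U z \<and> (\<forall>z'\<in>U z. P (C z) z')"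
    by metis
  obtain D where D: "D \<subseteq> Z" "finite D" "Z \<subseteq> (\<Union>z\<in>D. U z)"
    using \<open>compact Z\<close> by (rule compactE_image[where f = U and C = Z]) (use U in auto)
  have "P (Max (C ` D)) z" if z: "z \<in> Z" for z
  proof -
    obtain z' where "z' \<in> D" "z \<in> U z'" using D(3) z by blast
    then have "P (C z') z" using U D by blast
    then show ?thesis by (rule mono) (use \<open>z' \<in> D\<close> D in simp)
  qed
  then show ?thesis by blast
qed

context riemannian_retraction
begin

section \<open>The retraction in charts\<close>

abbreviation pt :: "('m, 'e) chart \<Rightarrow> 'e \<times> 'e \<Rightarrow> 'm" where
  "pt c z \<equiv> chart_inv c (fst z)"

abbreviation tvec :: "('m, 'e) chart \<Rightarrow> 'e \<times> 'e \<Rightarrow> 'e" where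
  "tvec c z \<equiv> from_chart A c (pt c z) (snd z)"

definition Rdom :: "('m, 'e) chart \<Rightarrow> ('m, 'e) chart \<Rightarrow> ('e \<times> 'e) set" where
  "Rdom c c' = {z. fst z \<in> chart_image c \<and> R (pt c z) (tvec c z) \<in> fst c'}"

definition Rchart :: "('m, 'e) chart \<Rightarrow> ('m, 'e) chart \<Rightarrow> 'e \<times> 'e \<Rightarrow> 'e" where
  "Rchart c c' z = snd c' (R (pt c z) (tvec c z))"

text \<open>The derivative along the fibre, with the base point held fixed.\<close>

definition dR :: "('m, 'e) chart \<Rightarrow> ('m, 'e) chart \<Rightarrow> 'e \<times> 'e \<Rightarrow> 'e \<Rightarrow> 'e" where
  "dR c c' z w = frechet_derivative (Rchart c c') (at z) (0, w)"

lemma retraction_zero [simp]: "R x 0 = x"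
  and DR_zero [simp]: "DR A R x 0 \<eta> = \<eta>"
  using retraction by (auto simp: manifold_retraction_def)

lemma
  assumes "c \<in> A" "c' \<in> A"
  shows open_Rdom: "open (Rdom c c')"
    and Rchart_smooth: "smooth_on (Rdom c c') (Rchart c c')"
proof -
  have Rdom: "Rdom c c' = {(p, a). p \<in> chart_image c \<and>
      (\<lambda>(p, a). R (chart_inv c p) (from_chart A c (chart_inv c p) a)) (p, a) \<in> fst c'}"
    by (auto simp: Rdom_def)
  have Rchart: "Rchart c c' = snd c' \<circ> (\<lambda>(p, a). R (chart_inv c p) (from_chart A c (chart_inv c p) a))"
    by (auto simp: Rchart_def fun_eq_iff)
  show "open (Rdom c c')" "smooth_on (Rdom c c') (Rchart c c')"
    unfolding Rdom Rchart using retraction assms unfolding manifold_retraction_def Let_def by blast+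
qed

lemma Rchart_derivative:
  assumes "c \<in> A" "c' \<in> A" "z \<in> Rdom c c'"
  shows "(Rchart c c' has_derivative frechet_derivative (Rchart c c') (at z)) (at z)"
  by (rule smooth_on_C1(1)[OF Rchart_smooth]) (use assms in auto)

lemma Rchart_tendsto:
  assumes "c \<in> A" "c' \<in> A" "z \<in> Rdom c c'"
  shows "(Rchart c c' \<longlongrightarrow> Rchart c c' z) (nhds z)"
  using has_derivative_continuous[OF Rchart_derivative[OF assms]] by (rule isCont_tendsto_nhds)

lemma linear_dR:
  assumes "c \<in> A" "c' \<in> A" "z \<in> Rdom c c'"
  shows "linear (dR c c' z)"
proof -
  interpret D: linear "frechet_derivative (Rchart c c') (at z)"
    using Rchart_derivative[OF assms] by (rule has_derivative_linear)
  show ?thesis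
    by (rule linearI) (simp_all add: dR_def flip: D.add D.scale)
qed

lemma dR_tendsto:
  assumes "c \<in> A" "c' \<in> A" "z \<in> Rdom c c'"
  shows "((\<lambda>z. dR c c' z w) \<longlongrightarrow> dR c c' z w) (nhds z)"
proof (rule isCont_tendsto_nhds)
  have "continuous_on (Rdom c c') (\<lambda>z. dR c c' z w)"
    unfolding dR_def by (rule smooth_on_C1(2)[OF Rchart_smooth]) (use assms in auto)
  then show "isCont (\<lambda>z. dR c c' z w) z"
    using open_Rdom assms by (simp add: continuous_on_eq_continuous_at)
qed

lemma dR_uniform:
  assumes "c \<in> A" "c' \<in> A" "z \<in> Rdom c c'" and "0 < \<epsilon>"
  shows "\<forall>\<^sub>F z' in nhds z. \<forall>w. norm (dR c c' z' w - dR c c' z w) \<le> \<epsilon> * norm w"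
proof (rule uniform_linear_limit)
  show "\<forall>\<^sub>F z' in nhds z. linear (dR c c' z')"
    using eventually_nhds_in_open[OF open_Rdom[OF assms(1,2)] assms(3)]
    by eventually_elim (rule linear_dR[OF assms(1,2)])
qed (use assms linear_dR dR_tendsto in auto)

lemma Rdom_iff: "c \<in> A \<Longrightarrow> x \<in> fst c \<Longrightarrow> (snd c x, to_chart A c x \<xi>) \<in> Rdom c c' \<longleftrightarrow> R x \<xi> \<in> fst c'"
  by (simp add: Rdom_def)

lemma Rdom_zero: "c \<in> A \<Longrightarrow> x \<in> fst c \<Longrightarrow> (snd c x, 0) \<in> Rdom c c"
  by (simp add: Rdom_def linear_0[OF linear_from_chart])

lemma R_derivative:
  assumes c: "c \<in> A" "c' \<in> A" and x: "x \<in> fst c" "R x \<xi> \<in> fst c'"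
  shows "((\<lambda>\<zeta>. snd c' (R x \<zeta>)) has_derivative
           (\<lambda>\<eta>. dR c c' (snd c x, to_chart A c x \<xi>) (to_chart A c x \<eta>))) (at \<xi>)"
proof -
  define k where "k = (\<lambda>\<zeta>. (snd c x, to_chart A c x \<zeta>))"
  have "bounded_linear (to_chart A c x)"
    using linear_to_chart[OF c(1) x(1)] by (simp add: linear_conv_bounded_linear)
  then have k: "(k has_derivative (\<lambda>\<eta>. (0, to_chart A c x \<eta>))) (at \<xi>)"
    unfolding k_def by (intro has_derivative_Pair has_derivative_const bounded_linear_imp_has_derivative)
  have "(Rchart c c' has_derivative frechet_derivative (Rchart c c') (at (k \<xi>))) (at (k \<xi>))"
    by (rule Rchart_derivative[OF c]) (simp add: k_def Rdom_iff c x)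
  from diff_chain_at[OF k this] show ?thesis
    using c x by (simp add: o_def dR_def k_def Rchart_def)
qed

lemma eventually_R_in_chart:
  assumes c: "c \<in> A" "c' \<in> A" and x: "x \<in> fst c" "R x \<xi> \<in> fst c'"
  shows "\<forall>\<^sub>F \<zeta> in nhds \<xi>. R x \<zeta> \<in> fst c'"
    and "((\<lambda>\<zeta>. (snd c x, to_chart A c x \<zeta>)) \<longlongrightarrow> (snd c x, to_chart A c x \<xi>)) (nhds \<xi>)"
proof -
  have "bounded_linear (to_chart A c x)"
    using linear_to_chart[OF c(1) x(1)] by (simp add: linear_conv_bounded_linear)
  from bounded_linear.tendsto[OF this filterlim_ident]
  show lim: "((\<lambda>\<zeta>. (snd c x, to_chart A c x \<zeta>)) \<longlongrightarrow> (snd c x, to_chart A c x \<xi>)) (nhds \<xi>)"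
    by (intro tendsto_Pair tendsto_const)
  show "\<forall>\<^sub>F \<zeta> in nhds \<xi>. R x \<zeta> \<in> fst c'"
    using topological_tendstoD[OF lim open_Rdom[OF c]] c x by (simp add: Rdom_iff)
qed

text \<open>\<open>DR\<close> is computed in the preferred chart at \<open>R x \<xi>\<close>. Near
  \<xi> the retraction stays in \<open>c'\<close>, so the chain rule with the transition map
  expresses it through \<open>c'\<close>.\<close>

lemma DR_chart:
  assumes c: "c \<in> A" "c' \<in> A" and x: "x \<in> fst c" "R x \<xi> \<in> fst c'"
  shows "DR A R x \<xi> \<eta> = from_chart A c' (R x \<xi>) (dR c c' (snd c x, to_chart A c x \<xi>) (to_chart A c x \<eta>))"
proof -
  let ?c = "chart_at A (R x \<xi>)"
  note c'' = chart_at[of "R x \<xi>"]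
  obtain U where U: "open U" "\<xi> \<in> U" "\<And>\<zeta>. \<zeta> \<in> U \<Longrightarrow> R x \<zeta> \<in> fst c'"
    using eventually_R_in_chart(1)[OF c x] unfolding eventually_nhds by blast
  have "((snd ?c \<circ> chart_inv c') \<circ> (\<lambda>\<zeta>. snd c' (R x \<zeta>)) has_derivative
      dtrans c' ?c (R x \<xi>) \<circ> (\<lambda>\<eta>. dR c c' (snd c x, to_chart A c x \<xi>) (to_chart A c x \<eta>))) (at \<xi>)"
    by (rule diff_chain_at[OF R_derivative[OF c x] transition_derivative[OF c(2) c''(1) x(2) c''(2)]])
  then have "((\<lambda>\<zeta>. snd ?c (R x \<zeta>)) has_derivative
      dtrans c' ?c (R x \<xi>) \<circ> (\<lambda>\<eta>. dR c c' (snd c x, to_chart A c x \<xi>) (to_chart A c x \<eta>))) (at \<xi>)"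
    by (rule has_derivative_transform_within_open[OF _ U(1,2)]) (simp add: c U(3))
  then show ?thesis
    unfolding DR_def by (simp add: frechet_derivative_at[symmetric] from_chart_eq)
qed

lemma dR_zero:
  assumes "c \<in> A" "x \<in> fst c"
  shows "dR c c (snd c x, 0) a = a"
  using arg_cong[OF DR_chart[of c c x 0 "from_chart A c x a"], of "to_chart A c x"] assms
  by (simp add: linear_0[OF linear_to_chart])

text \<open>Near 0 the pullback of \<open>f\<close> along \<open>R y\<close> is the chart expression
  of \<open>f\<close> composed with \<open>R y\<close> read in \<open>c\<close>. The derivative of
  the latter at 0 sends \<open>from_chart A c y b'\<close> to \<open>b'\<close>, so the slope bound
  in direction \<open>b\<close> carries over to every subgradient at every point of the ball, at the
  price of the mismatch between \<open>b'\<close> and \<open>b\<close>.\<close>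

lemma subgradient_chart_le:
  assumes c: "c \<in> A" and y: "y \<in> fst c" and g: "g \<in> riem_subdiff G R f y"
    and lip: "K-lipschitz_on (ball q0 r0) (f \<circ> chart_inv c)"
    and b: "dquot_le (f \<circ> chart_inv c) q0 b s r0"
    and q0: "snd c y \<in> ball q0 r0"
  shows "G y g (from_chart A c y b') \<le> s + K * norm (b' - b)"
proof -
  let ?h = "f \<circ> chart_inv c" and ?\<phi> = "\<lambda>\<zeta>. snd c (R y \<zeta>)" and ?w = "from_chart A c y b'"
  let ?D = "\<lambda>\<zeta> \<eta>. dR c c (snd c y, to_chart A c y \<zeta>) (to_chart A c y \<eta>)"
  have y0: "R y 0 \<in> fst c" using y by simp
  have D: "\<forall>\<^sub>F \<zeta> in nhds 0. (?\<phi> has_derivative ?D \<zeta>) (at \<zeta>)"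
    using eventually_R_in_chart(1)[OF c c y y0]
    by eventually_elim (rule R_derivative[OF c c y])
  have D0: "?D 0 ?w = b'"
    using c y by (simp add: linear_0[OF linear_to_chart] dR_zero)
  have "((\<lambda>\<zeta>. dR c c (snd c y, to_chart A c y \<zeta>) b') \<longlongrightarrow> dR c c (snd c y, to_chart A c y 0) b') (nhds 0)"
    by (rule filterlim_compose[OF dR_tendsto eventually_R_in_chart(2)[OF c c y y0]])
      (use c y in \<open>auto simp: Rdom_iff\<close>)
  then have Dlim: "((\<lambda>\<zeta>. ?D \<zeta> ?w) \<longlongrightarrow> ?D 0 ?w) (nhds 0)"
    using c y by simp
  have "G y g ?w \<le> s + K * norm (b' - b) + e" if "0 < e" for e
  proof -
    have "0 \<le> K" using lip by (rule lipschitz_on_nonneg)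
    \<comment> \<open>Dividing by K + 1 instead of K covers K = 0.\<close>
    define \<epsilon> where "\<epsilon> = e / (K + 1)"
    have "0 < \<epsilon>" "K * \<epsilon> \<le> e" using \<open>0 < e\<close> \<open>0 \<le> K\<close> by (auto simp: \<epsilon>_def field_simps)
    obtain r where "0 < r" and r: "dquot_le (?h \<circ> ?\<phi>) 0 ?w (s + K * (norm (?D 0 ?w - b) + \<epsilon>)) r"
      using dquot_le_compose[OF lip b _ D Dlim \<open>0 < \<epsilon>\<close>] q0 by auto
    obtain r' where "0 < r'" and r': "\<And>\<zeta>. dist \<zeta> 0 < r' \<Longrightarrow> R y \<zeta> \<in> fst c"
      using eventually_R_in_chart(1)[OF c c y y0] unfolding eventually_nhds_metric by blast
    \<comment> \<open>Keeps both \<zeta> and its displacement by t times the direction within r' of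
      0, where \<open>f \<circ> R y\<close> coincides with the chart expression.\<close>
    define r'' where "r'' = min r (r' / (2 * (1 + norm ?w)))"
    have pos: "0 < 1 + norm ?w" by (simp add: add_pos_nonneg)
    then have "0 < r''" "r'' \<le> r"
      using \<open>0 < r\<close> \<open>0 < r'\<close> by (auto simp: r''_def)
    have half: "r' / (2 * N) * N = r' / 2" if "0 < N" for N :: real
      using that by simp
    have "r'' * (1 + norm ?w) \<le> r' / (2 * (1 + norm ?w)) * (1 + norm ?w)"
      using pos by (intro mult_right_mono) (auto simp: r''_def)
    also have "\<dots> = r' / 2"
      by (rule half[OF pos])
    also have "\<dots> < r'"
      using \<open>0 < r'\<close> by simp
    finally have "r'' * (1 + norm ?w) < r'" .
    have "dquot_le (f \<circ> R y) 0 ?w (s + K * (norm (?D 0 ?w - b) + \<epsilon>)) r''"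
      unfolding dquot_le_def
    proof (intro ballI allI impI)
      fix \<zeta> :: 'e and t assume \<zeta>: "\<zeta> \<in> ball 0 r''" and t: "0 < t \<and> t < r''"
      have "norm (\<zeta> + t *\<^sub>R ?w) \<le> norm \<zeta> + t * norm ?w"
        using t by (intro order_trans[OF norm_triangle_ineq]) simp
      also have "\<dots> \<le> r'' + r'' * norm ?w"
        using \<zeta> t by (intro add_mono mult_right_mono) auto
      finally have "norm (\<zeta> + t *\<^sub>R ?w) < r'"
        using \<open>r'' * (1 + norm ?w) < r'\<close> by (simp add: algebra_simps)
      moreover have "r'' \<le> r'' * (1 + norm ?w)"
        using \<open>0 < r''\<close> by (simp add: algebra_simps)
      then have "norm \<zeta> < r'"
        using \<zeta> \<open>r'' * (1 + norm ?w) < r'\<close> by auto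
      ultimately have "R y \<zeta> \<in> fst c" "R y (\<zeta> + t *\<^sub>R ?w) \<in> fst c"
        by (auto intro!: r')
      moreover have "(?h \<circ> ?\<phi>) (\<zeta> + t *\<^sub>R ?w) - (?h \<circ> ?\<phi>) \<zeta> \<le> (s + K * (norm (?D 0 ?w - b) + \<epsilon>)) * t"
        using r \<zeta> t \<open>r'' \<le> r\<close> unfolding dquot_le_def by auto
      ultimately show "(f \<circ> R y) (\<zeta> + t *\<^sub>R ?w) - (f \<circ> R y) \<zeta> \<le> (s + K * (norm (?D 0 ?w - b) + \<epsilon>)) * t"
        using c by simp
    qed
    then have "clarke_dd (f \<circ> R y) 0 ?w \<le> ereal (s + K * (norm (b' - b) + \<epsilon>))"
      unfolding D0 using \<open>0 < r''\<close> by (intro clarke_dd_leI)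
    moreover have "ereal (G y g ?w) \<le> clarke_dd (f \<circ> R y) 0 ?w"
      using g by (simp add: riem_subdiff_def clarke_subdiff_def)
    ultimately have "G y g ?w \<le> s + K * (norm (b' - b) + \<epsilon>)"
      by (metis ereal_less_eq(3) order_trans)
    then show ?thesis using \<open>K * \<epsilon> \<le> e\<close> by (simp add: algebra_simps)
  qed
  then show ?thesis by (rule field_le_epsilon)
qed

text \<open>Away from the zero vector \<open>beta\<close> is a quotient of two tangent norms, each
  comparable to a Euclidean norm in its chart. Multiplying by \<open>norm (snd z)\<close> avoids the
  quotient; at the zero vector \<open>beta\<close> is 1 by definition, hence the guard.\<close>

lemma beta_bounds:
  assumes c: "c \<in> A" "c' \<in> A" and z0: "z0 \<in> Rdom c c'"
  obtains k K where "0 < k" "0 < K"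
    "\<forall>\<^sub>F z in nhds z0. tvec c z \<noteq> 0 \<longrightarrow>
       k * norm (dR c c' z (snd z)) \<le> beta A G R (pt c z) (tvec c z) * norm (snd z) \<and>
       beta A G R (pt c z) (tvec c z) * norm (snd z) \<le> K * norm (dR c c' z (snd z))"
proof -
  have p0: "fst z0 \<in> chart_image c" and y0: "R (pt c z0) (tvec c z0) \<in> fst c'"
    using z0 by (auto simp: Rdom_def)
  obtain m M where "0 < m" "0 < M" and ev: "\<forall>\<^sub>F q in nhds (fst z0).
      \<forall>a. m * norm a \<le> tnorm G (chart_inv c q) (from_chart A c (chart_inv c q) a) \<and>
        tnorm G (chart_inv c q) (from_chart A c (chart_inv c q) a) \<le> M * norm a"
    by (rule tnorm_chart_bounds[OF c(1) p0])
  have "Rchart c c' z0 \<in> chart_image c'"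
    using y0 by (simp add: Rchart_def)
  then obtain m' M' where "0 < m'" "0 < M'" and ev': "\<forall>\<^sub>F q in nhds (Rchart c c' z0).
      \<forall>a. m' * norm a \<le> tnorm G (chart_inv c' q) (from_chart A c' (chart_inv c' q) a) \<and>
        tnorm G (chart_inv c' q) (from_chart A c' (chart_inv c' q) a) \<le> M' * norm a"
    by (rule tnorm_chart_bounds[OF c(2)])
  have "(fst \<longlongrightarrow> fst z0) (nhds z0)"
    by (intro tendsto_fst filterlim_ident)
  from eventually_compose_filterlim[OF ev this]
    eventually_compose_filterlim[OF ev' Rchart_tendsto[OF c z0]]
    eventually_nhds_in_open[OF open_Rdom[OF c] z0]
  have "\<forall>\<^sub>F z in nhds z0. tvec c z \<noteq> 0 \<longrightarrow>
       m' / M * norm (dR c c' z (snd z)) \<le> beta A G R (pt c z) (tvec c z) * norm (snd z) \<and>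
       beta A G R (pt c z) (tvec c z) * norm (snd z) \<le> M' / m * norm (dR c c' z (snd z))"
  proof eventually_elim
    case (elim z)
    let ?x = "pt c z" and ?\<eta> = "tvec c z" and ?d = "dR c c' z (snd z)"
    show ?case
    proof
      assume nz: "?\<eta> \<noteq> 0"
      have x: "?x \<in> fst c" and y: "R ?x ?\<eta> \<in> fst c'" and p: "fst z \<in> chart_image c"
        using elim(3) c by (auto simp: Rdom_def)
      have n: "m * norm (snd z) \<le> tnorm G ?x ?\<eta>" "tnorm G ?x ?\<eta> \<le> M * norm (snd z)"
        using elim(1) by auto
      have "DR A R ?x ?\<eta> ?\<eta> = from_chart A c' (R ?x ?\<eta>) ?d"
        using DR_chart[OF c x y] c x p by simp
      moreover have "chart_inv c' (Rchart c c' z) = R ?x ?\<eta>"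
        using c y by (simp add: Rchart_def)
      ultimately have N: "m' * norm ?d \<le> tnorm G (R ?x ?\<eta>) (DR A R ?x ?\<eta> ?\<eta>)"
          "tnorm G (R ?x ?\<eta>) (DR A R ?x ?\<eta> ?\<eta>) \<le> M' * norm ?d"
        using elim(2)[rule_format, of ?d] by simp_all
      have pos: "0 < tnorm G ?x ?\<eta>" using nz by (rule tnorm_pos)
      have \<beta>: "beta A G R ?x ?\<eta> * tnorm G ?x ?\<eta> = tnorm G (R ?x ?\<eta>) (DR A R ?x ?\<eta> ?\<eta>)"
        using nz pos by (simp add: beta_def)
      have "0 \<le> beta A G R ?x ?\<eta>"
        by (simp add: beta_def)
      then have "m' * norm ?d \<le> beta A G R ?x ?\<eta> * (M * norm (snd z))"
        "beta A G R ?x ?\<eta> * (m * norm (snd z)) \<le> M' * norm ?d"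
        using N \<beta> mult_left_mono[OF n(1), of "beta A G R ?x ?\<eta>"] mult_left_mono[OF n(2), of "beta A G R ?x ?\<eta>"]
        by linarith+
      then show "m' / M * norm ?d \<le> beta A G R ?x ?\<eta> * norm (snd z) \<and>
          beta A G R ?x ?\<eta> * norm (snd z) \<le> M' / m * norm ?d"
        using \<open>0 < m\<close> \<open>0 < M\<close> by (simp add: field_simps)
    qed
  qed
  then show thesis
    using that[of "m' / M" "M' / m"] \<open>0 < m\<close> \<open>0 < M\<close> \<open>0 < m'\<close> \<open>0 < M'\<close> by simp
qed

lemma beta_nonneg: "0 \<le> beta A G R x \<xi>"
  by (simp add: beta_def)

lemma tvec_eq_0_iff: "c \<in> A \<Longrightarrow> fst z \<in> chart_image c \<Longrightarrow> tvec c z = 0 \<longleftrightarrow> snd z = 0"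
  by (metis chart_inv_in linear_0 linear_from_chart linear_to_chart to_from_chart)

text \<open>Near \<open>z0\<close> the fibre derivative has operator norm at most B + 1, where B
  bounds it at \<open>z0\<close>. The 1 in the maximum is the value of \<open>beta\<close> at the
  zero vector.\<close>

lemma beta_upper_bound:
  assumes c: "c \<in> A" and p0: "fst z0 \<in> chart_image c"
  shows "\<exists>C. \<forall>\<^sub>F z in nhds z0. beta A G R (pt c z) (tvec c z) \<le> C"
proof -
  define c' where "c' = chart_at A (R (pt c z0) (tvec c z0))"
  have c': "c' \<in> A" and z0: "z0 \<in> Rdom c c'"
    using p0 by (simp_all add: c'_def chart_at Rdom_def)
  obtain k K where "0 < K" and ev: "\<forall>\<^sub>F z in nhds z0. tvec c z \<noteq> 0 \<longrightarrow>
       k * norm (dR c c' z (snd z)) \<le> beta A G R (pt c z) (tvec c z) * norm (snd z) \<and>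
       beta A G R (pt c z) (tvec c z) * norm (snd z) \<le> K * norm (dR c c' z (snd z))"
    by (rule beta_bounds[OF c c' z0])
  obtain B where B: "\<And>w. norm (dR c c' z0 w) \<le> B * norm w"
    using linear_dR[OF c c' z0] by (metis linear_bounded)
  from ev dR_uniform[OF c c' z0 zero_less_one] eventually_nhds_in_open[OF open_Rdom[OF c c'] z0]
  have "\<forall>\<^sub>F z in nhds z0. beta A G R (pt c z) (tvec c z) \<le> max 1 (K * (B + 1))"
  proof eventually_elim
    case (elim z)
    show ?case
    proof (cases "tvec c z = 0")
      case False
      have pos: "0 < norm (snd z)"
        using False elim(3) tvec_eq_0_iff[OF c] by (auto simp: Rdom_def)
      have "beta A G R (pt c z) (tvec c z) * norm (snd z) \<le> K * norm (dR c c' z (snd z))"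
        using elim(1) False by blast
      also have "norm (dR c c' z (snd z)) \<le> norm (dR c c' z (snd z) - dR c c' z0 (snd z)) + norm (dR c c' z0 (snd z))"
        using norm_triangle_ineq[of "dR c c' z (snd z) - dR c c' z0 (snd z)" "dR c c' z0 (snd z)"] by simp
      also have "\<dots> \<le> (B + 1) * norm (snd z)"
        using elim(2)[rule_format, of "snd z"] B[of "snd z"] by (simp add: algebra_simps)
      finally have "beta A G R (pt c z) (tvec c z) * norm (snd z) \<le> (K * (B + 1)) * norm (snd z)"
        using \<open>0 < K\<close> by (simp add: mult.assoc)
      then show ?thesis
        using pos by (simp add: le_max_iff_disj)
    qed (simp add: beta_def)
  qed
  then show ?thesis by blast
qed

text \<open>At the zero section the fibre derivative is the identity, so nearby it shrinks a vector
  by at most the factor 1/2. This keeps the factor \<open>beta\<close> from destroying a negative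
  inner product.\<close>

lemma beta_lower_bound:
  assumes c: "c \<in> A" and x0: "x0 \<in> fst c"
  shows "\<exists>k>0. \<forall>\<^sub>F z in nhds (snd c x0, 0). k \<le> beta A G R (pt c z) (tvec c z)"
proof -
  note z0 = Rdom_zero[OF c x0]
  obtain k K where "0 < k" and ev: "\<forall>\<^sub>F z in nhds (snd c x0, 0). tvec c z \<noteq> 0 \<longrightarrow>
       k * norm (dR c c z (snd z)) \<le> beta A G R (pt c z) (tvec c z) * norm (snd z) \<and>
       beta A G R (pt c z) (tvec c z) * norm (snd z) \<le> K * norm (dR c c z (snd z))"
    by (rule beta_bounds[OF c c z0])
  have half: "0 < (1 / 2 :: real)" by simp
  from ev dR_uniform[OF c c z0 half] eventually_nhds_in_open[OF open_Rdom[OF c c] z0]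
  have "\<forall>\<^sub>F z in nhds (snd c x0, 0). min 1 (k / 2) \<le> beta A G R (pt c z) (tvec c z)"
  proof eventually_elim
    case (elim z)
    show ?case
    proof (cases "tvec c z = 0")
      case False
      have pos: "0 < norm (snd z)"
        using False elim(3) tvec_eq_0_iff[OF c] by (auto simp: Rdom_def)
      have "norm (dR c c z (snd z) - snd z) \<le> 1 / 2 * norm (snd z)"
        using elim(2)[rule_format, of "snd z"] by (simp add: dR_zero[OF c x0])
      then have "1 / 2 * norm (snd z) \<le> norm (dR c c z (snd z))"
        using norm_triangle_ineq2[of "snd z" "snd z - dR c c z (snd z)"] by (simp add: norm_minus_commute)
      then have "k * (1 / 2 * norm (snd z)) \<le> k * norm (dR c c z (snd z))"
        using \<open>0 < k\<close> by (intro mult_left_mono) auto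
      then have "(k / 2) * norm (snd z) \<le> beta A G R (pt c z) (tvec c z) * norm (snd z)"
        using elim(1) False by simp
      then show ?thesis
        using pos by (simp add: min_le_iff_disj)
    qed (simp add: beta_def)
  qed
  then show ?thesis
    using \<open>0 < k\<close> by (intro exI[of _ "min 1 (k / 2)"]) simp
qed

end

context riemannian_retraction
begin

section \<open>Estimates near a point\<close>

lemma Rchart_inv [simp]: "c' \<in> A \<Longrightarrow> z \<in> Rdom c c' \<Longrightarrow> chart_inv c' (Rchart c c' z) = R (pt c z) (tvec c z)"
  by (simp add: Rchart_def Rdom_def)

text \<open>The zero direction satisfies \<open>dquot_le\<close> with slope 0, so
  \<open>subgradient_chart_le\<close> with \<open>b = 0\<close> is the bound of subgradients by the
  Lipschitz constant. The product with \<open>beta\<close> is bounded because that is what the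
  transport with a hat produces.\<close>

lemma scaled_subgradient_locally_bounded:
  assumes c: "c \<in> A" and p0: "fst z0 \<in> chart_image c"
  shows "\<exists>C. \<forall>\<^sub>F z in nhds z0. \<forall>g\<in>riem_subdiff G R f (R (pt c z) (tvec c z)). \<forall>w.
           beta A G R (pt c z) (tvec c z) * G (R (pt c z) (tvec c z)) g w \<le> C * tnorm G (R (pt c z) (tvec c z)) w"
proof -
  define c' where "c' = chart_at A (R (pt c z0) (tvec c z0))"
  have c': "c' \<in> A" and z0: "z0 \<in> Rdom c c'"
    using p0 by (simp_all add: c'_def chart_at Rdom_def)
  let ?q0 = "Rchart c c' z0"
  have q0: "?q0 \<in> chart_image c'"
    using z0 by (simp add: Rchart_def Rdom_def)
  obtain r K where "0 < r" "ball ?q0 r \<subseteq> chart_image c'" and lip: "K-lipschitz_on (ball ?q0 r) (f \<circ> chart_inv c')"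
    by (rule chart_lipschitz[OF c' q0])
  have "0 \<le> K" using lip by (rule lipschitz_on_nonneg)
  obtain m M where "0 < m" and ev: "\<forall>\<^sub>F q in nhds ?q0.
      \<forall>a. m * norm a \<le> tnorm G (chart_inv c' q) (from_chart A c' (chart_inv c' q) a) \<and>
        tnorm G (chart_inv c' q) (from_chart A c' (chart_inv c' q) a) \<le> M * norm a"
    by (rule tnorm_chart_bounds[OF c' q0])
  obtain B where B: "\<forall>\<^sub>F z in nhds z0. beta A G R (pt c z) (tvec c z) \<le> B"
    using beta_upper_bound[OF c p0] by blast
  note lim = Rchart_tendsto[OF c c' z0]
  have "\<forall>\<^sub>F z in nhds z0. Rchart c c' z \<in> ball ?q0 r"
    using \<open>0 < r\<close> by (intro topological_tendstoD[OF lim]) auto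
  with eventually_compose_filterlim[OF ev lim] B eventually_nhds_in_open[OF open_Rdom[OF c c'] z0]
  have "\<forall>\<^sub>F z in nhds z0. \<forall>g\<in>riem_subdiff G R f (R (pt c z) (tvec c z)). \<forall>w.
      beta A G R (pt c z) (tvec c z) * G (R (pt c z) (tvec c z)) g w \<le> B * (K / m) * tnorm G (R (pt c z) (tvec c z)) w"
  proof eventually_elim
    case (elim z)
    let ?y = "R (pt c z) (tvec c z)" and ?b = "beta A G R (pt c z) (tvec c z)"
    have y: "?y \<in> fst c'" using elim(3) by (simp add: Rdom_def)
    show ?case
    proof (intro ballI allI)
      fix g w assume g: "g \<in> riem_subdiff G R f ?y"
      have "G ?y g (from_chart A c' ?y (to_chart A c' ?y w)) \<le> 0 + K * norm (to_chart A c' ?y w - 0)"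
        by (rule subgradient_chart_le[OF c' y g lip])
          (use elim(4) in \<open>auto simp: dquot_le_def Rchart_def\<close>)
      then have "G ?y g w \<le> K * norm (to_chart A c' ?y w)"
        using c' y by simp
      also have "m * norm (to_chart A c' ?y w) \<le> tnorm G ?y w"
        using elim(1)[rule_format, of "to_chart A c' ?y w"] c' y elim(3) by simp
      then have "K * norm (to_chart A c' ?y w) \<le> K / m * tnorm G ?y w"
        using \<open>0 < m\<close> \<open>0 \<le> K\<close> mult_left_mono[of "m * norm (to_chart A c' ?y w)" "tnorm G ?y w" "K / m"] by simp
      finally have "?b * G ?y g w \<le> ?b * (K / m * tnorm G ?y w)"
        using beta_nonneg by (rule mult_left_mono)
      also have "\<dots> \<le> B * (K / m * tnorm G ?y w)"
        using elim(2) \<open>0 < m\<close> \<open>0 \<le> K\<close> by (intro mult_right_mono) auto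
      finally show "?b * G ?y g w \<le> B * (K / m) * tnorm G ?y w"
        by (simp add: mult.assoc)
    qed
  qed
  then show ?thesis by blast
qed

text \<open>Tangent vectors of length up to \<mu> are not close to the zero section, so one chart
  for their images does not do. Their coordinates over points near \<open>x0\<close> lie in a
  product of two closed balls, and compactness gives a common constant.\<close>

lemma scaled_subgradient_bounded:
  shows "\<exists>C. \<forall>\<^sub>F x in nhds x0. \<forall>\<eta>. tnorm G x \<eta> \<le> \<mu> \<longrightarrow> (\<forall>g\<in>riem_subdiff G R f (R x \<eta>). \<forall>w.
           beta A G R x \<eta> * G (R x \<eta>) g w \<le> C * tnorm G (R x \<eta>) w)"
proof -
  define c where "c = chart_at A x0"
  have c: "c \<in> A" and x0: "x0 \<in> fst c" by (simp_all add: c_def chart_at)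
  let ?p0 = "snd c x0"
  obtain m M where "0 < m" and ev: "\<forall>\<^sub>F q in nhds ?p0.
      \<forall>a. m * norm a \<le> tnorm G (chart_inv c q) (from_chart A c (chart_inv c q) a) \<and>
        tnorm G (chart_inv c q) (from_chart A c (chart_inv c q) a) \<le> M * norm a"
    by (rule tnorm_chart_bounds[OF c chart_in[OF x0]])
  obtain r where "0 < r" and r: "cball ?p0 r \<subseteq> chart_image c"
    using open_contains_cball_eq[OF open_chart_image[OF c]] x0 by (meson chart_in)
  define Z where "Z = cball ?p0 r \<times> cball (0::'e) (\<mu> / m)"
  let ?P = "\<lambda>C z. \<forall>g\<in>riem_subdiff G R f (R (pt c z) (tvec c z)). \<forall>w.
      beta A G R (pt c z) (tvec c z) * G (R (pt c z) (tvec c z)) g w \<le> C * tnorm G (R (pt c z) (tvec c z)) w"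
  have "\<exists>C. \<forall>z\<in>Z. ?P C z"
  proof (rule compact_eventually_bound)
    show "compact Z" unfolding Z_def by (intro compact_Times compact_cball)
    show "?P C' z" if "?P C z" "C \<le> C'" for C C' z
      using that by (meson mult_right_mono order_trans tnorm_nonneg)
    show "\<exists>C. \<forall>\<^sub>F z' in nhds z. ?P C z'" if "z \<in> Z" for z
      using that r by (intro scaled_subgradient_locally_bounded[OF c]) (auto simp: Z_def)
  qed
  then obtain C where C: "\<And>z. z \<in> Z \<Longrightarrow> ?P C z" by blast
  have "\<forall>\<^sub>F x in nhds x0. snd c x \<in> ball ?p0 r"
    using \<open>0 < r\<close> by (intro topological_tendstoD[OF chart_tendsto[OF c x0]]) auto
  with eventually_compose_filterlim[OF ev chart_tendsto[OF c x0]]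
    eventually_nhds_in_open[OF open_chart_domain[OF c] x0]
  have "\<forall>\<^sub>F x in nhds x0. \<forall>\<eta>. tnorm G x \<eta> \<le> \<mu> \<longrightarrow> (\<forall>g\<in>riem_subdiff G R f (R x \<eta>). \<forall>w.
           beta A G R x \<eta> * G (R x \<eta>) g w \<le> C * tnorm G (R x \<eta>) w)"
  proof eventually_elim
    case (elim x)
    show ?case
    proof (intro allI impI)
      fix \<eta> assume "tnorm G x \<eta> \<le> \<mu>"
      moreover have "m * norm (to_chart A c x \<eta>) \<le> tnorm G x \<eta>"
        using elim(1)[rule_format, of "to_chart A c x \<eta>"] c elim(2) by simp
      ultimately have "norm (to_chart A c x \<eta>) \<le> \<mu> / m"
        using \<open>0 < m\<close> by (simp add: field_simps)
      then have "(snd c x, to_chart A c x \<eta>) \<in> Z"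
        using elim(3) by (simp add: Z_def)
      from C[OF this] show "\<forall>g\<in>riem_subdiff G R f (R x \<eta>). \<forall>w.
           beta A G R x \<eta> * G (R x \<eta>) g w \<le> C * tnorm G (R x \<eta>) w"
        using c elim(2) by simp
    qed
  qed
  then show ?thesis by blast
qed

text \<open>Turns a property near (x0, 0) in a bundle chart into one that is uniform over tangent
  balls at all points near \<open>x0\<close>. Half of the radius r is spent on the base point and
  half on the fibre; the factor m converts the Euclidean radius into a tangent norm.\<close>

lemma eventually_near_zero_section:
  assumes c: "c \<in> A" and x0: "x0 \<in> fst c" and P: "\<forall>\<^sub>F z in nhds (snd c x0, 0). P z"
  shows "\<exists>\<rho>>0. \<forall>\<^sub>F x in nhds x0. x \<in> fst c \<and> (\<forall>\<eta>. tnorm G x \<eta> \<le> \<rho> \<longrightarrow> P (snd c x, to_chart A c x \<eta>))"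
proof -
  let ?p0 = "snd c x0"
  obtain m M where "0 < m" and ev: "\<forall>\<^sub>F q in nhds ?p0.
      \<forall>a. m * norm a \<le> tnorm G (chart_inv c q) (from_chart A c (chart_inv c q) a) \<and>
        tnorm G (chart_inv c q) (from_chart A c (chart_inv c q) a) \<le> M * norm a"
    by (rule tnorm_chart_bounds[OF c chart_in[OF x0]])
  obtain r where "0 < r" and r: "\<And>z. dist z (?p0, 0) < r \<Longrightarrow> P z"
    using P unfolding eventually_nhds_metric by blast
  have "\<forall>\<^sub>F x in nhds x0. snd c x \<in> ball ?p0 (r / 2)"
    using \<open>0 < r\<close> by (intro topological_tendstoD[OF chart_tendsto[OF c x0]]) auto
  with eventually_compose_filterlim[OF ev chart_tendsto[OF c x0]]
    eventually_nhds_in_open[OF open_chart_domain[OF c] x0]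
  have "\<forall>\<^sub>F x in nhds x0. x \<in> fst c \<and> (\<forall>\<eta>. tnorm G x \<eta> \<le> m * (r / 2) \<longrightarrow> P (snd c x, to_chart A c x \<eta>))"
  proof eventually_elim
    case (elim x)
    have "P (snd c x, to_chart A c x \<eta>)" if "tnorm G x \<eta> \<le> m * (r / 2)" for \<eta>
    proof (rule r)
      have "m * norm (to_chart A c x \<eta>) \<le> tnorm G x \<eta>"
        using elim(1)[rule_format, of "to_chart A c x \<eta>"] c elim(2) by simp
      then have "m * norm (to_chart A c x \<eta>) \<le> m * (r / 2)"
        using that by linarith
      then have "norm (to_chart A c x \<eta>) \<le> r / 2"
        using \<open>0 < m\<close> by (simp only: mult_le_cancel_left_pos)
      moreover have "dist (snd c x) ?p0 < r / 2"
        using elim(3) by (simp add: dist_commute)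
      moreover have "dist (snd c x, to_chart A c x \<eta>) (?p0, 0) \<le> dist (snd c x) ?p0 + norm (to_chart A c x \<eta>)"
        using sqrt_sum_squares_le_sum_abs[of "dist (snd c x) ?p0" "norm (to_chart A c x \<eta>)"]
        by (simp add: dist_Pair_Pair)
      ultimately show "dist (snd c x, to_chart A c x \<eta>) (?p0, 0) < r" by simp
    qed
    then show ?case using elim(2) by blast
  qed
  then show ?thesis
    using \<open>0 < m\<close> \<open>0 < r\<close> by (intro exI[of _ "m * (r / 2)"]) simp
qed

lemma retraction_uniformly_continuous:
  assumes "0 < \<epsilon>"
  shows "\<exists>\<rho>>0. \<forall>\<^sub>F x in nhds x0. \<forall>\<eta>. tnorm G x \<eta> \<le> \<rho> \<longrightarrow> \<bar>f x - f (R x \<eta>)\<bar> < \<epsilon>"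
proof -
  define c where "c = chart_at A x0"
  have c: "c \<in> A" and x0: "x0 \<in> fst c" by (simp_all add: c_def chart_at)
  let ?z0 = "(snd c x0, 0::'e)"
  note z0 = Rdom_zero[OF c x0]
  obtain r K where "0 < r" "ball (snd c x0) r \<subseteq> chart_image c" "K-lipschitz_on (ball (snd c x0) r) (f \<circ> chart_inv c)"
    by (rule chart_lipschitz[OF c chart_in[OF x0]])
  from this(3) have "continuous_on (ball (snd c x0) r) (f \<circ> chart_inv c)"
    by (intro lipschitz_on_continuous_on)
  then have "isCont (f \<circ> chart_inv c) (snd c x0)"
    using continuous_on_eq_continuous_at[OF open_ball] \<open>0 < r\<close> centre_in_ball by blast
  then have h: "((f \<circ> chart_inv c) \<longlongrightarrow> (f \<circ> chart_inv c) (snd c x0)) (nhds (snd c x0))"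
    by (rule isCont_tendsto_nhds)
  have "Rchart c c ?z0 = snd c x0"
    using c x0 by (simp add: Rchart_def linear_0[OF linear_from_chart])
  then have "((\<lambda>z. (f \<circ> chart_inv c) (fst z) - (f \<circ> chart_inv c) (Rchart c c z)) \<longlongrightarrow>
      (f \<circ> chart_inv c) (snd c x0) - (f \<circ> chart_inv c) (snd c x0)) (nhds ?z0)"
    using Rchart_tendsto[OF c c z0] tendsto_fst[OF filterlim_ident, of ?z0]
    by (intro tendsto_diff filterlim_compose[OF h]) auto
  then have "\<forall>\<^sub>F z in nhds ?z0. \<bar>(f \<circ> chart_inv c) (fst z) - (f \<circ> chart_inv c) (Rchart c c z)\<bar> < \<epsilon>"
    using \<open>0 < \<epsilon>\<close> by (auto simp: tendsto_iff dist_norm)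
  with eventually_nhds_in_open[OF open_Rdom[OF c c] z0]
  have "\<forall>\<^sub>F z in nhds ?z0. z \<in> Rdom c c \<and> \<bar>(f \<circ> chart_inv c) (fst z) - (f \<circ> chart_inv c) (Rchart c c z)\<bar> < \<epsilon>"
    by eventually_elim blast
  from eventually_near_zero_section[OF c x0 this]
  obtain \<rho> where "0 < \<rho>" and \<rho>: "\<forall>\<^sub>F x in nhds x0. x \<in> fst c \<and> (\<forall>\<eta>. tnorm G x \<eta> \<le> \<rho> \<longrightarrow>
      (snd c x, to_chart A c x \<eta>) \<in> Rdom c c \<and>
      \<bar>(f \<circ> chart_inv c) (snd c x) - (f \<circ> chart_inv c) (Rchart c c (snd c x, to_chart A c x \<eta>))\<bar> < \<epsilon>)"
    by auto
  from \<rho> have "\<forall>\<^sub>F x in nhds x0. \<forall>\<eta>. tnorm G x \<eta> \<le> \<rho> \<longrightarrow> \<bar>f x - f (R x \<eta>)\<bar> < \<epsilon>"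
    by eventually_elim (use c in auto)
  with \<open>0 < \<rho>\<close> show ?thesis by blast
qed

text \<open>Nonstationarity gives a negative slope for the pullback along \<open>R x0\<close>.
  Moving it to the chart runs against the composition: every q near the base point must be written
  as \<open>\<phi> \<zeta>\<close> with small \<zeta>. Any such \<zeta> will do, because the slope
  bound is uniform in the base point.\<close>

lemma descent_direction_in_chart:
  assumes c: "c \<in> A" and x0: "x0 \<in> fst c" and "0 \<notin> riem_subdiff G R f x0"
  obtains b s r where "s < 0" "0 < r" "dquot_le (f \<circ> chart_inv c) (snd c x0) b s r"
proof -
  let ?h = "f \<circ> chart_inv c" and ?p0 = "snd c x0"
  let ?D = "\<lambda>\<zeta> \<eta>. dR c c (?p0, to_chart A c x0 \<zeta>) (to_chart A c x0 \<eta>)"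
  define \<phi> where "\<phi> = (\<lambda>\<zeta>. snd c (R x0 \<zeta>))"
  have R0: "R x0 0 \<in> fst c" using x0 by simp
  obtain v where "clarke_dd (f \<circ> R x0) 0 v < 0"
    using assms(3) bilinear_lzero[OF bilinear_metric]
    by (auto simp: riem_subdiff_def clarke_subdiff_def not_le zero_ereal_def)
  then obtain s where s: "clarke_dd (f \<circ> R x0) 0 v < ereal s" "s < 0"
    by (metis ereal_dense2 ereal_less(1) less_ereal.simps(1) zero_ereal_def)
  then obtain r1 where "0 < r1" and r1: "dquot_le (f \<circ> R x0) 0 v s r1"
    using clarke_dd_lessD by blast
  obtain r0 K where "0 < r0" and r0: "ball ?p0 r0 \<subseteq> chart_image c" and lip: "K-lipschitz_on (ball ?p0 r0) ?h"
    by (rule chart_lipschitz[OF c chart_in[OF x0]])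
  have "0 \<le> K" using lip by (rule lipschitz_on_nonneg)
  \<comment> \<open>The loss from replacing \<phi> by its linearization is then at most half of the
    slope, which leaves s/2.\<close>
  define \<epsilon> where "\<epsilon> = - s / (2 * (K + 1))"
  have "0 < \<epsilon>" "K * \<epsilon> \<le> - s / 2" using \<open>s < 0\<close> \<open>0 \<le> K\<close> by (auto simp: \<epsilon>_def field_simps)
  define b where "b = to_chart A c x0 v"
  have D: "\<forall>\<^sub>F \<zeta> in nhds 0. (\<phi> has_derivative ?D \<zeta>) (at \<zeta>)"
    using eventually_R_in_chart(1)[OF c c x0 R0] unfolding \<phi>_def
    by eventually_elim (rule R_derivative[OF c c x0])
  have D0: "?D 0 = to_chart A c x0"
    using c x0 by (simp add: linear_0[OF linear_to_chart] dR_zero fun_eq_iff)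
  have "((\<lambda>\<zeta>. dR c c (?p0, to_chart A c x0 \<zeta>) b) \<longlongrightarrow> dR c c (?p0, to_chart A c x0 0) b) (nhds 0)"
    by (rule filterlim_compose[OF dR_tendsto eventually_R_in_chart(2)[OF c c x0 R0]])
      (use c x0 in \<open>auto simp: Rdom_iff\<close>)
  then obtain r2 where "0 < r2" and r2: "\<And>y t. y \<in> ball 0 r2 \<Longrightarrow> 0 < t \<Longrightarrow> t < r2 \<Longrightarrow>
      norm (\<phi> (y + t *\<^sub>R v) - \<phi> y - t *\<^sub>R ?D 0 v) \<le> \<epsilon> * t"
    using strict_derivative[OF D _ \<open>0 < \<epsilon>\<close>, of v] unfolding b_def by blast
  have \<phi>0: "\<phi> 0 = ?p0" by (simp add: \<phi>_def)
  have "isCont \<phi> 0"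
    using eventually_nhds_x_imp_x[OF D] by (rule has_derivative_continuous)
  then have "\<forall>\<^sub>F \<zeta> in nhds 0. \<phi> \<zeta> \<in> ball ?p0 r0"
    using \<open>0 < r0\<close> \<phi>0 by (intro topological_tendstoD[OF isCont_tendsto_nhds]) auto
  with D eventually_R_in_chart(1)[OF c c x0 R0]
  have "\<forall>\<^sub>F \<zeta> in nhds 0. (\<phi> has_derivative ?D \<zeta>) (at \<zeta>) \<and> R x0 \<zeta> \<in> fst c \<and> \<phi> \<zeta> \<in> ball ?p0 r0"
    by eventually_elim blast
  then obtain r3 where "0 < r3" and r3: "\<And>\<zeta>. norm \<zeta> < r3 \<Longrightarrow>
      (\<phi> has_derivative ?D \<zeta>) (at \<zeta>) \<and> R x0 \<zeta> \<in> fst c \<and> \<phi> \<zeta> \<in> ball ?p0 r0"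
    unfolding eventually_nhds_metric dist_0_norm dist_norm by auto
  have pos: "0 < 1 + norm v" by (simp add: add_pos_nonneg)
  define r4 where "r4 = Min {r1, r2, r3 / (2 * (1 + norm v))}"
  have "0 < r4" "r4 \<le> r1" "r4 \<le> r2" "r4 \<le> r3 / (2 * (1 + norm v))"
    using \<open>0 < r1\<close> \<open>0 < r2\<close> \<open>0 < r3\<close> pos by (auto simp: r4_def)
  then have "2 * (r4 * (1 + norm v)) \<le> r3"
    using pos by (simp add: pos_le_divide_eq mult_ac)
  moreover have "r4 \<le> r4 * (1 + norm v)" using \<open>0 < r4\<close> by (simp add: algebra_simps)
  ultimately have "r4 * (1 + norm v) < r3" "r4 < r3" using \<open>0 < r4\<close> by linarith+
  \<comment> \<open>Open mapping at a point whose derivative has a right inverse, here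
    \<open>from_chart A c x0\<close>.\<close>
  have "\<phi> 0 \<in> interior (\<phi> ` ball 0 r4)"
  proof (rule sussmann_open_mapping)
    show "continuous_on (ball 0 r3) \<phi>"
      by (intro continuous_at_imp_continuous_on ballI has_derivative_continuous) (use r3 in auto)
    show "(\<phi> has_derivative to_chart A c x0) (at 0)"
      using eventually_nhds_x_imp_x[OF D] unfolding D0 .
    show "bounded_linear (from_chart A c x0)"
      using linear_from_chart[OF c x0] by (simp add: linear_conv_bounded_linear)
    show "to_chart A c x0 \<circ> from_chart A c x0 = id"
      using c x0 by (auto simp: fun_eq_iff)
  qed (use \<open>0 < r3\<close> \<open>r4 < r3\<close> \<open>0 < r4\<close> in auto)
  then obtain r5 where "0 < r5" and r5: "ball ?p0 r5 \<subseteq> \<phi> ` ball 0 r4"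
    using \<phi>0 by (auto simp: mem_interior)
  define r where "r = Min {r5, r4, r0 / (2 * (1 + norm b))}"
  have posb: "0 < 1 + norm b" by (simp add: add_pos_nonneg)
  have "0 < r" "r \<le> r5" "r \<le> r4" "r \<le> r0 / (2 * (1 + norm b))"
    using \<open>0 < r5\<close> \<open>0 < r4\<close> \<open>0 < r0\<close> posb by (auto simp: r_def)
  then have "2 * (r * (1 + norm b)) \<le> r0"
    using posb by (simp add: pos_le_divide_eq mult_ac)
  moreover have "0 < r * (1 + norm b)" using \<open>0 < r\<close> posb by simp
  ultimately have rb: "r * (1 + norm b) < r0" by linarith
  have "?h (q + t *\<^sub>R b) - ?h q \<le> s / 2 * t" if q: "q \<in> ball ?p0 r" and t: "0 < t" "t < r" for q t
  proof -
    have "q \<in> ball ?p0 r5" using q \<open>r \<le> r5\<close> by simp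
    then obtain \<zeta> where \<zeta>: "\<zeta> \<in> ball 0 r4" and q\<zeta>: "q = \<phi> \<zeta>"
      using r5 by blast
    have "norm (\<zeta> + t *\<^sub>R v) \<le> norm \<zeta> + t * norm v"
      using t by (intro order_trans[OF norm_triangle_ineq]) simp
    also have "\<dots> \<le> r4 + r4 * norm v"
      using \<zeta> t \<open>r \<le> r4\<close> by (intro add_mono mult_right_mono) auto
    finally have "norm (\<zeta> + t *\<^sub>R v) < r3"
      using \<open>r4 * (1 + norm v) < r3\<close> by (simp add: algebra_simps)
    note \<zeta>v = r3[OF this]
    have \<zeta>r: "R x0 \<zeta> \<in> fst c" using r3[of \<zeta>] \<zeta> \<open>r4 < r3\<close> by auto
    have "dist ?p0 (q + t *\<^sub>R b) \<le> dist ?p0 q + t * norm b"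
      using t norm_triangle_ineq4[of "?p0 - q" "t *\<^sub>R b"] by (simp add: dist_norm algebra_simps)
    also have "\<dots> < r + r * norm b"
      using q t by (intro add_less_le_mono mult_right_mono) auto
    finally have qb: "q + t *\<^sub>R b \<in> ball ?p0 r0"
      using rb by (simp add: algebra_simps)
    have "norm (\<phi> (\<zeta> + t *\<^sub>R v) - (q + t *\<^sub>R b)) \<le> \<epsilon> * t"
      using r2[of \<zeta> t] \<zeta> t \<open>r \<le> r4\<close> \<open>r4 \<le> r2\<close> fun_cong[OF D0, of v]
      by (auto simp: b_def q\<zeta> algebra_simps)
    then have "K * norm (\<phi> (\<zeta> + t *\<^sub>R v) - (q + t *\<^sub>R b)) \<le> K * (\<epsilon> * t)"
      using \<open>0 \<le> K\<close> by (rule mult_left_mono)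
    moreover have "?h (q + t *\<^sub>R b) - ?h (\<phi> (\<zeta> + t *\<^sub>R v)) \<le> K * norm (\<phi> (\<zeta> + t *\<^sub>R v) - (q + t *\<^sub>R b))"
      using lipschitz_onD[OF lip qb, of "\<phi> (\<zeta> + t *\<^sub>R v)"] \<zeta>v by (simp add: dist_norm norm_minus_commute)
    moreover have "K * (\<epsilon> * t) \<le> - s / 2 * t"
      using mult_right_mono[OF \<open>K * \<epsilon> \<le> - s / 2\<close>, of t] t by (simp only: mult.assoc)
    moreover have "(f \<circ> R x0) (\<zeta> + t *\<^sub>R v) - (f \<circ> R x0) \<zeta> \<le> s * t"
      using r1 \<zeta> t \<open>r \<le> r4\<close> \<open>r4 \<le> r1\<close> unfolding dquot_le_def by auto
    then have "?h (\<phi> (\<zeta> + t *\<^sub>R v)) - ?h q \<le> s * t"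
      using \<zeta>v \<zeta>r c by (simp add: \<phi>_def q\<zeta>)
    ultimately show ?thesis by (simp add: algebra_simps)
  qed
  then have "dquot_le ?h ?p0 b (s / 2) r"
    by (auto simp: dquot_le_def)
  then show thesis
    using that[of "s / 2" r b] \<open>s < 0\<close> \<open>0 < r\<close> by simp
qed

end

section \<open>Isometric vector transport\<close>

locale isometric_retraction = riemannian_retraction A G R f
  for A :: "('m::{t2_space, second_countable_topology}, 'e::euclidean_space) chart set"
    and G :: "('m, 'e) metric"
    and R :: "'m \<Rightarrow> 'e \<Rightarrow> 'm"
    and f :: "'m \<Rightarrow> real" +
  fixes T :: "'m \<Rightarrow> 'e \<Rightarrow> 'e \<Rightarrow> 'e"
  assumes transport: "vector_transport A R T" and isometric: "isometric_transport G R T"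
begin

lemma linear_transport: "linear (T x \<eta>)"
  and bij_transport: "bij (T x \<eta>)"
  and transport_zero [simp]: "T x 0 \<xi> = \<xi>"
  using transport by (auto simp: vector_transport_def)

lemma transport_isometric [simp]: "G (R x \<eta>) (T x \<eta> \<xi>) (T x \<eta> \<zeta>) = G x \<xi> \<zeta>"
  using isometric by (simp add: isometric_transport_def)

lemma transport_inv [simp]: "T x \<eta> (inv (T x \<eta>) \<xi>) = \<xi>" "inv (T x \<eta>) (T x \<eta> \<xi>) = \<xi>"
  using bij_transport[of x \<eta>] by (simp_all add: bij_is_surj surj_f_inv_f bij_is_inj)

lemma tnorm_transport [simp]: "tnorm G (R x \<eta>) (T x \<eta> \<xi>) = tnorm G x \<xi>"
  by (simp add: tnorm_def)

lemma metric_inv_transport: "G x (inv (T x \<eta>) \<xi>) v = G (R x \<eta>) \<xi> (T x \<eta> v)"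
  using transport_isometric[of x \<eta> "inv (T x \<eta>) \<xi>" v] by simp

text \<open>Continuity of the transport is given jointly in base point, displacement and vector.
  Freezing the vector and using that transport along 0 is the identity gives the limit.\<close>

lemma transported_constant_tendsto:
  assumes c: "c \<in> A" and x0: "x0 \<in> fst c"
  shows "((\<lambda>z. to_chart A c (R (pt c z) (tvec c z)) (T (pt c z) (tvec c z) (from_chart A c (pt c z) b)))
           \<longlongrightarrow> b) (nhds (snd c x0, 0))"
proof -
  let ?z0 = "(snd c x0, 0::'e)"
  let ?S = "{(p, a, b). p \<in> chart_image c \<and> R (chart_inv c p) (from_chart A c (chart_inv c p) a) \<in> fst c}"
  define F where "F = (\<lambda>(p, a, b). let x = chart_inv c p; \<eta> = from_chart A c x a; \<xi> = from_chart A c x b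
             in (snd c (R x \<eta>), to_chart A c (R x \<eta>) (T x \<eta> \<xi>)))"
  have F: "continuous_on ?S F"
    using transport c unfolding vector_transport_def F_def by blast
  have k: "continuous_on (Rdom c c) (\<lambda>z. (fst z, snd z, b))"
    by (intro continuous_intros)
  have "continuous_on (Rdom c c) (\<lambda>z. snd (F (fst z, snd z, b)))"
    by (intro continuous_on_snd continuous_on_compose2[OF F k]) (auto simp: Rdom_def)
  then have "isCont (\<lambda>z. snd (F (fst z, snd z, b))) ?z0"
    using open_Rdom[OF c c] Rdom_zero[OF c x0] by (simp add: continuous_on_eq_continuous_at)
  then have "((\<lambda>z. snd (F (fst z, snd z, b))) \<longlongrightarrow> snd (F (fst ?z0, snd ?z0, b))) (nhds ?z0)"
    by (rule isCont_tendsto_nhds)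
  then show ?thesis
    using c x0 by (simp add: F_def Let_def linear_0[OF linear_from_chart])
qed

text \<open>For small \<eta> the transported direction has coordinates close to \<open>b\<close>, so
  by \<open>subgradient_chart_le\<close> the inner product is at most s/2. Multiplying by
  \<open>beta\<close>, which is at least k > 0 there, leaves \<sigma> = k (-s/2).\<close>

lemma transported_subgradient_descent:
  assumes c: "c \<in> A" and x0: "x0 \<in> fst c" and "s < 0" "0 < r"
    and b: "dquot_le (f \<circ> chart_inv c) (snd c x0) b s r"
  shows "\<exists>\<sigma>>0. \<exists>\<rho>>0. \<forall>\<^sub>F x in nhds x0. \<forall>\<eta>. tnorm G x \<eta> \<le> \<rho> \<longrightarrow> (\<forall>g\<in>riem_subdiff G R f (R x \<eta>).
           beta A G R x \<eta> * G (R x \<eta>) g (T x \<eta> (from_chart A c x b)) \<le> - \<sigma>)"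
proof -
  let ?p0 = "snd c x0" and ?h = "f \<circ> chart_inv c"
  let ?z0 = "(?p0, 0::'e)"
  let ?b' = "\<lambda>z. to_chart A c (R (pt c z) (tvec c z)) (T (pt c z) (tvec c z) (from_chart A c (pt c z) b))"
  note z0 = Rdom_zero[OF c x0]
  obtain r0 K where "0 < r0" and "ball ?p0 r0 \<subseteq> chart_image c" and lip: "K-lipschitz_on (ball ?p0 r0) ?h"
    by (rule chart_lipschitz[OF c chart_in[OF x0]])
  have "0 \<le> K" using lip by (rule lipschitz_on_nonneg)
  define \<epsilon> where "\<epsilon> = - s / (2 * (K + 1))"
  have "0 < \<epsilon>" "K * \<epsilon> \<le> - s / 2" using \<open>s < 0\<close> \<open>0 \<le> K\<close> by (auto simp: \<epsilon>_def field_simps)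
  define r1 where "r1 = min r r0"
  have "0 < r1" "r1 \<le> r" "r1 \<le> r0" using \<open>0 < r\<close> \<open>0 < r0\<close> by (auto simp: r1_def)
  have lip1: "K-lipschitz_on (ball ?p0 r1) ?h"
    using lip by (rule lipschitz_on_subset) (use \<open>r1 \<le> r0\<close> in auto)
  have b1: "dquot_le ?h ?p0 b s r1"
    using b \<open>r1 \<le> r\<close> by (rule dquot_le_mono)
  obtain k where "0 < k" and k: "\<forall>\<^sub>F z in nhds ?z0. k \<le> beta A G R (pt c z) (tvec c z)"
    using beta_lower_bound[OF c x0] by blast
  have "Rchart c c ?z0 = ?p0"
    using c x0 by (simp add: Rchart_def linear_0[OF linear_from_chart])
  then have "\<forall>\<^sub>F z in nhds ?z0. Rchart c c z \<in> ball ?p0 r1"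
    using \<open>0 < r1\<close> by (intro topological_tendstoD[OF Rchart_tendsto[OF c c z0]]) auto
  moreover have "\<forall>\<^sub>F z in nhds ?z0. norm (?b' z - b) < \<epsilon>"
    using transported_constant_tendsto[OF c x0, of b] \<open>0 < \<epsilon>\<close> by (simp add: tendsto_iff dist_norm)
  ultimately have "\<forall>\<^sub>F z in nhds ?z0. z \<in> Rdom c c \<and> Rchart c c z \<in> ball ?p0 r1 \<and> norm (?b' z - b) < \<epsilon> \<and>
      k \<le> beta A G R (pt c z) (tvec c z)"
    using k eventually_nhds_in_open[OF open_Rdom[OF c c] z0] by eventually_elim blast
  from eventually_near_zero_section[OF c x0 this] obtain \<rho> where "0 < \<rho>"
    and \<rho>: "\<forall>\<^sub>F x in nhds x0. x \<in> fst c \<and> (\<forall>\<eta>. tnorm G x \<eta> \<le> \<rho> \<longrightarrow>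
      (let z = (snd c x, to_chart A c x \<eta>) in z \<in> Rdom c c \<and> Rchart c c z \<in> ball ?p0 r1 \<and> norm (?b' z - b) < \<epsilon> \<and>
      k \<le> beta A G R (pt c z) (tvec c z)))"
    unfolding Let_def by blast
  from \<rho> have "\<forall>\<^sub>F x in nhds x0. \<forall>\<eta>. tnorm G x \<eta> \<le> \<rho> \<longrightarrow> (\<forall>g\<in>riem_subdiff G R f (R x \<eta>).
           beta A G R x \<eta> * G (R x \<eta>) g (T x \<eta> (from_chart A c x b)) \<le> - (k * (- s / 2)))"
  proof eventually_elim
    case (elim x)
    then have x: "x \<in> fst c" by blast
    show ?case
    proof (intro allI impI ballI)
      fix \<eta> g assume \<eta>: "tnorm G x \<eta> \<le> \<rho>" and g: "g \<in> riem_subdiff G R f (R x \<eta>)"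
      let ?w = "T x \<eta> (from_chart A c x b)"
      have y: "R x \<eta> \<in> fst c" and q: "snd c (R x \<eta>) \<in> ball ?p0 r1" and n: "norm (to_chart A c (R x \<eta>) ?w - b) < \<epsilon>"
        and k: "k \<le> beta A G R x \<eta>"
        using elim \<eta> c by (auto simp: Let_def Rdom_def Rchart_def)
      have "G (R x \<eta>) g ?w \<le> s + K * norm (to_chart A c (R x \<eta>) ?w - b)"
        using subgradient_chart_le[OF c y g lip1 b1 q, of "to_chart A c (R x \<eta>) ?w"] c y by simp
      also have "\<dots> \<le> s + K * \<epsilon>"
        using n \<open>0 \<le> K\<close> by (intro add_left_mono mult_left_mono) auto
      also have "\<dots> \<le> s / 2"
        using \<open>K * \<epsilon> \<le> - s / 2\<close> by simp
      finally have "beta A G R x \<eta> * G (R x \<eta>) g ?w \<le> beta A G R x \<eta> * (s / 2)"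
        using beta_nonneg by (rule mult_left_mono)
      also have "\<dots> \<le> k * (s / 2)"
        using k \<open>s < 0\<close> by (intro mult_right_mono_neg) auto
      finally show "beta A G R x \<eta> * G (R x \<eta>) g ?w \<le> - (k * (- s / 2))" by simp
    qed
  qed
  moreover have "0 < k * (- s / 2)"
    using \<open>0 < k\<close> \<open>s < 0\<close> by (intro mult_pos_pos) auto
  ultimately show ?thesis using \<open>0 < \<rho>\<close> by blast
qed

end

text \<open>Stated for semidefinite forms, since it is applied to the forms of the operators
  \<open>H\<close> as well as to the metric.\<close>

lemma bilinear_cauchy_schwarz:
  fixes B :: "'e::real_vector \<Rightarrow> 'e \<Rightarrow> real"
  assumes B: "bilinear B" and sym: "\<And>u v. B u v = B v u" and pos: "\<And>u. 0 \<le> B u u"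
  shows "(B u v)\<^sup>2 \<le> B u u * B v v"
proof -
  have q: "0 \<le> B u u + 2 * t * B u v + t\<^sup>2 * B v v" for t
    using pos[of "u + t *\<^sub>R v"]
    by (simp add: bilinear_ladd[OF B] bilinear_radd[OF B] bilinear_lmul[OF B] bilinear_rmul[OF B]
        sym[of v u] power2_eq_square algebra_simps)
  show ?thesis
  proof (cases "B v v = 0")
    case True
    have "B u v = 0"
    proof (rule ccontr)
      assume "B u v \<noteq> 0"
      \<comment> \<open>As \<open>B v v = 0\<close>, the quadratic is affine in t, and this t gives
        it the value -1.\<close>
      then show False
        using q[of "- (B u u + 1) / (2 * B u v)"] True by (simp add: field_simps)
    qed
    then show ?thesis using True by simp
  next
    case False
    then have "0 < B v v" using pos[of v] by simp
    have "0 \<le> B u u - (B u v)\<^sup>2 / B v v"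
      using q[of "- B u v / B v v"] False by (simp add: power2_eq_square field_simps)
    then show ?thesis
      using \<open>0 < B v v\<close> by (simp add: field_simps)
  qed
qed

text \<open>The bracket 0 \<le> tA \<le> t \<le> tU with t > 0 survives each pass, so the step size
  is positive and never exceeds the initial one; the rest is read off the exit that was
  taken.\<close>

lemma ls_loop_output:
  assumes "ls_loop A G R T f L x d w tmin tA tU t out g"
    and "0 \<le> tA" "tA \<le> t" "0 < t" "t \<le> tU" and "0 < \<kappa>\<^sub>l\<^sub>s L" "\<kappa>\<^sub>l\<^sub>s L < 1 / 2"
  shows "\<exists>tL tR \<delta> \<alpha>. out = (tL, tR, \<delta>, \<alpha>) \<and> 0 < tR \<and> tR \<le> tU \<and>
           g \<in> riem_subdiff G R f (R x (tR *\<^sub>R d)) \<and> \<delta> = ls_delta A G R T f L x d tR g \<and>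
           (tL = tR \<and> \<alpha> = 0 \<and> ls_serious_exit R f L x d w tmin tR \<delta> \<or> tL = 0 \<and> \<alpha> = \<delta>)"
  using assms
proof (induction rule: ls_loop.induct)
  case (loop g t \<delta> tA' tA tU' tU t' out g')
  let ?\<kappa> = "\<kappa>\<^sub>l\<^sub>s L"
  have A': "0 \<le> tA'" "tA' \<le> tU'" "tU' \<le> tU" and "0 < tU'"
    using loop.hyps(3,4) loop.prems by auto
  have "0 \<le> ?\<kappa> * (tU' - tA')"
    using A' loop.prems by simp
  \<comment> \<open>If the left end is still 0, positivity comes from the fraction \<kappa> of the
    bracket.\<close>
  moreover have "0 < tA' + ?\<kappa> * (tU' - tA')"
    using A' \<open>0 < tU'\<close> loop.prems
    by (cases "tA' = 0") (auto intro: add_pos_nonneg)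
  ultimately have "tA' \<le> t'" "0 < t'" "t' \<le> tU'"
    using loop.hyps(7) by auto
  then show ?case
    using loop.IH A' loop.prems by fastforce
qed auto

section \<open>Tangent norm inequalities and the inverse retraction\<close>

context riemannian_retraction
begin

lemmas metric_add_left = bilinear_ladd[OF bilinear_metric]
  and metric_add_right = bilinear_radd[OF bilinear_metric]
  and metric_diff_left = bilinear_lsub[OF bilinear_metric]
  and metric_diff_right = bilinear_rsub[OF bilinear_metric]
  and metric_scale_left = bilinear_lmul[OF bilinear_metric]
  and metric_scale_right = bilinear_rmul[OF bilinear_metric]
  and metric_neg_left = bilinear_lneg[OF bilinear_metric]
  and metric_neg_right = bilinear_rneg[OF bilinear_metric]
  and metric_zero_left = bilinear_lzero[OF bilinear_metric]

lemmas metric_simps = metric_add_left metric_add_right metric_diff_left metric_diff_right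
  metric_scale_left metric_scale_right metric_neg_left metric_neg_right metric_zero_left

lemma metric_le_tnorm: "\<bar>G x u v\<bar> \<le> tnorm G x u * tnorm G x v"
proof -
  have "(G x u v)\<^sup>2 \<le> G x u u * G x v v"
    by (rule bilinear_cauchy_schwarz[OF bilinear_metric metric_commute metric_nonneg])
  then have "\<bar>G x u v\<bar>\<^sup>2 \<le> (tnorm G x u * tnorm G x v)\<^sup>2"
    by (simp add: metric_self power_mult_distrib)
  then show ?thesis by (rule power2_le_imp_le) simp
qed

lemma tnorm_triangle: "tnorm G x (u + v) \<le> tnorm G x u + tnorm G x v"
proof (rule power2_le_imp_le)
  have "(tnorm G x (u + v))\<^sup>2 = (tnorm G x u)\<^sup>2 + 2 * G x u v + (tnorm G x v)\<^sup>2"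
    by (simp add: metric_simps metric_commute[of x v u] flip: metric_self)
  also have "\<dots> \<le> (tnorm G x u + tnorm G x v)\<^sup>2"
    using metric_le_tnorm[of x u v] by (simp add: power2_sum)
  finally show "(tnorm G x (u + v))\<^sup>2 \<le> (tnorm G x u + tnorm G x v)\<^sup>2" .
qed simp

lemma tnorm_minus [simp]: "tnorm G x (- v) = tnorm G x v"
  using tnorm_scale[of x "-1" v] by simp

text \<open>The injectivity radius is a supremum of radii, so each of two competing vectors brings
  its own ball on which \<open>R x\<close> is injective. The larger of the two balls contains both
  vectors.\<close>

lemma Rinv_R:
  assumes "ereal (tnorm G x \<eta>) < Inj G R"
  shows "Rinv G R x (R x \<eta>) = \<eta>"
  unfolding Rinv_def
proof (rule the_equality)
  fix \<zeta> assume \<zeta>: "R x \<zeta> = R x \<eta> \<and> ereal (tnorm G x \<zeta>) < Inj G R"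
  have le: "Inj G R \<le> Inj_at G R x"
    unfolding Inj_def by (rule INF_lower) simp
  have "\<exists>r. tnorm G x \<xi> < r \<and> inj_on (R x) (tball G x r)" if "ereal (tnorm G x \<xi>) < Inj G R" for \<xi>
    using less_le_trans[OF that le] unfolding Inj_at_def less_SUP_iff by auto
  then obtain r1 r2 where "tnorm G x \<eta> < r1" "inj_on (R x) (tball G x r1)"
    "tnorm G x \<zeta> < r2" "inj_on (R x) (tball G x r2)"
    using \<zeta> assms by meson
  then have "tnorm G x \<eta> < max r1 r2" "tnorm G x \<zeta> < max r1 r2" "inj_on (R x) (tball G x (max r1 r2))"
    by (auto simp: max_def)
  then show "\<zeta> = \<eta>"
    using \<zeta> by (auto simp: tball_def dest: inj_onD)
qed (use assms in simp)

section \<open>Positive semidefinite operators\<close>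

text \<open>The weak inequality \<open>0 \<le> G x (H u) u\<close> is what the lower bounds on w_k
  draw from the operators, and it passes through transport, both updates, scaling and shift.\<close>

definition psd_operator :: "'m \<Rightarrow> ('e \<Rightarrow> 'e) \<Rightarrow> bool" where
  "psd_operator x H \<longleftrightarrow> linear H \<and> (\<forall>u v. G x (H u) v = G x u (H v)) \<and> (\<forall>u. 0 \<le> G x (H u) u)"

lemma psd_operatorD:
  assumes "psd_operator x H"
  shows "linear H" "G x (H u) v = G x u (H v)" "0 \<le> G x (H u) u"
  using assms by (auto simp: psd_operator_def)

lemma spd_imp_psd: "spd_operator G x H \<Longrightarrow> psd_operator x H"
  unfolding spd_operator_def psd_operator_def
  by (metis linear_0 bilinear_lzero bilinear_metric less_eq_real_def)

lemma bilinear_operator: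
  assumes "linear H"
  shows "bilinear (\<lambda>u v. G x (H u) v)"
  using assms by (auto simp: bilinear_def metric_simps linear_add linear_scale intro!: linearI)

lemma psd_cauchy_schwarz:
  assumes "psd_operator x H"
  shows "(G x (H u) v)\<^sup>2 \<le> G x (H u) u * G x (H v) v"
proof (rule bilinear_cauchy_schwarz[of "\<lambda>u v. G x (H u) v"])
  show "G x (H u) v = G x (H v) u" for u v
    using psd_operatorD(2)[OF assms, of u v] metric_commute[of x "H v" u] by simp
qed (intro bilinear_operator psd_operatorD[OF assms])+

lemma psd_scale: "psd_operator x H \<Longrightarrow> 0 \<le> a \<Longrightarrow> psd_operator x (\<lambda>z. a *\<^sub>R H z)"
  by (auto simp: psd_operator_def metric_simps intro: linear_compose_scale_right)

lemma psd_shift: "psd_operator x H \<Longrightarrow> 0 \<le> a \<Longrightarrow> psd_operator x (\<lambda>z. H z + a *\<^sub>R z)"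
  by (auto simp: psd_operator_def metric_simps metric_nonneg intro!: linear_compose_add linear_compose_scale_right linear_ident)

lemma rank_one_linear: "linear (rank_one v (flat G x a))"
  by (rule linearI) (simp_all add: rank_one_def flat_def metric_simps scaleR_add_left)

text \<open>The sign test on \<open>G x gt v\<close> makes the denominator \<open>G x u v\<close>
  exceed \<open>G x (H q) q\<close>, which is nonnegative. Cauchy-Schwarz for \<open>H\<close> then
  shows that the subtracted rank-one form is dominated by that of \<open>H\<close>.\<close>

lemma psd_sr1_update:
  assumes H: "psd_operator x H" and v: "v = H u - s" and s: "s = - (t *\<^sub>R H gt)"
    and "0 < t" and neg: "G x gt v < 0"
  shows "psd_operator x (sr1_update G x H u v)"
proof -
  \<comment> \<open>As \<open>v = H q\<close>, the vector \<open>q\<close> stands in for the inverse of \<open>H\<close> applied to \<open>v\<close>; \<open>H\<close> may be singular.\<close>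
  define q where "q = u + t *\<^sub>R gt"
  note lin = psd_operatorD(1)[OF H]
  have vq: "v = H q"
    by (simp add: v s q_def linear_add[OF lin] linear_scale[OF lin])
  have "G x q v = G x u v + t * G x gt v"
    by (simp add: q_def metric_simps)
  moreover have "t * G x gt v < 0"
    using \<open>0 < t\<close> neg by (rule mult_pos_neg)
  ultimately have uv: "G x q v < G x u v" by simp
  have qv: "G x (H q) q = G x q v"
    by (simp add: vq metric_commute)
  have "0 \<le> G x q v" using psd_operatorD(3)[OF H, of q] qv by simp
  then have c: "0 < G x u v" using uv by simp
  have form: "G x (sr1_update G x H u v a) b = G x (H a) b - G x v a * G x v b / G x u v" for a b
    by (simp add: sr1_update_def rank_one_def flat_def metric_simps)
  have "(G x v z)\<^sup>2 / G x u v \<le> G x (H z) z" for z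
  proof -
    have "(G x v z)\<^sup>2 \<le> G x q v * G x (H z) z"
      using psd_cauchy_schwarz[OF H, of q z] metric_commute[of x v q] by (simp flip: vq)
    also have "\<dots> \<le> G x u v * G x (H z) z"
      using uv psd_operatorD(3)[OF H] by (intro mult_right_mono) auto
    finally show ?thesis using c by (simp add: field_simps)
  qed
  moreover have "linear (sr1_update G x H u v)"
    unfolding sr1_update_def
    by (intro linear_compose_sub linear_compose_scale_right lin rank_one_linear)
  moreover have "G x a (sr1_update G x H u v b) = G x (sr1_update G x H u v a) b" for a b
    using psd_operatorD(2)[OF H, of a b] metric_commute[of x a "H b"]
    unfolding metric_commute[of x a "sr1_update G x H u v b"] form by simp
  ultimately show ?thesis
    by (auto simp: psd_operator_def form power2_eq_square)
qed

text \<open>Completing the square: with \<sigma> = \<open>G x s z\<close> and c =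
  \<open>G x u s\<close>, the new form at z is the form of \<open>H\<close> at z - (\<sigma>/c) u
  plus \<sigma>^2/c.\<close>

lemma psd_bfgs_update:
  assumes H: "psd_operator x H" and c: "0 < G x u s"
  shows "psd_operator x (bfgs_update G x H u s)"
proof -
  note lin = psd_operatorD(1)[OF H] and sym = psd_operatorD(2)[OF H]
  \<comment> \<open>The adjoint is an arbitrary choice; \<open>H\<close> itself is a witness, and
    only inner products with the chosen map are needed below.\<close>
  have "\<forall>a b. G x (H a) b = G x a (riem_adjoint G x H b)"
    unfolding riem_adjoint_def by (rule someI[of _ H]) (simp add: sym)
  then have adj: "G x (riem_adjoint G x H u) a = G x (H u) a" for a
    using sym metric_commute by metis
  let ?c = "G x u s" and ?a = "G x u (H u) + G x u s"
  have form: "G x (bfgs_update G x H u s z) w = G x (H z) w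
      - G x (H u) z * G x s w / ?c - G x s z * G x (H u) w / ?c + ?a * (G x s z * G x s w) / ?c\<^sup>2" for z w
    by (simp add: bfgs_update_def Let_def rank_one_def flat_def metric_simps adj)
  have "0 \<le> G x (bfgs_update G x H u s z) z" for z
  proof -
    define \<sigma> where "\<sigma> = G x s z"
    have "0 \<le> G x (H (z - (\<sigma> / ?c) *\<^sub>R u)) (z - (\<sigma> / ?c) *\<^sub>R u)"
      by (rule psd_operatorD(3)[OF H])
    also have "\<dots> = G x (H z) z - 2 * (\<sigma> / ?c) * G x (H u) z + (\<sigma> / ?c)\<^sup>2 * G x u (H u)"
      using sym[of z u] metric_commute[of x z "H u"] sym[of u u]
      by (simp add: linear_diff[OF lin] linear_scale[OF lin] metric_simps power2_eq_square algebra_simps)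
    also have "\<dots> \<le> \<dots> + \<sigma>\<^sup>2 / ?c"
      using c by simp
    also have "\<dots> = G x (bfgs_update G x H u s z) z"
      using c by (simp add: form \<sigma>_def[symmetric] power2_eq_square field_simps)
    finally show ?thesis .
  qed
  moreover have "linear (bfgs_update G x H u s)"
    unfolding bfgs_update_def Let_def
    by (intro linear_compose_add linear_compose_sub linear_compose_scale_right lin rank_one_linear)
  moreover have "G x a (bfgs_update G x H u s b) = G x (bfgs_update G x H u s a) b" for a b
    using sym[of a b] metric_commute[of x a "H b"]
    unfolding metric_commute[of x a "bfgs_update G x H u s b"] form by (simp add: algebra_simps)
  ultimately show ?thesis
    by (auto simp: psd_operator_def)
qed

end

context isometric_retraction
begin

lemma psd_transport:
  assumes H: "psd_operator x H"
  shows "psd_operator (R x \<eta>) (T x \<eta> \<circ> H \<circ> inv (T x \<eta>))"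
proof -
  have "linear (inv (T x \<eta>))"
    using inj_linear_imp_inv_linear[OF linear_transport] bij_transport by (auto simp: bij_is_inj)
  then have "linear (T x \<eta> \<circ> H \<circ> inv (T x \<eta>))"
    using linear_transport psd_operatorD(1)[OF H] by (intro linear_compose)
  moreover have form: "G (R x \<eta>) ((T x \<eta> \<circ> H \<circ> inv (T x \<eta>)) u) v = G x (H (inv (T x \<eta>) u)) (inv (T x \<eta>) v)"
    "G (R x \<eta>) u ((T x \<eta> \<circ> H \<circ> inv (T x \<eta>)) v) = G x (inv (T x \<eta>) u) (H (inv (T x \<eta>) v))" for u v
    using transport_isometric[of x \<eta> "H (inv (T x \<eta>) u)" "inv (T x \<eta>) v"]
      transport_isometric[of x \<eta> "inv (T x \<eta>) u" "H (inv (T x \<eta>) v)"] by simp_all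
  ultimately show ?thesis
    using psd_operatorD[OF H] unfolding psd_operator_def form by simp
qed

section \<open>Transported subgradients\<close>

text \<open>
  The aggregate pairs of the algorithm lie in the convex hull of this set.  Arguing with affine
  inequalities on the hull makes explicit convex combinations (and Caratheodory's theorem) unnecessary.
\<close>

definition subgradient_bundle :: "real \<Rightarrow> real \<Rightarrow> real \<Rightarrow> 'm \<Rightarrow> ('e \<times> real) set" where
  "subgradient_bundle \<mu> \<gamma> \<nu> x = {(beta A G R x \<eta> *\<^sub>R inv (T x \<eta>) g, a) | \<eta> g a.
     tnorm G x \<eta> \<le> \<mu> \<and> g \<in> riem_subdiff G R f (R x \<eta>) \<and> \<gamma> * tnorm G x \<eta> powr \<nu> \<le> a}"

lemma scaled_transport_metric:
  "G x (beta A G R x \<eta> *\<^sub>R inv (T x \<eta>) g) v = beta A G R x \<eta> * G (R x \<eta>) g (T x \<eta> v)"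
  by (simp add: metric_simps metric_inv_transport)

text \<open>A norm bound is encoded as the family of inequalities
  \<open>G x g v \<le> C * tnorm G x v\<close>, each affine in g and hence inherited by the hull; v
  = g gives back the norm.\<close>

lemma bundle_hull_bounded:
  assumes "0 \<le> \<gamma>"
  shows "\<exists>C. \<forall>\<^sub>F x in nhds x0. \<forall>(g, a)\<in>convex hull subgradient_bundle \<mu> \<gamma> \<nu> x. 0 \<le> a \<and> tnorm G x g \<le> C"
proof -
  obtain C where C: "\<forall>\<^sub>F x in nhds x0. \<forall>\<eta>. tnorm G x \<eta> \<le> \<mu> \<longrightarrow> (\<forall>g\<in>riem_subdiff G R f (R x \<eta>). \<forall>w.
           beta A G R x \<eta> * G (R x \<eta>) g w \<le> C * tnorm G (R x \<eta>) w)"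
    using scaled_subgradient_bounded[of \<mu> x0] by blast
  have "\<forall>\<^sub>F x in nhds x0. \<forall>(g, a)\<in>convex hull subgradient_bundle \<mu> \<gamma> \<nu> x. 0 \<le> a \<and> tnorm G x g \<le> max C 0"
    using C
  proof eventually_elim
    case (elim x)
    let ?Q = "{(g, a). 0 \<le> a \<and> (\<forall>v. G x g v \<le> C * tnorm G x v)} :: ('e \<times> real) set"
    have "convex ?Q"
    proof (rule convexI)
      fix p q and u v :: real
      assume pq: "p \<in> ?Q" "q \<in> ?Q" and uv: "0 \<le> u" "0 \<le> v" "u + v = 1"
      have "u * G x (fst p) w + v * G x (fst q) w \<le> C * tnorm G x w" for w
      proof -
        have "u * G x (fst p) w + v * G x (fst q) w \<le> u * (C * tnorm G x w) + v * (C * tnorm G x w)"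
          using pq uv by (intro add_mono mult_left_mono) auto
        also have "\<dots> = C * tnorm G x w"
          using uv(3) by (simp flip: distrib_right)
        finally show ?thesis .
      qed
      then show "u *\<^sub>R p + v *\<^sub>R q \<in> ?Q"
        using pq uv by (auto simp: case_prod_unfold metric_simps)
    qed
    moreover have "subgradient_bundle \<mu> \<gamma> \<nu> x \<subseteq> ?Q"
    proof
      fix p assume "p \<in> subgradient_bundle \<mu> \<gamma> \<nu> x"
      then obtain \<eta> g a where p: "p = (beta A G R x \<eta> *\<^sub>R inv (T x \<eta>) g, a)" "tnorm G x \<eta> \<le> \<mu>"
        "g \<in> riem_subdiff G R f (R x \<eta>)" "\<gamma> * tnorm G x \<eta> powr \<nu> \<le> a"
        unfolding subgradient_bundle_def by blast
      have "0 \<le> \<gamma> * tnorm G x \<eta> powr \<nu>" using assms by simp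
      then have "0 \<le> a" using p(4) by linarith
      moreover have "G x (beta A G R x \<eta> *\<^sub>R inv (T x \<eta>) g) v \<le> C * tnorm G x v" for v
        using elim p(2,3) unfolding scaled_transport_metric by (metis tnorm_transport)
      ultimately show "p \<in> ?Q" by (simp add: p(1))
    qed
    ultimately have "convex hull subgradient_bundle \<mu> \<gamma> \<nu> x \<subseteq> ?Q" by (rule hull_minimal[rotated])
    moreover have "tnorm G x g \<le> max C 0" if "G x g g \<le> C * tnorm G x g" for g
      using that tnorm_nonneg[of x g] by (cases "tnorm G x g = 0") (auto simp: metric_self power2_eq_square)
    ultimately show ?case by blast
  qed
  then show ?thesis by blast
qed

text \<open>The inequality \<open>G x g (v x) + \<sigma> \<le> K * a\<close> holds on the bundle:
  for short \<eta> the left side is at most 0, for long \<eta> the error a is at least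
  \<open>\<gamma> * r powr \<nu>\<close>. It is affine, so the hull inherits it, and there g and a
  cannot both be small.\<close>

lemma bundle_hull_not_stationary:
  assumes "0 \<notin> riem_subdiff G R f x0" and "0 < \<gamma>" "0 < \<nu>" "0 < \<rho>"
  shows "\<exists>\<omega>>0. \<forall>\<^sub>F x in nhds x0. \<forall>(g, a)\<in>convex hull subgradient_bundle \<mu> \<gamma> \<nu> x. \<forall>w.
           \<rho> * (tnorm G x g)\<^sup>2 \<le> w \<and> 2 * a \<le> w \<longrightarrow> \<omega> \<le> w"
proof -
  define c where "c = chart_at A x0"
  have c: "c \<in> A" and x0: "x0 \<in> fst c" by (simp_all add: c_def chart_at)
  obtain b s r where b: "s < 0" "0 < r" "dquot_le (f \<circ> chart_inv c) (snd c x0) b s r"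
    by (rule descent_direction_in_chart[OF c x0 assms(1)])
  define v where "v = (\<lambda>x. from_chart A c x b)"
  obtain \<sigma> r where "0 < \<sigma>" "0 < r" and ev1: "\<forall>\<^sub>F x in nhds x0. \<forall>\<eta>. tnorm G x \<eta> \<le> r \<longrightarrow>
      (\<forall>g\<in>riem_subdiff G R f (R x \<eta>). beta A G R x \<eta> * G (R x \<eta>) g (T x \<eta> (v x)) \<le> - \<sigma>)"
    using transported_subgradient_descent[OF c x0 b] unfolding v_def by blast
  obtain C where ev2: "\<forall>\<^sub>F x in nhds x0. \<forall>\<eta>. tnorm G x \<eta> \<le> \<mu> \<longrightarrow> (\<forall>g\<in>riem_subdiff G R f (R x \<eta>). \<forall>w.
           beta A G R x \<eta> * G (R x \<eta>) g w \<le> C * tnorm G (R x \<eta>) w)"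
    using scaled_subgradient_bounded[of \<mu> x0] by blast
  obtain m M where "0 < M" and ev: "\<forall>\<^sub>F q in nhds (snd c x0).
      \<forall>a. m * norm a \<le> tnorm G (chart_inv c q) (from_chart A c (chart_inv c q) a) \<and>
        tnorm G (chart_inv c q) (from_chart A c (chart_inv c q) a) \<le> M * norm a"
    by (rule tnorm_chart_bounds[OF c chart_in[OF x0]])
  \<comment> \<open>The summand 1 makes the bound usable as a divisor even for
    \<open>b = 0\<close>.\<close>
  define V where "V = M * norm b + 1"
  have "0 < V" using \<open>0 < M\<close> by (simp add: V_def add_nonneg_pos)
  have ev3: "\<forall>\<^sub>F x in nhds x0. tnorm G x (v x) \<le> V"
    using eventually_compose_filterlim[OF ev chart_tendsto[OF c x0]] eventually_nhds_in_open[OF open_chart_domain[OF c] x0]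
  proof eventually_elim
    case (elim x)
    then have "tnorm G x (v x) \<le> M * norm b" using c by (simp add: v_def)
    then show ?case by (simp add: V_def)
  qed
  \<comment> \<open>Chosen so that K times the least error of a long \<eta> equals the largest
    possible left side, max C 0 * V + \<sigma>.\<close>
  define K where "K = (max C 0 * V + \<sigma>) / (\<gamma> * r powr \<nu>)"
  have "0 < \<gamma> * r powr \<nu>" using \<open>0 < r\<close> \<open>0 < \<gamma>\<close> by simp
  moreover have "0 < max C 0 * V + \<sigma>"
    using \<open>0 < V\<close> \<open>0 < \<sigma>\<close> by (intro add_nonneg_pos) auto
  ultimately have "0 < K" and K: "K * (\<gamma> * r powr \<nu>) = max C 0 * V + \<sigma>" by (auto simp: K_def)
  \<comment> \<open>For w below the first entry K a is less than \<sigma>/2, and below the second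
    the inner product is at least -\<sigma>/2; together they violate the affine inequality.\<close>
  define \<omega> where "\<omega> = min (\<sigma> / K) (\<rho> * (\<sigma> / (2 * V))\<^sup>2)"
  have "0 < \<omega>" using \<open>0 < \<sigma>\<close> \<open>0 < K\<close> \<open>0 < \<rho>\<close> \<open>0 < V\<close> by (simp add: \<omega>_def)
  have "\<forall>\<^sub>F x in nhds x0. \<forall>(g, a)\<in>convex hull subgradient_bundle \<mu> \<gamma> \<nu> x. \<forall>w.
           \<rho> * (tnorm G x g)\<^sup>2 \<le> w \<and> 2 * a \<le> w \<longrightarrow> \<omega> \<le> w"
    using ev1 ev2 ev3
  proof eventually_elim
    case (elim x)
    let ?Q = "{(g, a). G x g (v x) + \<sigma> \<le> K * a} :: ('e \<times> real) set"
    have "convex ?Q"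
    proof (rule convexI)
      fix p q and t u :: real
      assume pq: "p \<in> ?Q" "q \<in> ?Q" and tu: "0 \<le> t" "0 \<le> u" "t + u = 1"
      have "t * (G x (fst p) (v x) + \<sigma>) + u * (G x (fst q) (v x) + \<sigma>) \<le> t * (K * snd p) + u * (K * snd q)"
        using pq tu by (intro add_mono mult_left_mono) auto
      moreover have "t * \<sigma> + u * \<sigma> = \<sigma>" using tu(3) by (simp flip: distrib_right)
      ultimately show "t *\<^sub>R p + u *\<^sub>R q \<in> ?Q"
        by (simp add: case_prod_unfold metric_simps algebra_simps)
    qed
    moreover have "subgradient_bundle \<mu> \<gamma> \<nu> x \<subseteq> ?Q"
    proof
      fix p assume "p \<in> subgradient_bundle \<mu> \<gamma> \<nu> x"
      then obtain \<eta> g a where p: "p = (beta A G R x \<eta> *\<^sub>R inv (T x \<eta>) g, a)" "tnorm G x \<eta> \<le> \<mu>"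
        "g \<in> riem_subdiff G R f (R x \<eta>)" "\<gamma> * tnorm G x \<eta> powr \<nu> \<le> a"
        unfolding subgradient_bundle_def by blast
      let ?Gv = "beta A G R x \<eta> * G (R x \<eta>) g (T x \<eta> (v x))"
      have "?Gv + \<sigma> \<le> K * a"
      proof (cases "tnorm G x \<eta> \<le> r")
        case True
        have "0 \<le> \<gamma> * tnorm G x \<eta> powr \<nu>" using \<open>0 < \<gamma>\<close> by simp
        then have "0 \<le> K * a" using p(4) \<open>0 < K\<close> by simp
        moreover have "?Gv \<le> - \<sigma>" using elim(1) True p(3) by blast
        ultimately show ?thesis by linarith
      next
        case False
        have "?Gv \<le> C * tnorm G (R x \<eta>) (T x \<eta> (v x))" using elim(2) p(2,3) by blast
        also have "\<dots> = C * tnorm G x (v x)" by simp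
        also have "\<dots> \<le> max C 0 * V"
          using elim(3) by (intro mult_mono) auto
        finally have "?Gv + \<sigma> \<le> K * (\<gamma> * r powr \<nu>)"
          unfolding K by simp
        also have "\<dots> \<le> K * (\<gamma> * tnorm G x \<eta> powr \<nu>)"
          using False \<open>0 < K\<close> \<open>0 < \<gamma>\<close> \<open>0 < r\<close> \<open>0 < \<nu>\<close> by (intro mult_left_mono powr_mono2) auto
        also have "\<dots> \<le> K * a" using p(4) \<open>0 < K\<close> by simp
        finally show ?thesis .
      qed
      then show "p \<in> ?Q" by (simp add: p(1) scaled_transport_metric)
    qed
    ultimately have sub: "convex hull subgradient_bundle \<mu> \<gamma> \<nu> x \<subseteq> ?Q" by (rule hull_minimal[rotated])
    have "\<omega> \<le> w" if "G x g (v x) + \<sigma> \<le> K * a" "\<rho> * (tnorm G x g)\<^sup>2 \<le> w" "2 * a \<le> w" for g a w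
    proof (rule ccontr)
      assume "\<not> \<omega> \<le> w"
      then have w: "w < \<sigma> / K" "w < \<rho> * (\<sigma> / (2 * V))\<^sup>2" by (auto simp: \<omega>_def)
      have "2 * (K * a) < \<sigma>" using w(1) that(3) \<open>0 < K\<close> by (simp add: field_simps) (smt (verit, best) mult_left_mono)
      moreover have "\<rho> * (tnorm G x g)\<^sup>2 < \<rho> * (\<sigma> / (2 * V))\<^sup>2" using w(2) that(2) by linarith
      then have "(tnorm G x g)\<^sup>2 < (\<sigma> / (2 * V))\<^sup>2" using \<open>0 < \<rho>\<close> by simp
      then have "tnorm G x g < \<sigma> / (2 * V)"
        by (rule power2_less_imp_less) (use \<open>0 < \<sigma>\<close> \<open>0 < V\<close> in simp)
      then have "tnorm G x g * V \<le> \<sigma> / 2"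
        using \<open>0 < V\<close> by (simp add: field_simps)
      moreover have "tnorm G x g * tnorm G x (v x) \<le> tnorm G x g * V"
        using elim(3) by (intro mult_left_mono) auto
      ultimately show False
        using that(1) metric_le_tnorm[of x g "v x"] by linarith
    qed
    then show ?case using sub by blast
  qed
  with \<open>0 < \<omega>\<close> show ?thesis by blast
qed

text \<open>All parts of \<delta> vanish with the distance moved, \<open>t * tnorm G x d\<close>.
  The factor t in front of the slope is absorbed into the vector t d, so the bound does not involve
  the length of d by itself; staying within \<mu> lets \<open>Rinv\<close> recover t d.\<close>

lemma ls_delta_small:
  assumes "0 < \<epsilon>" and \<mu>: "ereal \<mu> < Inj G R" and L: "0 < \<gamma>\<^sub>l\<^sub>s L" "1 \<le> \<nu>\<^sub>l\<^sub>s L"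
  shows "\<exists>r>0. \<forall>\<^sub>F x in nhds x0. \<forall>d t. \<forall>g\<in>riem_subdiff G R f (R x (t *\<^sub>R d)).
           0 \<le> t \<and> t * tnorm G x d \<le> \<mu> \<and> t * tnorm G x d \<le> r \<longrightarrow> ls_delta A G R T f L x d t g \<le> \<epsilon>"
proof -
  obtain C where ev1: "\<forall>\<^sub>F x in nhds x0. \<forall>\<eta>. tnorm G x \<eta> \<le> \<mu> \<longrightarrow> (\<forall>g\<in>riem_subdiff G R f (R x \<eta>). \<forall>w.
           beta A G R x \<eta> * G (R x \<eta>) g w \<le> C * tnorm G (R x \<eta>) w)"
    using scaled_subgradient_bounded[of \<mu> x0] by blast
  obtain r1 where "0 < r1" and ev2: "\<forall>\<^sub>F x in nhds x0. \<forall>\<eta>. tnorm G x \<eta> \<le> r1 \<longrightarrow> \<bar>f x - f (R x \<eta>)\<bar> < \<epsilon> / 2"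
    using retraction_uniformly_continuous[of "\<epsilon> / 2" x0] \<open>0 < \<epsilon>\<close> by auto
  \<comment> \<open>In this order: the power \<nu> \<ge> 1 only decreases numbers up to 1; the
    change of \<open>f\<close> is below \<epsilon>/2; the locality term is at most \<epsilon>; the
    slope term is at most \<epsilon>/2.\<close>
  define r where "r = Min {1, r1, \<epsilon> / \<gamma>\<^sub>l\<^sub>s L, \<epsilon> / (2 * (\<bar>C\<bar> + 1))}"
  have "0 < \<bar>C\<bar> + 1" by simp
  then have "0 < r" and r: "r \<le> 1" "r \<le> r1" "r \<le> \<epsilon> / \<gamma>\<^sub>l\<^sub>s L" "r \<le> \<epsilon> / (2 * (\<bar>C\<bar> + 1))"
    using \<open>0 < r1\<close> \<open>0 < \<epsilon>\<close> L by (auto simp: r_def)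
  have r\<gamma>: "\<gamma>\<^sub>l\<^sub>s L * r \<le> \<epsilon>"
    using r(3) L by (simp add: field_simps)
  have "(\<bar>C\<bar> + 1) * r \<le> \<epsilon> / 2"
    using r(4) \<open>0 < \<bar>C\<bar> + 1\<close> by (simp add: pos_le_divide_eq mult_ac)
  then have rC: "\<bar>C\<bar> * r \<le> \<epsilon> / 2"
    using \<open>0 < r\<close> by (simp add: algebra_simps)
  have "\<forall>\<^sub>F x in nhds x0. \<forall>d t. \<forall>g\<in>riem_subdiff G R f (R x (t *\<^sub>R d)).
           0 \<le> t \<and> t * tnorm G x d \<le> \<mu> \<and> t * tnorm G x d \<le> r \<longrightarrow> ls_delta A G R T f L x d t g \<le> \<epsilon>"
    using ev1 ev2
  proof eventually_elim
    case (elim x)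
    show ?case
    proof (intro allI ballI impI)
      fix d t g assume g: "g \<in> riem_subdiff G R f (R x (t *\<^sub>R d))"
        and t: "0 \<le> t \<and> t * tnorm G x d \<le> \<mu> \<and> t * tnorm G x d \<le> r"
      let ?\<eta> = "t *\<^sub>R d"
      have n: "tnorm G x ?\<eta> = t * tnorm G x d" using t by simp
      have "ereal (tnorm G x ?\<eta>) < Inj G R"
        using t n by (intro le_less_trans[OF _ \<mu>]) simp
      then have slope: "t * ls_slope A G R T x d t g = beta A G R x ?\<eta> * G (R x ?\<eta>) g (T x ?\<eta> ?\<eta>)"
        by (simp add: ls_slope_def transp_from_hat_def transp_from_def Rinv_R metric_inv_transport
            linear_scale[OF linear_transport, of x _ t d] metric_simps)
      have "tnorm G x ?\<eta> \<le> \<mu>" using t n by simp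
      then have B: "beta A G R x ?\<eta> * G (R x ?\<eta>) g w \<le> C * tnorm G (R x ?\<eta>) w" for w
        using elim(1) g by blast
      \<comment> \<open>The subgradient bound is one-sided; testing it with the transported vector
        and with its negative bounds the absolute value.\<close>
      have "\<bar>t * ls_slope A G R T x d t g\<bar> \<le> C * tnorm G x ?\<eta>"
        unfolding slope using B[of "T x ?\<eta> ?\<eta>"] B[of "- T x ?\<eta> ?\<eta>"] by (simp only: metric_simps tnorm_minus tnorm_transport)
      also have "\<dots> \<le> \<bar>C\<bar> * r"
        using t n by (intro mult_mono) auto
      finally have "\<bar>t * ls_slope A G R T x d t g\<bar> \<le> \<epsilon> / 2" using rC by linarith
      moreover have "\<bar>f x - f (R x ?\<eta>)\<bar> < \<epsilon> / 2"
        using elim(2) t n r(2) by auto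
      moreover have "\<gamma>\<^sub>l\<^sub>s L * (t * tnorm G x d) powr \<nu>\<^sub>l\<^sub>s L \<le> \<epsilon>"
      proof -
        let ?q = "t * tnorm G x d"
        have "?q powr \<nu>\<^sub>l\<^sub>s L \<le> ?q powr 1"
          using t r(1) L by (intro powr_mono') auto
        also have "\<dots> \<le> r" using t by simp
        finally show ?thesis
          using L by (intro order_trans[OF mult_left_mono r\<gamma>]) auto
      qed
      ultimately show "ls_delta A G R T f L x d t g \<le> \<epsilon>"
        unfolding ls_delta_def by linarith
    qed
  qed
  with \<open>0 < r\<close> show ?thesis by blast
qed

end

section \<open>The algorithm\<close>

locale rqnbm = isometric_retraction A G R f T
  for A :: "('m::{t2_space, second_countable_topology}, 'e::euclidean_space) chart set"
    and G :: "('m, 'e) metric"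
    and R :: "'m \<Rightarrow> 'e \<Rightarrow> 'm"
    and f :: "'m \<Rightarrow> real"
    and T :: "'m \<Rightarrow> 'e \<Rightarrow> 'e \<Rightarrow> 'e" +
  fixes L :: ls_params and P :: rq_params and S :: "('m, 'e) rq_run"
  assumes ls_params: "valid_ls_params L" and rq_params: "valid_rq_params G R P"
    and run: "rq_infinite_run A G R T f L P S"
begin

abbreviation "\<mu> \<equiv> \<mu>\<^sub>r\<^sub>q P"
abbreviation "\<rho> \<equiv> \<rho>\<^sub>r\<^sub>q P"

lemma params:
  "0 < \<theta>\<^sub>A L" "0 < \<theta>\<^sub>L L" "0 < \<gamma>\<^sub>l\<^sub>s L" "0 < \<kappa>\<^sub>l\<^sub>s L" "\<kappa>\<^sub>l\<^sub>s L < 1 / 2" "1 \<le> \<nu>\<^sub>l\<^sub>s L"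
  "0 < \<rho>" "\<rho> < 1" "0 < tmin\<^sub>r\<^sub>q P" "0 < \<mu>" "ereal \<mu> < Inj G R" "0 < D\<^sub>r\<^sub>q P" "0 \<le> \<epsilon>\<^sub>r\<^sub>q P"
  using ls_params rq_params by (auto simp: valid_ls_params_def valid_rq_params_def)

lemma step: "1 \<le> k \<Longrightarrow> rq_step A G R T f L P S k"
  and init: "rq_init G R f S"
  using run by (auto simp: rq_infinite_run_def)

abbreviation hull_at :: "'m \<Rightarrow> ('e \<times> real) set" where
  "hull_at x \<equiv> convex hull subgradient_bundle \<mu> (\<gamma>\<^sub>l\<^sub>s L) (\<nu>\<^sub>l\<^sub>s L) x"

lemma subgradient_bundle_in_hull:
  assumes "tnorm G x \<eta> \<le> \<mu>" "g \<in> riem_subdiff G R f (R x \<eta>)" "\<gamma>\<^sub>l\<^sub>s L * tnorm G x \<eta> powr \<nu>\<^sub>l\<^sub>s L \<le> a"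
  shows "(beta A G R x \<eta> *\<^sub>R inv (T x \<eta>) g, a) \<in> hull_at x"
  by (rule hull_inc) (use assms in \<open>auto simp: subgradient_bundle_def\<close>)

text \<open>The case \<eta> = 0 of the bundle, where \<open>beta\<close> is 1, the transport is the
  identity and the locality term is 0.\<close>

lemma subgradient_in_hull:
  assumes "g \<in> riem_subdiff G R f x"
  shows "(g, 0) \<in> hull_at x"
proof -
  have "inv (T x 0) g = g"
    by (metis transport_inv(2) transport_zero)
  then show ?thesis
    using subgradient_bundle_in_hull[of x 0 g 0] assms params by (simp add: beta_def)
qed

lemma ws_pos: "1 \<le> k \<Longrightarrow> 0 < ws S k"
  using step[of k] params(13) by (auto simp: rq_step_def Let_def)

lemma line_search_step:
  assumes "1 \<le> k"
  defines "d \<equiv> ds S k" and "t \<equiv> tRs S k"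
  shows "d = - Hs S k (gts S k)"
    and "xs S (Suc k) = R (xs S k) (tLs S k *\<^sub>R d)" and "ys S (Suc k) = R (xs S k) (t *\<^sub>R d)"
    and "0 < t" and "tnorm G (xs S k) (t *\<^sub>R d) \<le> \<mu>"
    and "gs S (Suc k) \<in> riem_subdiff G R f (R (xs S k) (t *\<^sub>R d))"
    and "dels S (Suc k) = ls_delta A G R T f L (xs S k) d t (gs S (Suc k))"
    and "tLs S k = t \<and> ls_serious_exit R f L (xs S k) d (ws S k) (tmin\<^sub>r\<^sub>q P) t (dels S (Suc k)) \<or>
         tLs S k = 0 \<and> als S (Suc k) = dels S (Suc k)"
proof -
  note st = step[OF assms(1), unfolded rq_step_def Let_def]
  show "d = - Hs S k (gts S k)"
    "xs S (Suc k) = R (xs S k) (tLs S k *\<^sub>R d)" "ys S (Suc k) = R (xs S k) (t *\<^sub>R d)"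
    unfolding d_def t_def by (insert st, elim conjE, assumption)+
  have tI: "0 < tIs S k" and \<mu>: "d \<noteq> 0 \<longrightarrow> tIs S k \<le> \<mu> / tnorm G (xs S k) d"
    unfolding d_def by (insert st, elim conjE, assumption)+
  have "line_search A G R T f L (xs S k) d (ws S k) (tIs S k) (tmin\<^sub>r\<^sub>q P)
         (tLs S k, t, dels S (Suc k), als S (Suc k)) (gs S (Suc k))"
    unfolding d_def t_def by (insert st, elim conjE, assumption)
  then have loop: "ls_loop A G R T f L (xs S k) d (ws S k) (tmin\<^sub>r\<^sub>q P) 0 (tIs S k) (tIs S k)
         (tLs S k, t, dels S (Suc k), als S (Suc k)) (gs S (Suc k))"
    unfolding line_search_def .
  have out: "0 < t \<and> t \<le> tIs S k \<and> gs S (Suc k) \<in> riem_subdiff G R f (R (xs S k) (t *\<^sub>R d)) \<and>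
      dels S (Suc k) = ls_delta A G R T f L (xs S k) d t (gs S (Suc k)) \<and>
      (tLs S k = t \<and> ls_serious_exit R f L (xs S k) d (ws S k) (tmin\<^sub>r\<^sub>q P) t (dels S (Suc k)) \<or>
         tLs S k = 0 \<and> als S (Suc k) = dels S (Suc k))"
    using ls_loop_output[OF loop] tI params(4,5) by auto
  then show "0 < t" "gs S (Suc k) \<in> riem_subdiff G R f (R (xs S k) (t *\<^sub>R d))"
    "dels S (Suc k) = ls_delta A G R T f L (xs S k) d t (gs S (Suc k))"
    "tLs S k = t \<and> ls_serious_exit R f L (xs S k) d (ws S k) (tmin\<^sub>r\<^sub>q P) t (dels S (Suc k)) \<or>
         tLs S k = 0 \<and> als S (Suc k) = dels S (Suc k)"
    by blast+
  show "tnorm G (xs S k) (t *\<^sub>R d) \<le> \<mu>"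
  proof (cases "d = 0")
    case False
    then have "t \<le> \<mu> / tnorm G (xs S k) d" using out \<mu> by auto
    then show ?thesis
      using out tnorm_pos[OF False, of "xs S k"] by (simp add: field_simps)
  qed (use params in simp)
qed

lemma transp_self [simp]: "transp_to G R T x x v = v" "transp_from G R T x x v = v"
proof -
  have "0 < Inj G R"
    using params(10,11) by (metis ereal_less(2) order.strict_trans)
  then have "Rinv G R x x = 0"
    using Rinv_R[of x 0] by (simp add: zero_ereal_def)
  moreover have "inv (T x 0) v = v"
    by (metis transport_inv(2) transport_zero)
  ultimately show "transp_to G R T x x v = v" "transp_from G R T x x v = v"
    by (simp_all add: transp_to_def transp_from_def)
qed

lemma Rinv_step:
  assumes "tnorm G x \<eta> \<le> \<mu>"
  shows "Rinv G R x (R x \<eta>) = \<eta>"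
proof (rule Rinv_R)
  have "ereal (tnorm G x \<eta>) \<le> ereal \<mu>" using assms by simp
  also note params(11)
  finally show "ereal (tnorm G x \<eta>) < Inj G R" .
qed

text \<open>The base subgradient belongs to the current iterate because \<open>ms\<close> changes
  exactly when a serious step is taken.\<close>

definition invariant :: "nat \<Rightarrow> bool" where
  "invariant k \<longleftrightarrow> psd_operator (xs S k) (Hs S k) \<and> gs S (ms S k) \<in> riem_subdiff G R f (xs S k) \<and>
     (gts S k, alts S k) \<in> hull_at (xs S k)"

text \<open>Kept out of \<open>invariant\<close>: these bounds are a result of each step, not part
  of the induction hypothesis.\<close>

definition estimates :: "nat \<Rightarrow> bool" where
  "estimates k \<longleftrightarrow> \<rho> * (tnorm G (xs S k) (gts S k))\<^sup>2 \<le> ws S k \<and> 2 * alts S k \<le> ws S k"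

lemma hull_at_nonneg:
  assumes "(g, a) \<in> hull_at x"
  shows "0 \<le> a"
proof -
  obtain C where "\<forall>\<^sub>F y in nhds x. \<forall>(g, a)\<in>hull_at y. 0 \<le> a \<and> tnorm G y g \<le> C"
    using bundle_hull_bounded[of "\<gamma>\<^sub>l\<^sub>s L" \<mu> "\<nu>\<^sub>l\<^sub>s L" x] params(3) by auto
  from eventually_nhds_x_imp_x[OF this] show ?thesis using assms by blast
qed

text \<open>A null step keeps the point, so transports from it to itself are identities and the new
  aggregate is a convex combination of three pairs in the hull. A serious step starts afresh with
  error 0, and conjugating \<open>H\<close> with an isometry keeps it semidefinite. After scaling,
  the operator sends the aggregate to a vector of length at most D; the correction adds \<rho> times
  the aggregate, with \<rho> < 1.\<close>

lemma invariant_step: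
  assumes k: "1 \<le> k" and inv: "invariant k"
  shows "invariant (Suc k)" and "estimates (Suc k)"
    and "tnorm G (xs S (Suc k)) (Hs S (Suc k) (gts S (Suc k))) \<le>
         D\<^sub>r\<^sub>q P + tnorm G (xs S (Suc k)) (gts S (Suc k))"
proof -
  let ?x = "xs S k" and ?x' = "xs S (Suc k)" and ?y' = "ys S (Suc k)"
    and ?H = "Hs S k" and ?d = "ds S k" and ?gt = "gts S k" and ?gt' = "gts S (Suc k)"
    and ?gm = "gs S (ms S k)" and ?g' = "gs S (Suc k)" and ?Hc' = "Hcs S (Suc k)"
  let ?u = "?g' - transp_to G R T ?x ?y' ?gm"
    and ?s = "transp_to G R T ?x ?x' (tRs S k *\<^sub>R ?d)"
    and ?Ht = "transp_to G R T ?x ?x' \<circ> ?H \<circ> transp_from G R T ?x ?x'"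
  let ?ut = "transp_from G R T ?x' ?y' ?u"
  let ?v = "?Ht ?ut - ?s"
  define Hu where "Hu = (if \<not> iUs S (Suc k) then ?Ht
               else if tLs S k = 0 then sr1_update G ?x' ?Ht ?ut ?v
               else bfgs_update G ?x' ?Ht ?u ?s)"
  let ?wc' = "G ?x' ?gt' (?Hc' ?gt') + 2 * alts S (Suc k)"
  let ?correct = "?wc' < \<rho> * (tnorm G ?x' ?gt')\<^sup>2 \<or> iCs S k \<and> iUs S (Suc k)"
  note st = step[OF k, unfolded rq_step_def Let_def]
  note ls = line_search_step[OF k]
  have Hc': "?Hc' = (if tnorm G ?x' (Hu ?gt') > D\<^sub>r\<^sub>q P
              then (\<lambda>z. (D\<^sub>r\<^sub>q P / tnorm G ?x' (Hu ?gt')) *\<^sub>R Hu z) else Hu)"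
    unfolding Hu_def by (insert st, elim conjE, assumption)
  have w': "ws S (Suc k) = (if ?correct then ?wc' + \<rho> * (tnorm G ?x' ?gt')\<^sup>2 else ?wc')"
    by (insert st, elim conjE, assumption)
  have H': "Hs S (Suc k) = (if ?correct then (\<lambda>z. ?Hc' z + \<rho> *\<^sub>R z) else ?Hc')"
    by (insert st, elim conjE, assumption)
  \<comment> \<open>The conjunct of \<open>rq_step\<close> that distinguishes null from serious
    steps.\<close>
  note branch = st[THEN conjunct2, THEN conjunct2, THEN conjunct2, THEN conjunct2, THEN conjunct2,
      THEN conjunct2, THEN conjunct2, THEN conjunct2, THEN conjunct1]
  have psd: "psd_operator ?x ?H" and gm: "?gm \<in> riem_subdiff G R f ?x"
    and hull: "(?gt, alts S k) \<in> hull_at ?x"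
    using inv by (auto simp: invariant_def)
  have \<eta>: "Rinv G R ?x ?y' = tRs S k *\<^sub>R ?d"
    unfolding ls(3) by (rule Rinv_step[OF ls(5)])
  have main: "psd_operator ?x' Hu \<and> gs S (ms S (Suc k)) \<in> riem_subdiff G R f ?x' \<and>
      (?gt', alts S (Suc k)) \<in> hull_at ?x'"
  proof (cases "tLs S k = 0")
    case True
    have x': "?x' = ?x"
      using ls(2) True by simp
    have Ht: "transp_to G R T ?x ?x \<circ> ?H \<circ> transp_from G R T ?x ?x = ?H"
      by (simp add: fun_eq_iff)
    have s: "?s = - (tRs S k *\<^sub>R ?H ?gt)"
      unfolding x' by (simp add: ls(1))
    note null = branch[unfolded if_P[OF True] is_arg_min_def]
    have N: "lams S k \<in> simplex3"
      "?gt' = comb3 ?gm (transp_from_hat A G R T ?x ?y' ?g') ?gt (lams S k)"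
      "alts S (Suc k) = comb3 0 (als S (Suc k)) (alts S k) (lams S k)"
      "ms S (Suc k) = ms S k" "iUs S (Suc k) \<longrightarrow> G ?x' ?gt ?v < 0"
      using null by blast+
    have "psd_operator ?x' Hu"
    proof (cases "iUs S (Suc k)")
      case iU: True
      have "psd_operator ?x (sr1_update G ?x ?H ?ut ?v)"
        using N(5) iU unfolding x' Ht by (intro psd_sr1_update[OF psd _ s[unfolded x'] ls(4)]) simp_all
      then show ?thesis
        using iU True unfolding Hu_def x' Ht by simp
    next
      case False
      then show ?thesis using psd unfolding Hu_def x' Ht by simp
    qed
    moreover have "gs S (ms S (Suc k)) \<in> riem_subdiff G R f ?x'"
      using gm N(4) x' by simp
    moreover have "(?gt', alts S (Suc k)) \<in> hull_at ?x"
    proof -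
      let ?h = "transp_from_hat A G R T ?x ?y' ?g'"
      have al: "als S (Suc k) = dels S (Suc k)"
        using ls(4,8) True by auto
      \<comment> \<open>On a null step \<alpha> is \<delta>, a maximum that includes the locality
        term, so the new pair belongs to the bundle.\<close>
      have "(?h, als S (Suc k)) \<in> hull_at ?x"
        unfolding transp_from_hat_def transp_from_def \<eta>
      proof (rule subgradient_bundle_in_hull[OF ls(5,6)])
        have n: "tnorm G ?x (tRs S k *\<^sub>R ?d) = tRs S k * tnorm G ?x ?d"
          using ls(4) by simp
        show "\<gamma>\<^sub>l\<^sub>s L * tnorm G ?x (tRs S k *\<^sub>R ?d) powr \<nu>\<^sub>l\<^sub>s L \<le> als S (Suc k)"
          unfolding al ls(7) ls_delta_def n by (rule max.cobounded2)
      qed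
      then have sub: "convex hull {(?gm, 0), (?h, als S (Suc k)), (?gt, alts S k)} \<subseteq> hull_at ?x"
        using subgradient_in_hull[OF gm] hull by (intro hull_minimal convex_convex_hull) auto
      obtain l1 l2 l3 where l: "lams S k = (l1, l2, l3)" "0 \<le> l1" "0 \<le> l2" "0 \<le> l3" "l1 + l2 + l3 = 1"
        using N(1) by (auto simp: simplex3_def)
      have "(?gt', alts S (Suc k)) = l1 *\<^sub>R (?gm, 0) + l2 *\<^sub>R (?h, als S (Suc k)) + l3 *\<^sub>R (?gt, alts S k)"
        unfolding N(2,3) by (simp add: comb3_def l(1))
      also have "\<dots> \<in> convex hull {(?gm, 0), (?h, als S (Suc k)), (?gt, alts S k)}"
        unfolding convex_hull_3 using l by blast
      finally show ?thesis using sub by blast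
    qed
    ultimately show ?thesis unfolding x' by blast
  next
    case False
    then have t: "tLs S k = tRs S k" using ls(8) by blast
    have x': "?x' = R ?x (tRs S k *\<^sub>R ?d)" using ls(2) t by simp
    have y': "?y' = ?x'" using ls(3) x' by simp
    have N: "?gt' = ?g'" "alts S (Suc k) = 0" "ms S (Suc k) = Suc k" "iUs S (Suc k) \<longrightarrow> \<rho> < G ?x' ?u ?s"
      using branch[unfolded if_not_P[OF False]] by blast+
    have "psd_operator ?x' ?Ht"
      using psd_transport[OF psd, of "tRs S k *\<^sub>R ?d"] \<eta> y' x'
      by (simp add: transp_to_def[abs_def] transp_from_def[abs_def])
    moreover have "psd_operator ?x' (bfgs_update G ?x' ?Ht ?u ?s)" if "iUs S (Suc k)"
    proof (rule psd_bfgs_update)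
      show "0 < G ?x' ?u ?s"
        using N(4) that params(7) by linarith
    qed fact
    ultimately have "psd_operator ?x' Hu"
      using False by (simp add: Hu_def)
    moreover have "?g' \<in> riem_subdiff G R f ?x'"
      using ls(6) x' by simp
    ultimately show ?thesis
      using N subgradient_in_hull by simp
  qed
  have Hc: "psd_operator ?x' ?Hc'"
    unfolding Hc' using main params(12) psd_scale[of ?x' Hu "D\<^sub>r\<^sub>q P / tnorm G ?x' (Hu ?gt')"]
    by (simp only: split: if_split) simp
  have nc: "tnorm G ?x' (?Hc' ?gt') \<le> D\<^sub>r\<^sub>q P"
  proof (cases "tnorm G ?x' (Hu ?gt') > D\<^sub>r\<^sub>q P")
    case True
    then have "?Hc' ?gt' = (D\<^sub>r\<^sub>q P / tnorm G ?x' (Hu ?gt')) *\<^sub>R Hu ?gt'"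
      using Hc' by (simp only: if_True)
    then show ?thesis
      using True params(12) by (simp only: tnorm_scale) simp
  next
    case False
    then have "?Hc' = Hu" using Hc' by (simp only: if_False)
    then show ?thesis using False by simp
  qed
  have "psd_operator ?x' (Hs S (Suc k))"
    unfolding H' using Hc params(7) psd_shift[OF Hc, of \<rho>] by simp
  with main show "invariant (Suc k)"
    by (simp add: invariant_def)
  have a: "0 \<le> alts S (Suc k)"
    using main hull_at_nonneg by blast
  have g0: "0 \<le> G ?x' ?gt' (?Hc' ?gt')"
    using psd_operatorD(2,3)[OF Hc] by metis
  have r0: "0 \<le> \<rho> * (tnorm G ?x' ?gt')\<^sup>2"
    using params(7) by simp
  show "estimates (Suc k)"
  proof (cases ?correct)
    case True
    then have "ws S (Suc k) = ?wc' + \<rho> * (tnorm G ?x' ?gt')\<^sup>2" using w' by (simp only: if_True)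
    then show ?thesis unfolding estimates_def using a g0 r0 by linarith
  next
    \<comment> \<open>Without a correction the failed test itself says that w is at least \<rho>
      times the squared norm.\<close>
    case False
    then have "ws S (Suc k) = ?wc'" using w' by (simp only: if_False)
    then show ?thesis unfolding estimates_def using a g0 False by linarith
  qed
  have "tnorm G ?x' (\<rho> *\<^sub>R ?gt') \<le> tnorm G ?x' ?gt'"
    using params(7,8) mult_right_mono[of \<rho> 1 "tnorm G ?x' ?gt'"] by simp
  then have "tnorm G ?x' (?Hc' ?gt' + \<rho> *\<^sub>R ?gt') \<le> D\<^sub>r\<^sub>q P + tnorm G ?x' ?gt'"
    using tnorm_triangle[of ?x' "?Hc' ?gt'" "\<rho> *\<^sub>R ?gt'"] nc by linarith
  moreover have "tnorm G ?x' (?Hc' ?gt') \<le> D\<^sub>r\<^sub>q P + tnorm G ?x' ?gt'"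
    using nc tnorm_nonneg[of ?x' ?gt'] by linarith
  ultimately show "tnorm G ?x' (Hs S (Suc k) ?gt') \<le> D\<^sub>r\<^sub>q P + tnorm G ?x' ?gt'"
    unfolding H' by simp
qed

lemma invariant_all: "1 \<le> k \<Longrightarrow> invariant k"
proof (induction k rule: dec_induct)
  case base
  show ?case
    using init subgradient_in_hull[of "gs S 1" "xs S 1"] by (auto simp: invariant_def rq_init_def spd_imp_psd)
next
  case (step k)
  then show ?case using invariant_step(1) by simp
qed

text \<open>The index starts at 2 because the first operator is an input that has not been scaled to
  D.\<close>

lemma
  assumes "2 \<le> k"
  shows estimates_all: "estimates k"
    and direction_bound: "tnorm G (xs S k) (ds S k) \<le> D\<^sub>r\<^sub>q P + tnorm G (xs S k) (gts S k)"
proof -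
  obtain j where j: "k = Suc j" "1 \<le> j"
    using assms by (cases k) auto
  show "estimates k"
    using invariant_step(2)[OF j(2) invariant_all[OF j(2)]] j by simp
  have "tnorm G (xs S k) (Hs S k (gts S k)) \<le> D\<^sub>r\<^sub>q P + tnorm G (xs S k) (gts S k)"
    using invariant_step(3)[OF j(2) invariant_all[OF j(2)]] j by simp
  then show "tnorm G (xs S k) (ds S k) \<le> D\<^sub>r\<^sub>q P + tnorm G (xs S k) (gts S k)"
    using line_search_step(1)[of k] assms by simp
qed

section \<open>Monotone decrease and the contradiction at a cluster point\<close>

lemma descent:
  assumes "1 \<le> k"
  shows "f (xs S (Suc k)) \<le> f (xs S k) - \<theta>\<^sub>L L * tLs S k * ws S k"
  using line_search_step(2,8)[OF assms] by (auto simp: ls_serious_exit_def decrease_def)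

lemma tL_nonneg: "1 \<le> k \<Longrightarrow> 0 \<le> tLs S k"
  using line_search_step(4,8)[of k] by auto

lemma f_antimono: "j \<le> k \<Longrightarrow> 1 \<le> j \<Longrightarrow> f (xs S k) \<le> f (xs S j)"
proof (induction k rule: dec_induct)
  case (step k)
  have "0 \<le> \<theta>\<^sub>L L * tLs S k * ws S k"
    using step params(2) tL_nonneg[of k] ws_pos[of k] by simp
  then show ?case
    using step descent[of k] by simp
qed simp

lemma cluster_point_stationary:
  assumes serious: "infinite (serious_steps S)"
    and r: "strict_mono r" "(xs S \<circ> r) \<longlonglongrightarrow> x_star"
  shows "0 \<in> riem_subdiff G R f x_star"
proof (rule ccontr)
  assume "0 \<notin> riem_subdiff G R f x_star"
  then obtain \<omega> where "0 < \<omega>" and ev_w: "\<forall>\<^sub>F x in nhds x_star. \<forall>(g, a)\<in>hull_at x. \<forall>w.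
           \<rho> * (tnorm G x g)\<^sup>2 \<le> w \<and> 2 * a \<le> w \<longrightarrow> \<omega> \<le> w"
    using bundle_hull_not_stationary[of x_star "\<gamma>\<^sub>l\<^sub>s L" "\<nu>\<^sub>l\<^sub>s L" \<rho> \<mu>] params by auto
  obtain C where ev_C: "\<forall>\<^sub>F x in nhds x_star. \<forall>(g, a)\<in>hull_at x. 0 \<le> a \<and> tnorm G x g \<le> C"
    using bundle_hull_bounded[of "\<gamma>\<^sub>l\<^sub>s L" \<mu> "\<nu>\<^sub>l\<^sub>s L" x_star] params(3) by auto
  \<comment> \<open>Bounds the search directions at iterates near the cluster point; the maximum
    with 0 keeps it positive.\<close>
  define B where "B = D\<^sub>r\<^sub>q P + max C 0"
  have "0 < B" using params(12) by (simp add: B_def add_pos_nonneg)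
  obtain r0 where "0 < r0" and ev_\<delta>: "\<forall>\<^sub>F x in nhds x_star. \<forall>d t. \<forall>g\<in>riem_subdiff G R f (R x (t *\<^sub>R d)).
           0 \<le> t \<and> t * tnorm G x d \<le> \<mu> \<and> t * tnorm G x d \<le> r0 \<longrightarrow> ls_delta A G R T f L x d t g \<le> \<theta>\<^sub>A L * \<omega>"
    using ls_delta_small[of "\<theta>\<^sub>A L * \<omega>" \<mu> L x_star] params \<open>0 < \<omega>\<close> by auto
  \<comment> \<open>A serious step shorter than \<tau> would miss the threshold for t and move by at
    most r0; then \<delta> \<le> \<theta>_A \<omega> \<le> \<theta>_A w, so neither alternative of
    the serious exit would hold.\<close>
  define \<tau> where "\<tau> = min (tmin\<^sub>r\<^sub>q P) (r0 / B)"
  have "0 < \<tau>" using params(9) \<open>0 < r0\<close> \<open>0 < B\<close> by (simp add: \<tau>_def)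
  \<comment> \<open>Quantified over all k with iterate x, since the serious step to which it is
    applied may come later than the subsequence index while starting at the same point.\<close>
  have drop: "\<forall>\<^sub>F x in nhds x_star. \<forall>k. k \<in> serious_steps S \<and> 2 \<le> k \<and> xs S k = x \<longrightarrow>
      f (xs S (Suc k)) \<le> f (xs S k) - \<theta>\<^sub>L L * \<tau> * \<omega>"
    using ev_w ev_C ev_\<delta>
  proof eventually_elim
    case (elim x)
    show ?case
    proof (intro allI impI)
      fix k assume k: "k \<in> serious_steps S \<and> 2 \<le> k \<and> xs S k = x"
      then have k1: "1 \<le> k" and "0 < tLs S k" and x: "x = xs S k" by (auto simp: serious_steps_def)
      note ls = line_search_step[OF k1]
      have t: "tLs S k = tRs S k"
        and exit: "tmin\<^sub>r\<^sub>q P \<le> tRs S k \<or> \<theta>\<^sub>A L * ws S k < dels S (Suc k)"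
        using ls(8) \<open>0 < tLs S k\<close> by (auto simp: ls_serious_exit_def)
      have hull: "(gts S k, alts S k) \<in> hull_at x"
        using invariant_all[OF k1] by (simp add: invariant_def x)
      have "\<omega> \<le> ws S k"
        using elim(1) hull estimates_all[of k] k unfolding estimates_def x by blast
      have "tnorm G x (gts S k) \<le> C"
        using elim(2) hull by blast
      then have "tnorm G x (ds S k) \<le> B"
        using direction_bound[of k] k by (auto simp: B_def)
      have "\<tau> \<le> tRs S k"
      proof (rule ccontr)
        assume "\<not> \<tau> \<le> tRs S k"
        then have lt: "tRs S k < tmin\<^sub>r\<^sub>q P" "tRs S k \<le> r0 / B" by (auto simp: \<tau>_def)
        have "tRs S k * tnorm G x (ds S k) \<le> (r0 / B) * B"
          using lt(2) \<open>tnorm G x (ds S k) \<le> B\<close> ls(4) \<open>0 < r0\<close> \<open>0 < B\<close> by (intro mult_mono) auto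
        also have "\<dots> = r0" using \<open>0 < B\<close> by simp
        finally have "tRs S k * tnorm G x (ds S k) \<le> r0" .
        moreover have "tRs S k * tnorm G x (ds S k) \<le> \<mu>"
          using ls(4,5) by (simp add: x)
        ultimately have "dels S (Suc k) \<le> \<theta>\<^sub>A L * \<omega>"
          using elim(3) ls(4,6) unfolding ls(7) x by (meson less_imp_le)
        also have "\<dots> \<le> \<theta>\<^sub>A L * ws S k"
          using \<open>\<omega> \<le> ws S k\<close> params(1) by simp
        finally show False using exit lt(1) by linarith
      qed
      then have "\<theta>\<^sub>L L * \<tau> * \<omega> \<le> \<theta>\<^sub>L L * tLs S k * ws S k"
        using \<open>\<omega> \<le> ws S k\<close> \<open>0 < \<tau>\<close> \<open>0 < \<omega>\<close> params(2) unfolding t by (intro mult_mono) auto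
      then show "f (xs S (Suc k)) \<le> f (xs S k) - \<theta>\<^sub>L L * \<tau> * \<omega>"
        using descent[OF k1] by linarith
    qed
  qed
  have r_ge: "j \<le> r j" for j
    using r(1) by (rule seq_suble)
  have "(\<lambda>j. f ((xs S \<circ> r) j)) \<longlonglongrightarrow> f x_star"
    by (rule filterlim_compose[OF tendsto_locally_lipschitz r(2)])
  then have lim: "(\<lambda>j. f (xs S (r j))) \<longlonglongrightarrow> f x_star" by simp
  \<comment> \<open>The values decrease along the whole sequence, so the limit along the subsequence
    bounds all of them from below.\<close>
  have lower: "f x_star \<le> f (xs S k)" if "1 \<le> k" for k
  proof (rule tendsto_upperbound[OF lim])
    show "\<forall>\<^sub>F j in sequentially. f (xs S (r j)) \<le> f (xs S k)"
      using eventually_ge_at_top[of k] by eventually_elim (meson f_antimono that r_ge order_trans)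
  qed simp
  define e where "e = \<theta>\<^sub>L L * \<tau> * \<omega>"
  have "0 < e" using params(2) \<open>0 < \<tau>\<close> \<open>0 < \<omega>\<close> by (simp add: e_def)
  have "\<forall>\<^sub>F j in sequentially. f (xs S (r j)) < f x_star + e"
    using \<open>0 < e\<close> by (intro order_tendstoD(2)[OF lim]) simp
  moreover have "\<forall>\<^sub>F j in sequentially. \<forall>k. k \<in> serious_steps S \<and> 2 \<le> k \<and> xs S k = (xs S \<circ> r) j \<longrightarrow>
      f (xs S (Suc k)) \<le> f (xs S k) - e"
    using eventually_compose_filterlim[OF drop r(2)] unfolding e_def .
  ultimately have "\<forall>\<^sub>F j in sequentially. 2 \<le> j \<and> f (xs S (r j)) < f x_star + e \<and>
      (\<forall>k. k \<in> serious_steps S \<and> 2 \<le> k \<and> xs S k = (xs S \<circ> r) j \<longrightarrow> f (xs S (Suc k)) \<le> f (xs S k) - e)"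
    using eventually_ge_at_top[of 2] by eventually_elim blast
  then obtain j where j: "2 \<le> j" "f (xs S (r j)) < f x_star + e"
    "\<And>k. k \<in> serious_steps S \<Longrightarrow> 2 \<le> k \<Longrightarrow> xs S k = xs S (r j) \<Longrightarrow> f (xs S (Suc k)) \<le> f (xs S k) - e"
    by (auto dest!: eventually_happens)
  text \<open>Null steps do not move the iterate, so the next serious step starts at the same point.\<close>
  have "2 \<le> r j" using j(1) r_ge[of j] by linarith
  define k where "k = (LEAST k. r j \<le> k \<and> k \<in> serious_steps S)"
  have "\<exists>k. r j \<le> k \<and> k \<in> serious_steps S"
    using serious unfolding infinite_nat_iff_unbounded_le by blast
  then have k: "r j \<le> k" "k \<in> serious_steps S"
    unfolding k_def by (metis (mono_tags, lifting) LeastI_ex)+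
  have "xs S i = xs S (r j)" if "r j \<le> i" "i \<le> k" for i
    using that
  proof (induction i rule: dec_induct)
    case (step i)
    have "1 \<le> i" using step \<open>2 \<le> r j\<close> by simp
    have "i \<notin> serious_steps S"
      using step not_less_Least[of i "\<lambda>k. r j \<le> k \<and> k \<in> serious_steps S"] unfolding k_def[symmetric] by auto
    then have "tLs S i = 0"
      using \<open>1 \<le> i\<close> tL_nonneg[of i] by (auto simp: serious_steps_def)
    then show ?case
      using step line_search_step(2)[OF \<open>1 \<le> i\<close>] by simp
  qed simp
  then have "xs S k = xs S (r j)" using k by blast
  then have "f (xs S (Suc k)) \<le> f (xs S (r j)) - e"
    using j(3)[OF k(2)] k(1) \<open>2 \<le> r j\<close> by simp
  then show False
    using lower[of "Suc k"] j(2) by simp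
qed

end

theorem theorem4p3:
  fixes A :: "('m::{t2_space, second_countable_topology}, 'e::euclidean_space) chart set"
    and G :: "('m, 'e) metric"
    and R :: "'m \<Rightarrow> 'e \<Rightarrow> 'm"
    and T :: "'m \<Rightarrow> 'e \<Rightarrow> 'e \<Rightarrow> 'e"
    and f :: "'m \<Rightarrow> real"
    and L :: ls_params
    and P :: rq_params
    and S :: "('m, 'e) rq_run"
    and x_star :: 'm
  assumes "riemannian_manifold A G" and "riem_complete A G"
    and "manifold_retraction A R" and "vector_transport A R T"
    and "riem_locally_lipschitz A G f"
    and "isometric_transport G R T" and "locking_condition A G R T"
    and "0 < Inj G R"
    and "riem_bounded A G {x. f x \<le> f (xs S 1)}"
    and "valid_ls_params L" and "valid_rq_params G R P" and "\<epsilon>\<^sub>r\<^sub>q P = 0"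
    and "rq_infinite_run A G R T f L P S"
    and "infinite (serious_steps S)"
    and "\<exists>r :: nat \<Rightarrow> nat. strict_mono r \<and> (xs S \<circ> r) \<longlonglongrightarrow> x_star"
  shows "0 \<in> riem_subdiff G R f x_star"
proof -
  interpret rqnbm A G R f T L P S
    by unfold_locales (use assms in auto)
  show ?thesis
    using cluster_point_stationary assms(14,15) by blast
qed

end
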